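(* Consider the stochastic Schrödinger equation $$\mathrm{i}\,\mathrm{d}u(t)=\Delta u(t)\,\mathrm{d}t+F(u(t))\,\mathrm{d}t+\alpha\,\mathrm{d}W^Q(t),\qquad u(0)=u_0,$$ on the torus $\mathbb{T}^d$, with a trace class covariance operator $Q$ and an initial value satisfying $\mathbb{E}[M(u_0)]<\infty$, where $M(u)=\|u\|_{L^2}^2$ is the mass. Assume that $F(u)=V[u]u$, where $V[u]$ is real-valued and a function of the modulus $|u|$; that an exact global (mild) solution $u$ exists; and that the differential equation $\mathrm{i}\dot u=F(u)=V[u]u$ can be solved exactly, with flow $\Phi_t(u)=\mathrm{e}^{-\mathrm{i}tV[u]}u$. Then the exact solution satisfies the trace formula for the mass $$\mathbb{E}[M(u(t))]=\mathbb{E}[M(u_0)]+t\alpha^2\,\mathrm{Tr}(Q)\qquad\text{for all } t\ge 0.$$ Furthermore, the numerical solution given by the splitting scheme $u_{n+1}=S(\tau)\bigl(\Phi_\tau(u_n)-\mathrm{i}\alpha\,\delta W_n^Q\bigr)$ satisfies the same trace formula: $$\mathbb{E}[M(u_n)]=\mathbb{E}[M(u_0)]+t_n\alpha^2\,\mathrm{Tr}(Q)\qquad\text{for all } t_n=n\tau,\ n\ge0.$$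
   Context: $\mathbb{T}^d$ is the $d$-dimensional torus; $L^2=L^2(\mathbb{T}^d;\mathbb{C})$ with $\langle u,v\rangle=\int\bar u v\,\mathrm{d}x$, $\|u\|_{L^2}^2=\langle u,u\rangle$; $\alpha>0$ is real; $S(t)=\mathrm{e}^{-\mathrm{i}t\Delta}$, a group of isometries of $L^2$. Noise: $W^Q(t)=\sum_{k\in\mathbb{N}}\gamma_k\beta_k(t)e_k$, where $(e_k)$ is a complete orthonormal system of $L^2$, $(\beta_k)$ are independent real-valued standard Wiener processes on a stochastic basis $(\Omega,\mathcal{F},\mathbb{P},(\mathcal{F}(t))_{t\ge0})$, and $(\gamma_k)$ are complex numbers with $\sum_k|\gamma_k|^2<\infty$ (trace class); $\mathrm{Tr}(Q):=\sum_k|\gamma_k|^2$. The initial value $u_0$ is an $\mathcal{F}(0)$-measurable $L^2$-valued random variable. $V$ assigns to each $u\in L^2$ a real-valued measurable function $V[u]$ on $\mathbb{T}^d$, with $V[u_1]=V[u_2]$ whenever $|u_1|=|u_2|$; the maps $\Phi_t:L^2\to L^2$ are Borel measurable. An exact global solution is an adapted process $u$ with continuous paths in $L^2$ such that almost surely $s\mapsto F(u(s))$ is locally integrable with values in $L^2$ and, for all $t\ge0$, $$u(t)=S(t)u_0-\mathrm{i}\int_0^tS(t-s)F(u(s))\,\mathrm{d}s-\mathrm{i}\alpha\int_0^tS(t-s)\,\mathrm{d}W^Q(s).$$ Scheme: $\tau>0$ is the time-step size, the recursion starts from $u_0$, and $\delta W_n^Q=W^Q((n+1)\tau)-W^Q(n\tau)$.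 *)

theory Defs
  imports "HOL-Probability.Probability"
begin

section \<open>The Hilbert space of square-integrable functions on the torus\<close>

text \<open>
  The torus is $(\mathbb{R}/2\pi\mathbb{Z})^d$ with $d$ the cardinality of the index type; functions
  on it are functions on the fundamental cell, which carries Lebesgue measure.
\<close>

definition torus :: "(real ^ 'n::finite) measure"
  where "torus = restrict_space lborel {x. \<forall>i. x $ i \<in> {0..<2 * pi}}"

definition square_integrable :: "(real ^ 'n::finite \<Rightarrow> complex) \<Rightarrow> bool"
  where "square_integrable f \<longleftrightarrow>
    f \<in> borel_measurable torus \<and> integrable torus (\<lambda>x. (cmod (f x))\<^sup>2)"

lemma torus_cell_borel: "{x :: real ^ 'n::finite. \<forall>i. x $ i \<in> {0..<2 * pi}} \<in> sets borel"
proof -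
  have "{x :: real ^ 'n. \<forall>i. x $ i \<in> {0..<2 * pi}} = (\<Inter>i. (\<lambda>x. x $ i) -` {0..<2 * pi})"
    by auto
  moreover have "(\<lambda>x :: real ^ 'n. x $ i) -` {0..<2 * pi} \<in> sets borel" for i
    using measurable_sets_borel[of "\<lambda>x :: real ^ 'n. x $ i" borel "{0..<2 * pi}"] by simp
  ultimately show ?thesis
    by auto
qed

lemma finite_measure_torus: "finite_measure (torus :: (real ^ 'n::finite) measure)"
proof
  let ?S = "{x :: real ^ 'n. \<forall>i. x $ i \<in> {0..<2 * pi}}"
  have sub: "?S \<subseteq> cbox 0 (\<chi> i. 2 * pi)"
    by (auto simp: mem_box_cart less_imp_le)
  have "emeasure lborel ?S \<le> emeasure lborel (cbox 0 (\<chi> i. 2 * pi) :: (real ^ 'n) set)"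
    by (intro emeasure_mono[OF sub]) simp
  also have "\<dots> < \<infinity>"
    by (intro emeasure_lborel_cbox_finite)
  finally show "emeasure (torus :: (real ^ 'n) measure) (space torus) \<noteq> \<infinity>"
    using torus_cell_borel
    by (simp add: torus_def space_restrict_space emeasure_restrict_space)
qed

interpretation torus: finite_measure "torus :: (real ^ 'n::finite) measure"
  by (rule finite_measure_torus)

lemma square_integrable_zero: "square_integrable (\<lambda>x. 0)"
  by (simp add: square_integrable_def)

lemma square_integrable_add:
  assumes "square_integrable f" "square_integrable g"
  shows "square_integrable (\<lambda>x. f x + g x)"
proof -
  have [measurable]: "f \<in> borel_measurable torus" "g \<in> borel_measurable torus"
    using assms by (auto simp: square_integrable_def)
  have le: "(cmod (f x + g x))\<^sup>2 \<le> 2 * (cmod (f x))\<^sup>2 + 2 * (cmod (g x))\<^sup>2" for x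
  proof -
    have "(cmod (f x + g x))\<^sup>2 \<le> (cmod (f x) + cmod (g x))\<^sup>2"
      by (intro power_mono norm_triangle_ineq) simp
    then show ?thesis
      using sum_squares_bound[of "cmod (f x)" "cmod (g x)"] by (simp add: power2_sum)
  qed
  have "integrable torus (\<lambda>x. 2 * (cmod (f x))\<^sup>2 + 2 * (cmod (g x))\<^sup>2)"
    using assms by (auto simp: square_integrable_def)
  then have "integrable torus (\<lambda>x. (cmod (f x + g x))\<^sup>2)"
    by (rule Bochner_Integration.integrable_bound) (use le in \<open>auto intro!: AE_I2\<close>)
  then show ?thesis
    by (simp add: square_integrable_def)
qed

lemma square_integrable_cmult:
  assumes "square_integrable f"
  shows "square_integrable (\<lambda>x. c * f x)"
  using assms by (auto simp: square_integrable_def norm_mult power_mult_distrib)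

lemma square_integrable_diff:
  assumes "square_integrable f" "square_integrable g"
  shows "square_integrable (\<lambda>x. f x - g x)"
  using square_integrable_add[OF assms(1) square_integrable_cmult[OF assms(2), of "-1"]] by simp

lemma borel_measurable_cnj [measurable (raw)]:
  assumes "f \<in> borel_measurable M"
  shows "(\<lambda>x. cnj (f x)) \<in> borel_measurable M"
  using measurable_compose[OF assms borel_measurable_continuous_onI[of cnj]]
  by (simp add: continuous_on_cnj)

lemma integrable_mult_cnj:
  assumes "square_integrable f" "square_integrable g"
  shows "integrable torus (\<lambda>x. cnj (f x) * g x)"
proof -
  have [measurable]: "f \<in> borel_measurable torus" "g \<in> borel_measurable torus"
    using assms by (auto simp: square_integrable_def)
  have le: "cmod (cnj (f x) * g x) \<le> (cmod (f x))\<^sup>2 + (cmod (g x))\<^sup>2" for x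
  proof -
    have "2 * (cmod (f x) * cmod (g x)) \<le> (cmod (f x))\<^sup>2 + (cmod (g x))\<^sup>2"
      using sum_squares_bound[of "cmod (f x)" "cmod (g x)"] by simp
    moreover have "0 \<le> cmod (f x) * cmod (g x)" by simp
    ultimately show ?thesis by (simp only: norm_mult complex_mod_cnj)
  qed
  have "integrable torus (\<lambda>x. (cmod (f x))\<^sup>2 + (cmod (g x))\<^sup>2)"
    using assms by (auto simp: square_integrable_def)
  then show ?thesis
    by (rule Bochner_Integration.integrable_bound) (use le in \<open>auto intro!: AE_I2 borel_measurable_cnj simp del: norm_mult\<close>)
qed

quotient_type (overloaded) 'n l2_torus = "real ^ ('n::finite) \<Rightarrow> complex"
  / partial: "\<lambda>f g. square_integrable f \<and> square_integrable g \<and> (AE x in torus. f x = g x)"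
proof (rule part_equivpI)
  show "\<exists>x :: real ^ 'n \<Rightarrow> complex. square_integrable x \<and> square_integrable x \<and> (AE y in torus. x y = x y)"
    using square_integrable_zero by blast
qed (auto intro!: sympI transpI)

text \<open>
  Elements are almost-everywhere classes.  \<open>rep_l2_torus\<close> chooses a representative; \<open>L2_class\<close> is
  the class of a function, and is zero on functions that are not square-integrable.
\<close>

definition L2_class :: "(real ^ 'n::finite \<Rightarrow> complex) \<Rightarrow> 'n l2_torus"
  where "L2_class f = abs_l2_torus (if square_integrable f then f else (\<lambda>x. 0))"

lemma square_integrable_rep [simp]: "square_integrable (rep_l2_torus u)"
  using Quotient_rep_reflp[OF Quotient_l2_torus, of u] by simp

lemma abs_rep_l2_torus [simp]: "abs_l2_torus (rep_l2_torus u) = u"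
  by (rule Quotient_abs_rep[OF Quotient_l2_torus])

lemma L2_class_rep [simp]: "L2_class (rep_l2_torus u) = u"
  by (simp add: L2_class_def)

lemma rep_L2_class:
  assumes "square_integrable f"
  shows "AE x in torus. rep_l2_torus (L2_class f) x = f x"
  using rep_abs_rsp_left[OF Quotient3_l2_torus, of f f] assms by (simp add: L2_class_def)

lemma L2_class_eqI:
  assumes "square_integrable f" "square_integrable g" "AE x in torus. f x = g x"
  shows "L2_class f = L2_class g"
  using assms Quotient_rel_abs[OF Quotient_l2_torus, of f g] by (simp add: L2_class_def)

lemma l2_torus_eqI:
  assumes "AE x in torus. rep_l2_torus u x = rep_l2_torus v x"
  shows "u = v"
  using L2_class_eqI[of "rep_l2_torus u" "rep_l2_torus v"] assms by simp

lift_definition scaleC :: "complex \<Rightarrow> 'n::finite l2_torus \<Rightarrow> 'n l2_torus"  (infixr \<open>*\<^sub>C\<close> 75)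
  is "\<lambda>c f x. c * f x"
  by (auto intro: square_integrable_cmult)

lift_definition cinner :: "'n::finite l2_torus \<Rightarrow> 'n l2_torus \<Rightarrow> complex"
  is "\<lambda>f g. \<integral>x. cnj (f x) * g x \<partial>torus"
proof -
  fix f f' g g' :: "real ^ 'n \<Rightarrow> complex"
  assume "square_integrable f \<and> square_integrable f' \<and> (AE x in torus. f x = f' x)"
    and "square_integrable g \<and> square_integrable g' \<and> (AE x in torus. g x = g' x)"
  then show "(\<integral>x. cnj (f x) * g x \<partial>torus) = (\<integral>x. cnj (f' x) * g' x \<partial>torus)"
    by (intro integral_cong_AE) (auto simp: square_integrable_def intro!: borel_measurable_cnj)
qed

instantiation l2_torus :: (finite) real_inner
begin

lift_definition zero_l2_torus :: "'a l2_torus" is "\<lambda>x. 0"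
  by (simp add: square_integrable_zero)

lift_definition plus_l2_torus :: "'a l2_torus \<Rightarrow> 'a l2_torus \<Rightarrow> 'a l2_torus" is "\<lambda>f g x. f x + g x"
  by (auto intro: square_integrable_add)

lift_definition minus_l2_torus :: "'a l2_torus \<Rightarrow> 'a l2_torus \<Rightarrow> 'a l2_torus" is "\<lambda>f g x. f x - g x"
  by (auto intro: square_integrable_diff)

lift_definition uminus_l2_torus :: "'a l2_torus \<Rightarrow> 'a l2_torus" is "\<lambda>f x. - f x"
  using square_integrable_cmult[of _ "-1"] by auto

lift_definition scaleR_l2_torus :: "real \<Rightarrow> 'a l2_torus \<Rightarrow> 'a l2_torus"
  is "\<lambda>c f x. complex_of_real c * f x"
  by (auto intro: square_integrable_cmult)

lift_definition norm_l2_torus :: "'a l2_torus \<Rightarrow> real" is "\<lambda>f. sqrt (\<integral>x. (cmod (f x))\<^sup>2 \<partial>torus)"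
proof -
  fix f g :: "real ^ 'a \<Rightarrow> complex"
  assume "square_integrable f \<and> square_integrable g \<and> (AE x in torus. f x = g x)"
  then have "(\<integral>x. (cmod (f x))\<^sup>2 \<partial>torus) = (\<integral>x. (cmod (g x))\<^sup>2 \<partial>torus)"
    by (intro integral_cong_AE) (auto simp: square_integrable_def)
  then show "sqrt (\<integral>x. (cmod (f x))\<^sup>2 \<partial>torus) = sqrt (\<integral>x. (cmod (g x))\<^sup>2 \<partial>torus)"
    by simp
qed

definition inner_l2_torus :: "'a l2_torus \<Rightarrow> 'a l2_torus \<Rightarrow> real"
  where "inner_l2_torus u v = Re (cinner u v)"

definition dist_l2_torus :: "'a l2_torus \<Rightarrow> 'a l2_torus \<Rightarrow> real"
  where "dist_l2_torus u v = norm (u - v)"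

definition sgn_l2_torus :: "'a l2_torus \<Rightarrow> 'a l2_torus"
  where "sgn_l2_torus u = scaleR (inverse (norm u)) u"

definition uniformity_l2_torus :: "('a l2_torus \<times> 'a l2_torus) filter"
  where "uniformity_l2_torus = (INF e\<in>{0 <..}. principal {(u, v). dist u v < e})"

definition open_l2_torus :: "'a l2_torus set \<Rightarrow> bool"
  where "open_l2_torus U \<longleftrightarrow> (\<forall>u\<in>U. eventually (\<lambda>(u', v). u' = u \<longrightarrow> v \<in> U) uniformity)"

instance
proof
  fix u v w :: "'a l2_torus" and a b :: real and U :: "'a l2_torus set"
  show "u + v + w = u + (v + w)"
    by transfer (auto simp: algebra_simps intro: square_integrable_add)
  show "u + v = v + u"
    by transfer (auto simp: algebra_simps intro: square_integrable_add)
  show "0 + u = u"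
    by transfer auto
  show "- u + u = 0"
    by transfer (auto simp: square_integrable_zero)
  show "u - v = u + - v"
    by transfer (auto intro: square_integrable_diff)
  show "a *\<^sub>R (u + v) = a *\<^sub>R u + a *\<^sub>R v"
    by transfer (auto simp: distrib_left distrib_right
        intro!: square_integrable_add square_integrable_cmult)
  show "(a + b) *\<^sub>R u = a *\<^sub>R u + b *\<^sub>R u"
    by transfer (auto simp: distrib_left distrib_right
        intro!: square_integrable_add square_integrable_cmult)
  show "a *\<^sub>R b *\<^sub>R u = (a * b) *\<^sub>R u"
    by transfer (auto simp: mult.assoc intro!: square_integrable_cmult)
  show "1 *\<^sub>R u = u"
    by transfer auto
  show "dist u v = norm (u - v)"
    by (rule dist_l2_torus_def)
  show "sgn u = scaleR (inverse (norm u)) u"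
    by (rule sgn_l2_torus_def)
  show "(uniformity :: ('a l2_torus \<times> 'a l2_torus) filter)
      = (INF e\<in>{0 <..}. principal {(u, v). dist u v < e})"
    by (rule uniformity_l2_torus_def)
  show "open U \<longleftrightarrow> (\<forall>u\<in>U. eventually (\<lambda>(u', v). u' = u \<longrightarrow> v \<in> U) uniformity)"
    by (rule open_l2_torus_def)
  show "inner u v = inner v u"
    unfolding inner_l2_torus_def
  proof transfer
    fix f g :: "real ^ 'a \<Rightarrow> complex"
    have "cnj (\<integral>x. cnj (g x) * f x \<partial>torus) = (\<integral>x. cnj (cnj (g x) * f x) \<partial>torus)"
      by (rule Bochner_Integration.integral_cnj[symmetric])
    also have "\<dots> = (\<integral>x. cnj (f x) * g x \<partial>torus)"
      by (simp add: mult.commute)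
    finally have "(\<integral>x. cnj (f x) * g x \<partial>torus) = cnj (\<integral>x. cnj (g x) * f x \<partial>torus)"
      by simp
    then show "Re (\<integral>x. cnj (f x) * g x \<partial>torus) = Re (\<integral>x. cnj (g x) * f x \<partial>torus)"
      by simp
  qed
  show "inner (u + v) w = inner u w + inner v w"
    unfolding inner_l2_torus_def
    by transfer (simp add: distrib_right integrable_mult_cnj)
  show "inner (a *\<^sub>R u) v = a * inner u v"
    unfolding inner_l2_torus_def
    by transfer (simp add: mult.assoc)
  have norm_sq: "inner u u = (norm u)\<^sup>2"
    unfolding inner_l2_torus_def
  proof transfer
    fix f :: "real ^ 'a \<Rightarrow> complex"
    have "cnj (f x) * f x = complex_of_real ((cmod (f x))\<^sup>2)" for x
      by (subst mult.commute) (rule complex_norm_square[symmetric])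
    then have "(\<integral>x. cnj (f x) * f x \<partial>torus) = complex_of_real (\<integral>x. (cmod (f x))\<^sup>2 \<partial>torus)"
      by (simp only: integral_complex_of_real)
    then show "Re (\<integral>x. cnj (f x) * f x \<partial>torus) = (sqrt (\<integral>x. (cmod (f x))\<^sup>2 \<partial>torus))\<^sup>2"
      by simp
  qed
  show "0 \<le> inner u u"
    by (simp add: norm_sq)
  show "norm u = sqrt (inner u u)"
    unfolding norm_sq by (simp, transfer, simp)
  show "inner u u = 0 \<longleftrightarrow> u = 0"
    unfolding norm_sq power_eq_0_iff
  proof transfer
    fix f :: "real ^ 'a \<Rightarrow> complex"
    assume "square_integrable f \<and> square_integrable f \<and> (AE x in torus. f x = f x)"
    then show "(sqrt (\<integral>x. (cmod (f x))\<^sup>2 \<partial>torus) = 0 \<and> 0 < (2::nat)) \<longleftrightarrow>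
        (square_integrable f \<and> square_integrable (\<lambda>x. 0) \<and> (AE x in torus. f x = 0))"
      using integral_nonneg_eq_0_iff_AE[of torus "\<lambda>x. (cmod (f x))\<^sup>2"]
      by (auto simp: square_integrable_def)
  qed
qed

end

lemma norm_L2_class:
  assumes "square_integrable f"
  shows "(norm (L2_class f))\<^sup>2 = (\<integral>x. (cmod (f x))\<^sup>2 \<partial>torus)"
  using assms by (simp add: L2_class_def norm_l2_torus.abs_eq)

lemma nn_integral_square:
  assumes "square_integrable f"
  shows "(\<integral>\<^sup>+x. ennreal ((cmod (f x))\<^sup>2) \<partial>torus) = ennreal ((norm (L2_class f))\<^sup>2)"
  using assms by (simp add: norm_L2_class nn_integral_eq_integral square_integrable_def)

lemma L2_class_add:
  assumes "square_integrable f" "square_integrable g"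
  shows "L2_class (\<lambda>x. f x + g x) = L2_class f + L2_class g"
  using assms square_integrable_add[OF assms] by (simp add: L2_class_def plus_l2_torus.abs_eq)

lemma L2_class_diff:
  assumes "square_integrable f" "square_integrable g"
  shows "L2_class (\<lambda>x. f x - g x) = L2_class f - L2_class g"
  using assms square_integrable_diff[OF assms] by (simp add: L2_class_def minus_l2_torus.abs_eq)

lemma L2_class_scaleC:
  assumes "square_integrable f"
  shows "L2_class (\<lambda>x. c * f x) = c *\<^sub>C L2_class f"
  using assms square_integrable_cmult[OF assms] by (simp add: L2_class_def scaleC.abs_eq)

lemma L2_class_zero: "L2_class (\<lambda>x. 0) = 0"
  by (simp add: L2_class_def zero_l2_torus_def)

lemma rep_diff:
  "AE x in torus. rep_l2_torus (u - v) x = rep_l2_torus u x - rep_l2_torus v x"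
  using rep_L2_class[OF square_integrable_diff[of "rep_l2_torus u" "rep_l2_torus v"]]
  by (simp add: L2_class_diff)

lemma scaleR_eq_scaleC: "a *\<^sub>R u = complex_of_real a *\<^sub>C u" for u :: "'n::finite l2_torus"
  by transfer (auto intro: square_integrable_cmult)

lemma scaleC_add_right: "c *\<^sub>C (u + v) = c *\<^sub>C u + c *\<^sub>C v"
  by transfer (auto simp: distrib_left intro!: square_integrable_add square_integrable_cmult)

lemma scaleC_add_left: "(c + d) *\<^sub>C u = c *\<^sub>C u + d *\<^sub>C u"
  by transfer (auto simp: distrib_right intro!: square_integrable_add square_integrable_cmult)

lemma scaleC_zero_right [simp]: "c *\<^sub>C 0 = 0"
  by transfer (simp add: square_integrable_zero)

lemma scaleC_scaleC: "c *\<^sub>C d *\<^sub>C u = (c * d) *\<^sub>C u"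
  by transfer (auto simp: mult.assoc intro!: square_integrable_cmult)

lemma norm_scaleC: "norm (c *\<^sub>C u) = cmod c * norm u"
  by transfer (simp add: norm_mult power_mult_distrib real_sqrt_mult)

lemma Cauchy_converges_fast:
  fixes X :: "nat \<Rightarrow> 'n::finite l2_torus"
  assumes "Cauchy X" and fast: "\<And>n. norm (X (Suc n) - X n) \<le> (1/2) ^ n"
  shows "convergent X"
proof -
  define f where "f n = rep_l2_torus (X n)" for n
  have sq: "square_integrable (f n)" for n
    by (simp add: f_def)
  have X_eq: "X n = L2_class (f n)" for n
    by (simp add: f_def)
  have [measurable]: "f n \<in> borel_measurable torus" for n
    using sq[of n] by (simp add: square_integrable_def)
  have nn_diff: "(\<integral>\<^sup>+x. ennreal ((cmod (f m x - f n x))\<^sup>2) \<partial>torus) = ennreal ((norm (X m - X n))\<^sup>2)" for m n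
    by (simp add: nn_integral_square square_integrable_diff sq L2_class_diff X_eq)
  define \<mu> where "\<mu> = measure (torus :: (real ^ 'n) measure) (space torus)"
  have step: "(\<integral>\<^sup>+x. ennreal (cmod (f (Suc n) x - f n x)) \<partial>torus) \<le> ennreal ((1 + \<mu>) * (1/2) ^ n)" for n
  proof -
    have le: "a \<le> 2 ^ n * a\<^sup>2 + (1/2) ^ n" for a :: real
    proof -
      have "0 \<le> (2 ^ n * a - 1 / 2)\<^sup>2" by simp
      then have "2 ^ n * a \<le> 2 ^ n * (2 ^ n * a\<^sup>2) + 1"
        by (simp add: power2_eq_square algebra_simps)
      then have "2 ^ n * a \<le> 2 ^ n * (2 ^ n * a\<^sup>2 + (1/2) ^ n)"
        by (simp add: distrib_left power_one_over)
      then show ?thesis by simp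
    qed
    have "(\<integral>\<^sup>+x. ennreal (cmod (f (Suc n) x - f n x)) \<partial>torus)
        \<le> (\<integral>\<^sup>+x. ennreal (2 ^ n) * ennreal ((cmod (f (Suc n) x - f n x))\<^sup>2) + ennreal ((1/2) ^ n) \<partial>torus)"
      by (intro nn_integral_mono) (simp add: ennreal_mult[symmetric] ennreal_plus[symmetric] le del: ennreal_plus)
    also have "\<dots> = ennreal (2 ^ n) * ennreal ((norm (X (Suc n) - X n))\<^sup>2) + ennreal ((1/2) ^ n) * ennreal \<mu>"
      by (simp add: nn_integral_add nn_integral_cmult nn_diff \<mu>_def torus.emeasure_eq_measure)
    also have "\<dots> \<le> ennreal (2 ^ n) * ennreal (((1/2) ^ n)\<^sup>2) + ennreal ((1/2) ^ n) * ennreal \<mu>"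
      by (intro add_mono mult_left_mono ennreal_leI power_mono fast) auto
    also have "\<dots> = ennreal (2 ^ n * ((1/2) ^ n)\<^sup>2 + (1/2) ^ n * \<mu>)"
      by (simp add: ennreal_mult[symmetric] ennreal_plus[symmetric] \<mu>_def del: ennreal_plus)
    also have "2 ^ n * ((1/2) ^ n)\<^sup>2 + (1/2) ^ n * \<mu> = (1 + \<mu>) * (1/2) ^ n"
      by (simp add: power2_eq_square distrib_right power_one_over add_divide_distrib)
    finally show ?thesis .
  qed
  have "(\<integral>\<^sup>+x. (\<Sum>n. ennreal (cmod (f (Suc n) x - f n x))) \<partial>torus)
      = (\<Sum>n. \<integral>\<^sup>+x. ennreal (cmod (f (Suc n) x - f n x)) \<partial>torus)"
    by (intro nn_integral_suminf) measurable
  also have "\<dots> \<le> (\<Sum>n. ennreal ((1 + \<mu>) * (1/2) ^ n))"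
    by (intro suminf_le step) auto
  also have "\<dots> = ennreal (\<Sum>n. (1 + \<mu>) * (1/2) ^ n)"
    by (intro suminf_ennreal2) (auto simp: \<mu>_def intro!: summable_mult summable_geometric)
  also have "\<dots> < \<infinity>"
    by simp
  finally have "AE x in torus. (\<Sum>n. ennreal (cmod (f (Suc n) x - f n x))) \<noteq> \<infinity>"
    by (intro nn_integral_PInf_AE) auto
  then have "AE x in torus. convergent (\<lambda>n. f n x)"
  proof (rule AE_mp, intro AE_I2 impI)
    fix x assume "(\<Sum>n. ennreal (cmod (f (Suc n) x - f n x))) \<noteq> \<infinity>"
    then have "summable (\<lambda>n. cmod (f (Suc n) x - f n x))"
      by (intro summable_suminf_not_top) auto
    then have "summable (\<lambda>n. f (Suc n) x - f n x)"
      by (rule summable_norm_cancel)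
    then have "convergent (\<lambda>m. \<Sum>n<m. f (Suc n) x - f n x)"
      by (simp add: summable_iff_convergent)
    then have "convergent (\<lambda>m. f m x - f 0 x)"
      using sum_lessThan_telescope[of "\<lambda>n. f n x"] by (simp only:)
    then show "convergent (\<lambda>n. f n x)"
      using convergent_diff_const_right_iff[of "\<lambda>n. f n x" "f 0 x"] by simp
  qed
  then have AE_lim: "AE x in torus. (\<lambda>n. f n x) \<longlonglongrightarrow> lim (\<lambda>n. f n x)"
    by eventually_elim (simp add: convergent_LIMSEQ_iff)
  define g where "g x = lim (\<lambda>n. f n x)" for x
  have [measurable]: "g \<in> borel_measurable torus"
    unfolding g_def by measurable
  have fatou: "(\<integral>\<^sup>+x. ennreal ((cmod (g x - f n x))\<^sup>2) \<partial>torus) \<le> ennreal (e\<^sup>2)"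
    if n: "\<And>m. m \<ge> n \<Longrightarrow> norm (X m - X n) \<le> e" for n e
  proof -
    have "(\<integral>\<^sup>+x. ennreal ((cmod (g x - f n x))\<^sup>2) \<partial>torus)
        = (\<integral>\<^sup>+x. liminf (\<lambda>m. ennreal ((cmod (f m x - f n x))\<^sup>2)) \<partial>torus)"
    proof (rule nn_integral_cong_AE, use AE_lim in eventually_elim)
      fix x assume "(\<lambda>n. f n x) \<longlonglongrightarrow> lim (\<lambda>n. f n x)"
      then have "(\<lambda>m. ennreal ((cmod (f m x - f n x))\<^sup>2)) \<longlonglongrightarrow> ennreal ((cmod (g x - f n x))\<^sup>2)"
        unfolding g_def by (intro tendsto_intros)
      then show "ennreal ((cmod (g x - f n x))\<^sup>2) = liminf (\<lambda>m. ennreal ((cmod (f m x - f n x))\<^sup>2))"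
        by (intro lim_imp_Liminf[symmetric]) simp_all
    qed
    also have "\<dots> \<le> liminf (\<lambda>m. \<integral>\<^sup>+x. ennreal ((cmod (f m x - f n x))\<^sup>2) \<partial>torus)"
      by (intro nn_integral_liminf) measurable
    also have "\<dots> \<le> liminf (\<lambda>m. ennreal (e\<^sup>2))"
      unfolding nn_diff
      by (intro Liminf_mono eventually_sequentiallyI[of n] ennreal_leI power_mono n) auto
    also have "\<dots> = ennreal (e\<^sup>2)"
      by (simp add: Liminf_const)
    finally show ?thesis .
  qed
  have sq_diff: "square_integrable (\<lambda>x. g x - f n x)"
    if n: "\<And>m. m \<ge> n \<Longrightarrow> norm (X m - X n) \<le> e" for n e
    unfolding square_integrable_def
    using fatou[OF n] by (auto intro!: integrableI_bounded simp: le_less_trans)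
  have "\<exists>n. \<forall>m\<ge>n. norm (X m - X n) \<le> 1"
    using \<open>Cauchy X\<close> unfolding Cauchy_def dist_norm by (meson less_imp_le order_refl zero_less_one)
  then obtain N where N: "\<And>m. m \<ge> N \<Longrightarrow> norm (X m - X N) \<le> 1"
    by auto
  have sq_g: "square_integrable g"
    using square_integrable_add[OF sq_diff[OF N] sq[of N]] by simp
  have "X \<longlonglongrightarrow> L2_class g"
  proof (rule LIMSEQ_I)
    fix r :: real assume "0 < r"
    then obtain M where M: "\<And>m n. m \<ge> M \<Longrightarrow> n \<ge> M \<Longrightarrow> norm (X m - X n) < r / 2"
      using \<open>Cauchy X\<close> unfolding Cauchy_def dist_norm by (meson half_gt_zero)
    have "norm (X n - L2_class g) < r" if "n \<ge> M" for n
    proof -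
      have "(\<integral>\<^sup>+x. ennreal ((cmod (g x - f n x))\<^sup>2) \<partial>torus) \<le> ennreal ((r / 2)\<^sup>2)"
        by (rule fatou) (use M that in \<open>auto intro!: less_imp_le\<close>)
      then have "(norm (L2_class g - X n))\<^sup>2 \<le> (r / 2)\<^sup>2"
        by (simp add: nn_integral_square square_integrable_diff sq sq_g L2_class_diff X_eq)
      then have "norm (L2_class g - X n) \<le> r / 2"
        by (rule power2_le_imp_le) (use \<open>0 < r\<close> in simp)
      then show ?thesis
        using \<open>0 < r\<close> by (simp add: norm_minus_commute)
    qed
    then show "\<exists>no. \<forall>n\<ge>no. norm (X n - L2_class g) < r"
      by blast
  qed
  then show ?thesis
    by (auto simp: convergent_def)
qed

instance l2_torus :: (finite) banach
proof
  fix X :: "nat \<Rightarrow> 'a l2_torus"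
  assume X: "Cauchy X"
  have "\<exists>M. \<forall>m\<ge>M. \<forall>n\<ge>M. norm (X m - X n) < (1/2) ^ k" for k
    using X unfolding Cauchy_def dist_norm by simp
  then obtain M where M: "\<And>k m n. m \<ge> M k \<Longrightarrow> n \<ge> M k \<Longrightarrow> norm (X m - X n) < (1/2) ^ k"
    by metis
  define r where "r k = (\<Sum>j\<le>k. M j) + k" for k
  have r: "strict_mono r"
    by (auto simp: r_def strict_mono_Suc_iff)
  have r_ge: "M k \<le> r k" for k
    unfolding r_def by (simp add: member_le_sum trans_le_add1)
  have "convergent (X \<circ> r)"
  proof (rule Cauchy_converges_fast)
    show "Cauchy (X \<circ> r)"
      using X r by (rule Cauchy_subseq_Cauchy)
    have "r k \<le> r (Suc k)" for k
      using r by (simp add: strict_mono_Suc_iff less_imp_le)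
    then show "norm ((X \<circ> r) (Suc k) - (X \<circ> r) k) \<le> (1/2) ^ k" for k
      using M[of k "r (Suc k)" "r k"] r_ge[of k] by (auto intro: less_imp_le order_trans)
  qed
  then show "convergent X"
    using X r by (auto simp: convergent_def dest: Cauchy_converges_subseq)
qed

lemma L2_class_dominated_convergence:
  fixes f :: "nat \<Rightarrow> real ^ 'n::finite \<Rightarrow> complex"
  assumes [measurable]: "\<And>n. f n \<in> borel_measurable torus" "g \<in> borel_measurable torus"
    and h: "integrable torus (\<lambda>x. (h x)\<^sup>2)"
    and bound: "\<And>n x. x \<in> space torus \<Longrightarrow> cmod (f n x) \<le> h x"
    and lim: "\<And>x. x \<in> space torus \<Longrightarrow> (\<lambda>n. f n x) \<longlonglongrightarrow> g x"
  shows "(\<lambda>n. L2_class (f n)) \<longlonglongrightarrow> L2_class g"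
proof -
  have bound_g: "cmod (g x) \<le> h x" if "x \<in> space torus" for x
    using tendsto_norm[OF lim[OF that]] bound[OF that] by (intro Lim_bounded) auto
  have sq_f: "square_integrable (f n)" for n
    unfolding square_integrable_def
    by (intro conjI Bochner_Integration.integrable_bound[OF h])
      (auto intro!: AE_I2 power_mono bound)
  have sq_g: "square_integrable g"
    unfolding square_integrable_def
    by (intro conjI Bochner_Integration.integrable_bound[OF h])
      (auto intro!: AE_I2 power_mono bound_g)
  have "(\<lambda>n. \<integral>x. (cmod (f n x - g x))\<^sup>2 \<partial>torus) \<longlonglongrightarrow> (\<integral>x. 0 \<partial>(torus :: (real ^ 'n) measure))"
  proof (rule Bochner_Integration.integral_dominated_convergence)
    show "integrable torus (\<lambda>x. 4 * (h x)\<^sup>2)"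
      using h by simp
    show "AE x in torus. (\<lambda>n. (cmod (f n x - g x))\<^sup>2) \<longlonglongrightarrow> 0"
    proof (rule AE_I2)
      fix x assume "x \<in> space (torus :: (real ^ 'n) measure)"
      then have "(\<lambda>n. (cmod (f n x - g x))\<^sup>2) \<longlonglongrightarrow> (cmod (g x - g x))\<^sup>2"
        by (intro tendsto_intros lim)
      then show "(\<lambda>n. (cmod (f n x - g x))\<^sup>2) \<longlonglongrightarrow> 0"
        by simp
    qed
    show "AE x in torus. norm ((cmod (f n x - g x))\<^sup>2) \<le> 4 * (h x)\<^sup>2" for n
    proof (rule AE_I2)
      fix x assume x: "x \<in> space (torus :: (real ^ 'n) measure)"
      have "cmod (f n x - g x) \<le> 2 * h x"
        using norm_triangle_ineq4[of "f n x" "g x"] bound[OF x, of n] bound_g[OF x] by simp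
      then have "(cmod (f n x - g x))\<^sup>2 \<le> (2 * h x)\<^sup>2"
        by (intro power_mono) simp_all
      then show "norm ((cmod (f n x - g x))\<^sup>2) \<le> 4 * (h x)\<^sup>2"
        by (simp add: power_mult_distrib)
    qed
  qed measurable
  then have "(\<lambda>n. (norm (L2_class (f n) - L2_class g))\<^sup>2) \<longlonglongrightarrow> 0"
    by (simp add: L2_class_diff[symmetric] norm_L2_class square_integrable_diff sq_f sq_g)
  then have "(\<lambda>n. sqrt ((norm (L2_class (f n) - L2_class g))\<^sup>2)) \<longlonglongrightarrow> sqrt 0"
    by (rule tendsto_real_sqrt)
  then show ?thesis
    by (simp add: tendsto_norm_zero_iff LIM_zero_iff)
qed

lemma l2_torus_separable: "\<exists>C :: 'n::finite l2_torus set. countable C \<and> (\<forall>u. \<forall>e>0. \<exists>c\<in>C. norm (c - u) < e)"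
proof -
  obtain B :: "(real ^ 'n) set set" where B: "countable B" "topological_basis B"
    using ex_countable_basis by blast
  define G where "G = Inter ` {F. F \<subseteq> B \<and> finite F}"
  have "countable G"
    unfolding G_def using B(1) by (intro countable_image) (simp add: countable_Collect_finite_subset conj_commute)
  have open_G: "open A" if "A \<in> G" for A
    using that B(2) unfolding G_def by (auto intro!: open_Inter dest: topological_basis_open)
  have "B \<subseteq> G"
    unfolding G_def by (auto intro!: image_eqI[where x = "{_}"])
  have "topological_basis G"
    using B(2) \<open>B \<subseteq> G\<close> open_G unfolding topological_basis_def by (metis subset_trans)
  then have borel_G: "sets (borel :: (real ^ 'n) measure) = sigma_sets UNIV G"
    using \<open>countable G\<close> by (simp add: borel_eq_countable_basis)
  have "Int_stable G"
  proof (rule Int_stableI)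
    fix a b assume "a \<in> G" "b \<in> G"
    then obtain E F where "a = \<Inter>E" "E \<subseteq> B" "finite E" "b = \<Inter>F" "F \<subseteq> B" "finite F"
      by (auto simp: G_def)
    then show "a \<inter> b \<in> G"
      unfolding G_def by (intro image_eqI[where x = "E \<union> F"]) auto
  qed
  have "UNIV \<in> G"
    unfolding G_def by (intro image_eqI[where x = "{}"]) auto
  define ind :: "(real ^ 'n) set \<Rightarrow> 'n l2_torus" where "ind A = L2_class (indicator A)" for A
  define Q where "Q = (\<lambda>(p, q). Complex p q) ` (\<rat> \<times> \<rat>)"
  have Q_dense: "\<exists>q\<in>Q. cmod (q - z) < e" if e: "0 < e" for z e
  proof -
    obtain p where p: "p \<in> \<rat>" "Re z - e / 2 < p" "p < Re z + e / 2"
      using Rats_dense_in_real[of "Re z - e / 2" "Re z + e / 2"] e by auto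
    obtain q where q: "q \<in> \<rat>" "Im z - e / 2 < q" "q < Im z + e / 2"
      using Rats_dense_in_real[of "Im z - e / 2" "Im z + e / 2"] e by auto
    have "\<bar>p - Re z\<bar> < e / 2" "\<bar>q - Im z\<bar> < e / 2"
      using p q by linarith+
    then have "cmod (Complex p q - z) < e"
      using cmod_le[of "Complex p q - z"] by simp
    then show ?thesis
      using p q unfolding Q_def by (intro bexI[of _ "Complex p q"]) auto
  qed
  define C where "C = (\<lambda>xs. \<Sum>(q, A)\<leftarrow>xs. q *\<^sub>C ind A) ` lists (Q \<times> G)"
  have "countable C"
    unfolding C_def Q_def using \<open>countable G\<close> countable_rat
    by (intro countable_image countable_lists countable_SIGMA) auto
  define D where "D = {u. \<forall>e>0. \<exists>c\<in>C. norm (c - u) < e}"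
  have D_approx: "\<exists>c\<in>C. norm (c - u) < e" if "u \<in> D" "0 < e" for u e
    using that by (simp add: D_def)
  have C_add: "c + d \<in> C" if cd: "c \<in> C" "d \<in> C" for c d
  proof -
    obtain xs ys where "c = (\<Sum>(q, A)\<leftarrow>xs. q *\<^sub>C ind A)" "xs \<in> lists (Q \<times> G)"
      and "d = (\<Sum>(q, A)\<leftarrow>ys. q *\<^sub>C ind A)" "ys \<in> lists (Q \<times> G)"
      using cd unfolding C_def by blast
    then show ?thesis
      unfolding C_def by (intro image_eqI[where x = "xs @ ys"]) auto
  qed
  have "0 \<in> C"
    unfolding C_def by (intro image_eqI[where x = "[]"]) auto
  then have D_zero: "0 \<in> D"
    unfolding D_def by force
  have D_add: "u + v \<in> D" if uv: "u \<in> D" "v \<in> D" for u v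
    unfolding D_def
  proof (intro CollectI allI impI)
    fix e :: real assume "0 < e"
    obtain c d where cd: "c \<in> C" "norm (c - u) < e / 2" "d \<in> C" "norm (d - v) < e / 2"
      using D_approx[OF uv(1), of "e / 2"] D_approx[OF uv(2), of "e / 2"] \<open>0 < e\<close> by auto
    have eq: "c + d - (u + v) = (c - u) + (d - v)"
      by simp
    have "norm (c + d - (u + v)) < e"
      unfolding eq using norm_triangle_ineq[of "c - u" "d - v"] cd by linarith
    then show "\<exists>c\<in>C. norm (c - (u + v)) < e"
      using C_add cd by blast
  qed
  have D_sum: "(\<Sum>i\<in>I. w i) \<in> D" if "\<And>i. i \<in> I \<Longrightarrow> w i \<in> D" for I :: "'i set" and w
    using that by (induction I rule: infinite_finite_induct) (auto intro: D_zero D_add)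
  have D_lim: "u \<in> D" if w: "\<And>n. w n \<in> D" "w \<longlonglongrightarrow> u" for w u
    unfolding D_def
  proof (intro CollectI allI impI)
    fix e :: real assume "0 < e"
    then obtain n where n: "norm (w n - u) < e / 2"
      using LIMSEQ_D[OF w(2), of "e / 2"] \<open>0 < e\<close> by auto
    obtain c where c: "c \<in> C" "norm (c - w n) < e / 2"
      using D_approx[OF w(1)[of n], of "e / 2"] \<open>0 < e\<close> by auto
    have "norm (c - u) < e"
      using norm_triangle_ineq[of "c - w n" "w n - u"] n c by simp
    then show "\<exists>c\<in>C. norm (c - u) < e"
      using c by blast
  qed
  have sq_ind: "square_integrable (indicator A)" if "A \<in> sets borel" for A :: "(real ^ 'n) set"
  proof -
    have [measurable]: "(indicator A :: _ \<Rightarrow> complex) \<in> borel_measurable torus"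
      unfolding torus_def using that by (intro measurable_restrict_space1) simp
    have "integrable torus (\<lambda>x. (cmod (indicator A x))\<^sup>2)"
    proof (rule torus.integrable_const_bound)
      show "AE x in torus. norm ((cmod (indicator A x))\<^sup>2) \<le> 1"
        by (auto simp: indicator_def)
    qed measurable
    then show ?thesis
      by (simp add: square_integrable_def)
  qed
  have gen: "z *\<^sub>C ind A \<in> D" if "A \<in> G" for z A
    unfolding D_def
  proof (intro CollectI allI impI)
    fix e :: real assume "0 < e"
    then have "0 < e / (norm (ind A) + 1)"
      by (simp add: add_nonneg_pos)
    then obtain q where q: "q \<in> Q" "cmod (q - z) < e / (norm (ind A) + 1)"
      using Q_dense by blast
    have "norm (q *\<^sub>C ind A - z *\<^sub>C ind A) = norm ((q - z) *\<^sub>C ind A)"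
      by (metis add_diff_cancel_right' diff_add_cancel scaleC_add_left)
    also have "\<dots> = cmod (q - z) * norm (ind A)"
      by (rule norm_scaleC)
    also have "\<dots> \<le> cmod (q - z) * (norm (ind A) + 1)"
      by (intro mult_left_mono) auto
    also have "\<dots> < e"
      using q by (simp add: pos_less_divide_eq add_nonneg_pos)
    finally show "\<exists>c\<in>C. norm (c - z *\<^sub>C ind A) < e"
      using q that unfolding C_def
      by (intro bexI[of _ "q *\<^sub>C ind A"] image_eqI[where x = "[(q, A)]"]) auto
  qed
  have G_Pow: "G \<subseteq> Pow UNIV"
    by simp
  have ind_D: "\<forall>z. z *\<^sub>C ind A \<in> D" if "A \<in> sets borel" for A
    using \<open>Int_stable G\<close> G_Pow that[unfolded borel_G]
  proof (induction A rule: sigma_sets_induct_disjoint)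
    case (basic A)
    then show ?case
      using gen by blast
  next
    case empty
    show ?case
    proof -
      have "ind {} = 0"
        unfolding ind_def L2_class_zero[symmetric] by (rule arg_cong[where f = L2_class]) auto
      then show ?thesis
        by (simp add: D_zero)
    qed
  next
    case (compl A)
    show ?case
    proof
      fix z :: complex
      have A: "A \<in> sets borel"
        using compl by (simp add: borel_G)
      have "ind (UNIV - A) = L2_class (\<lambda>x. indicator UNIV x - indicator A x)"
        unfolding ind_def by (rule arg_cong[where f = L2_class]) (auto simp: indicator_def)
      also have "\<dots> = ind UNIV - ind A"
        unfolding ind_def using A by (intro L2_class_diff sq_ind) simp_all
      also have "\<dots> = ind UNIV + (- 1) *\<^sub>C ind A"
        using scaleR_eq_scaleC[of "- 1" "ind A"] by simp
      finally have "ind (UNIV - A) = ind UNIV + (- 1) *\<^sub>C ind A" .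
      then show "z *\<^sub>C ind (UNIV - A) \<in> D"
        using compl gen \<open>UNIV \<in> G\<close> by (auto simp: scaleC_add_right scaleC_scaleC intro!: D_add)
    qed
  next
    case (union A)
    show ?case
    proof
      fix z :: complex
      have A: "A i \<in> sets borel" for i
        using union(2) by (auto simp: borel_G)
      have UN: "(\<Union>i<n. A i) \<in> sets borel" for n :: nat
        using A by auto
      have meas: "(\<lambda>x :: real ^ 'n. z * indicator S x) \<in> borel_measurable torus" if "S \<in> sets borel" for S
        using square_integrable_cmult[OF sq_ind[OF that], of z] by (simp add: square_integrable_def)
      have partial_sum: "(\<Sum>i<n. z *\<^sub>C ind (A i)) = L2_class (\<lambda>x. z * indicator (\<Union>i<n. A i) x)" for n
      proof (induction n)
        case 0
        show ?case
          by (simp add: L2_class_zero)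
      next
        case (Suc n)
        have "indicator (\<Union>i<Suc n. A i) x = indicator (\<Union>i<n. A i) x + (indicator (A n) x :: complex)" for x
        proof -
          have "(\<Union>i<n. A i) \<inter> A n = {}"
            using union(1) by (auto simp: disjoint_family_on_def dest: less_imp_neq)
          then show ?thesis
            by (auto simp: indicator_def less_Suc_eq)
        qed
        then have "L2_class (\<lambda>x. z * indicator (\<Union>i<Suc n. A i) x)
            = L2_class (\<lambda>x. z * indicator (\<Union>i<n. A i) x + z * indicator (A n) x)"
          by (simp add: distrib_left)
        also have "\<dots> = L2_class (\<lambda>x. z * indicator (\<Union>i<n. A i) x) + L2_class (\<lambda>x. z * indicator (A n) x)"
          by (intro L2_class_add square_integrable_cmult sq_ind UN A)
        also have "\<dots> = (\<Sum>i<Suc n. z *\<^sub>C ind (A i))"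
          using L2_class_scaleC[OF sq_ind[OF A[of n]], of z] Suc.IH by (simp add: ind_def)
        finally show ?case
          by simp
      qed
      have "(\<lambda>n. L2_class (\<lambda>x. z * indicator (\<Union>i<n. A i) x)) \<longlonglongrightarrow> L2_class (\<lambda>x. z * indicator (\<Union>i. A i) x)"
      proof (rule L2_class_dominated_convergence)
        show "integrable torus (\<lambda>x. (cmod z)\<^sup>2)"
          by simp
        show "cmod (z * indicator (\<Union>i<n. A i) x) \<le> cmod z" for n x
          by (auto simp: indicator_def)
        show "(\<lambda>n. z * indicator (\<Union>i<n. A i) x) \<longlonglongrightarrow> z * indicator (\<Union>i. A i) x" for x
          by (intro tendsto_intros LIMSEQ_indicator_UN)
      qed (use A UN meas in auto)
      then have "(\<lambda>n. \<Sum>i<n. z *\<^sub>C ind (A i)) \<longlonglongrightarrow> z *\<^sub>C ind (\<Union>i. A i)"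
        using A unfolding partial_sum by (simp add: ind_def L2_class_scaleC sq_ind)
      then show "z *\<^sub>C ind (\<Union>i. A i) \<in> D"
        by (rule D_lim[rotated]) (use union in \<open>auto intro: D_sum\<close>)
    qed
  qed
  have "u \<in> D" for u
  proof -
    define f where "f = rep_l2_torus u"
    have sq_f: "square_integrable f"
      by (simp add: f_def)
    then have [measurable]: "f \<in> borel_measurable torus"
      by (simp add: square_integrable_def)
    obtain F where F: "\<And>i. simple_function torus (F i)"
      and F_lim: "\<And>x. x \<in> space torus \<Longrightarrow> (\<lambda>i. F i x) \<longlonglongrightarrow> f x"
      and F_bound: "\<And>i x. x \<in> space torus \<Longrightarrow> dist (F i x) 0 \<le> 2 * dist (f x) 0"
      using borel_measurable_implies_sequence_metric[of f torus 0] by simp metis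
    have [measurable]: "F i \<in> borel_measurable torus" for i
      using F by (rule borel_measurable_simple_function)
    have h: "integrable torus (\<lambda>x. (2 * cmod (f x))\<^sup>2)"
      using sq_f by (simp add: square_integrable_def power_mult_distrib)
    have F_sq: "(cmod (F i x))\<^sup>2 \<le> (2 * cmod (f x))\<^sup>2" if "x \<in> space torus" for i x
      using F_bound[OF that, of i] by (intro power_mono) simp_all
    have sq_F: "square_integrable (F i)" for i
      unfolding square_integrable_def
      by (intro conjI Bochner_Integration.integrable_bound[OF h])
        (use F_sq in \<open>auto intro!: AE_I2\<close>)
    have "L2_class (F i) \<in> D" for i
    proof -
      define S where "S y = F i -` {y} \<inter> space torus" for y
      have S: "S y \<in> sets borel" for y
      proof -
        have "S y \<in> sets torus"
          unfolding S_def by measurable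
        then show ?thesis
          using torus_cell_borel by (auto simp: torus_def sets_restrict_space)
      qed
      have sum: "square_integrable (\<lambda>x. \<Sum>y\<in>I. y * indicator (S y) x) \<and>
          L2_class (\<lambda>x. \<Sum>y\<in>I. y * indicator (S y) x) = (\<Sum>y\<in>I. y *\<^sub>C ind (S y))" if "finite I" for I
        using that
      proof (induction I)
        case empty
        show ?case
          by (simp add: L2_class_zero square_integrable_zero)
      next
        case (insert y I)
        have y: "square_integrable (\<lambda>x. y * indicator (S y) x)"
          by (intro square_integrable_cmult sq_ind S)
        have "L2_class (\<lambda>x. y * indicator (S y) x) = y *\<^sub>C ind (S y)"
          unfolding ind_def by (intro L2_class_scaleC sq_ind S)
        then show ?case
          using insert y unfolding sum.insert[OF insert.hyps(1,2)]
          by (simp only: square_integrable_add L2_class_add)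
      qed
      have fin: "finite (F i ` space torus)"
        using F by (simp add: simple_function_def)
      have F_eq: "F i x = (\<Sum>y\<in>F i ` space torus. y * indicator (S y) x)" if "x \<in> space torus" for x
        using that fin by (subst sum.remove[of _ "F i x"]) (auto simp: S_def indicator_def intro!: sum.neutral)
      have "L2_class (F i) = L2_class (\<lambda>x. \<Sum>y\<in>F i ` space torus. y * indicator (S y) x)"
        by (rule L2_class_eqI[OF sq_F conjunct1[OF sum[OF fin]] AE_I2[OF F_eq]])
      also have "\<dots> = (\<Sum>y\<in>F i ` space torus. y *\<^sub>C ind (S y))"
        by (rule conjunct2[OF sum[OF fin]])
      also have "\<dots> \<in> D"
        using ind_D S by (intro D_sum) auto
      finally show ?thesis .
    qed
    moreover have "(\<lambda>i. L2_class (F i)) \<longlonglongrightarrow> L2_class f"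
      by (rule L2_class_dominated_convergence[OF _ _ h]) (use F_lim F_bound in auto)
    ultimately show ?thesis
      unfolding f_def L2_class_rep by (rule D_lim)
  qed
  then show ?thesis
    using \<open>countable C\<close> unfolding D_def by blast
qed

instance l2_torus :: (finite) second_countable_topology
proof
  obtain C :: "'a l2_torus set" where C: "countable C" "\<And>u e. 0 < e \<Longrightarrow> \<exists>c\<in>C. norm (c - u) < e"
    using l2_torus_separable by blast
  define B where "B = (\<lambda>(c, n). ball c (1 / real (Suc n))) ` (C \<times> UNIV)"
  have "topological_basis B"
  proof (rule topological_basisI)
    show "open U" if "U \<in> B" for U
      using that by (auto simp: B_def)
  next
    fix U :: "'a l2_torus set" and u assume "open U" "u \<in> U"
    then obtain e where e: "0 < e" "ball u e \<subseteq> U"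
      using open_contains_ball by blast
    obtain n where n: "1 / real (Suc n) < e / 2"
      using e nat_approx_posE[of "e / 2"] by auto
    obtain c where c: "c \<in> C" "norm (c - u) < 1 / real (Suc n)"
      using C(2)[of "1 / real (Suc n)"] by auto
    have "u \<in> ball c (1 / real (Suc n))"
      using c by (simp add: dist_norm)
    moreover have "ball c (1 / real (Suc n)) \<subseteq> ball u e"
    proof
      fix v assume "v \<in> ball c (1 / real (Suc n))"
      then have "dist u v < 1 / real (Suc n) + 1 / real (Suc n)"
        using c dist_triangle[of u v c] by (simp add: dist_norm norm_minus_commute)
      then show "v \<in> ball u e"
        using n by simp
    qed
    ultimately show "\<exists>V\<in>B. u \<in> V \<and> V \<subseteq> U"
      using c e unfolding B_def by (intro bexI[of _ "ball c (1 / real (Suc n))"]) auto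
  qed
  moreover have "countable B"
    unfolding B_def using C(1) by auto
  ultimately show "\<exists>B :: 'a l2_torus set set. countable B \<and> open = generate_topology B"
    using topological_basis_imp_subbasis by blast
qed

definition mass :: "'n::finite l2_torus \<Rightarrow> real"
  where "mass u = (norm u)\<^sup>2"

lemma mass_eq_integral: "mass u = (\<integral>x. (cmod (rep_l2_torus u x))\<^sup>2 \<partial>torus)"
  using norm_L2_class[OF square_integrable_rep, of u] by (simp add: mass_def)

lemma cinner_eq_integral: "cinner u v = (\<integral>x. cnj (rep_l2_torus u x) * rep_l2_torus v x \<partial>torus)"
  using cinner.abs_eq[of "rep_l2_torus u" "rep_l2_torus v"] by simp

section \<open>The free Schroedinger group\<close>

definition fourier_mode :: "int ^ 'n::finite \<Rightarrow> 'n l2_torus"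
  where "fourier_mode k = L2_class (\<lambda>x.
    complex_of_real (1 / sqrt ((2 * pi) ^ CARD('n))) * cis (\<Sum>i\<in>UNIV. real_of_int (k $ i) * x $ i))"

text \<open>
  $S(t) = e^{-\mathrm{i}t\Delta}$ by functional calculus: the Laplacian multiplies the $k$-th Fourier
  mode by $-|k|^2$, so the group multiplies it by $e^{\mathrm{i}t|k|^2}$.
\<close>

definition schroedinger_group :: "real \<Rightarrow> 'n::finite l2_torus \<Rightarrow> 'n l2_torus"
  where "schroedinger_group t u = (\<Sum>\<^sub>\<infinity>k.
    (cis (t * (\<Sum>i\<in>UNIV. (real_of_int (k $ i))\<^sup>2)) * cinner (fourier_mode k) u) *\<^sub>C fourier_mode k)"

section \<open>The nonlinearity and its flow\<close>

text \<open>
  Since \<^const>\<open>L2_class\<close> is zero outside $L^2$, the value of \<open>nonlinearity V u\<close> is meaningful only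
  when $V[u]u$ is square-integrable; this is required explicitly in the notion of solution below.
\<close>

definition nonlinearity ::
    "('n::finite l2_torus \<Rightarrow> real ^ 'n \<Rightarrow> real) \<Rightarrow> 'n l2_torus \<Rightarrow> 'n l2_torus"
  where "nonlinearity V u = L2_class (\<lambda>x. complex_of_real (V u x) * rep_l2_torus u x)"

definition phase_flow ::
    "('n::finite l2_torus \<Rightarrow> real ^ 'n \<Rightarrow> real) \<Rightarrow> real \<Rightarrow> 'n l2_torus \<Rightarrow> 'n l2_torus"
  where "phase_flow V t u = L2_class (\<lambda>x. cis (- t * V u x) * rep_l2_torus u x)"

lemma rep_phase_flow:
  fixes V :: "'n::finite l2_torus \<Rightarrow> real ^ 'n \<Rightarrow> real"
  assumes [measurable]: "V u \<in> borel_measurable torus"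
  shows "AE x in torus. rep_l2_torus (phase_flow V t u) x
    = cis (- t * V u x) * rep_l2_torus u x"
proof -
  have [measurable]: "rep_l2_torus u \<in> borel_measurable torus"
    and int: "integrable torus (\<lambda>x. (cmod (rep_l2_torus u x))\<^sup>2)"
    using square_integrable_rep[of u] by (simp_all add: square_integrable_def)
  have [measurable]: "cis \<in> borel_measurable borel"
    by (intro borel_measurable_continuous_onI continuous_intros)
  have "(\<lambda>x. cis (- t * V u x) * rep_l2_torus u x) \<in> borel_measurable torus"
    by measurable
  with int show ?thesis
    unfolding phase_flow_def by (intro rep_L2_class) (simp add: square_integrable_def norm_mult)
qed

text \<open>
  When $V[u]$ depends on $|u|$ only, the flow solves $\mathrm{i}\dot u = V[u]u$ at almost every point.
\<close>

lemma phase_flow_solves: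
  fixes V :: "'n::finite l2_torus \<Rightarrow> real ^ 'n \<Rightarrow> real"
  assumes meas: "\<And>u. V u \<in> borel_measurable torus"
    and modulus: "\<And>u v. AE x in torus. cmod (rep_l2_torus u x) = cmod (rep_l2_torus v x)
      \<Longrightarrow> AE x in torus. V u x = V v x"
  shows "AE x in torus.
    ((\<lambda>s. cis (- s * V u x) * rep_l2_torus u x) has_vector_derivative
      - \<i> * (complex_of_real (V (phase_flow V t u) x) * rep_l2_torus (phase_flow V t u) x)) (at t)"
proof -
  have rep: "AE x in torus. rep_l2_torus (phase_flow V t u) x
      = cis (- t * V u x) * rep_l2_torus u x"
    by (rule rep_phase_flow[OF meas])
  then have "AE x in torus. cmod (rep_l2_torus (phase_flow V t u) x) = cmod (rep_l2_torus u x)"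
    by eventually_elim (simp add: norm_mult)
  then have "AE x in torus. V (phase_flow V t u) x = V u x"
    by (rule modulus)
  with rep show ?thesis
  proof eventually_elim
    case (elim x)
    have "((\<lambda>s. cis (- s * V u x) * rep_l2_torus u x) has_vector_derivative
        - \<i> * (complex_of_real (V u x) * (cis (- t * V u x) * rep_l2_torus u x))) (at t)"
      unfolding has_vector_derivative_def
      by (auto intro!: derivative_eq_intros simp: scaleR_conv_of_real fun_eq_iff mult_ac)
    then show ?case
      by (simp add: elim)
  qed
qed

section \<open>The driving noise\<close>

text \<open>Time ranges over $[0,\infty)$; the values of \<open>F\<close> and of processes at negative times are irrelevant.\<close>

definition stochastic_basis :: "'a measure \<Rightarrow> (real \<Rightarrow> 'a measure) \<Rightarrow> bool"
  where "stochastic_basis M F \<longleftrightarrow> prob_space M \<and> (\<forall>t\<ge>0. subalgebra M (F t)) \<and>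
    (\<forall>s t. 0 \<le> s \<and> s \<le> t \<longrightarrow> sets (F s) \<subseteq> sets (F t))"

definition wiener_process :: "'a measure \<Rightarrow> (real \<Rightarrow> 'a measure) \<Rightarrow> (real \<Rightarrow> 'a \<Rightarrow> real) \<Rightarrow> bool"
  where "wiener_process M F B \<longleftrightarrow>
    (\<forall>t\<ge>0. B t \<in> borel_measurable (F t)) \<and>
    (AE \<omega> in M. B 0 \<omega> = 0 \<and> continuous_on {0..} (\<lambda>t. B t \<omega>)) \<and>
    (\<forall>s t. 0 \<le> s \<and> s < t \<longrightarrow>
      distributed M lborel (\<lambda>\<omega>. B t \<omega> - B s \<omega>) (normal_density 0 (sqrt (t - s))) \<and>
      prob_space.indep_set M (sets (F s))
        (sets (vimage_algebra (space M) (\<lambda>\<omega>. B t \<omega> - B s \<omega>) borel)))"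

definition complete_orthonormal_system :: "(nat \<Rightarrow> 'n::finite l2_torus) \<Rightarrow> bool"
  where "complete_orthonormal_system e \<longleftrightarrow>
    (\<forall>j k. cinner (e j) (e k) = (if j = k then 1 else 0)) \<and>
    (\<forall>u. (\<forall>k. cinner (e k) u = 0) \<longrightarrow> u = 0)"

definition trace_Q :: "(nat \<Rightarrow> complex) \<Rightarrow> real"
  where "trace_Q \<gamma> = (\<Sum>k. (cmod (\<gamma> k))\<^sup>2)"

definition wiener_Q ::
    "(nat \<Rightarrow> complex) \<Rightarrow> (nat \<Rightarrow> 'n::finite l2_torus) \<Rightarrow> (nat \<Rightarrow> real \<Rightarrow> 'a \<Rightarrow> real) \<Rightarrow>
      real \<Rightarrow> 'a \<Rightarrow> 'n l2_torus"
  where "wiener_Q \<gamma> e \<beta> t \<omega> = (\<Sum>k. (\<gamma> k * complex_of_real (\<beta> k t \<omega>)) *\<^sub>C e k)"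

section \<open>Stochastic integrals of deterministic operator-valued functions\<close>

definition partition :: "nat \<Rightarrow> (nat \<Rightarrow> real) \<Rightarrow> real \<Rightarrow> bool"
  where "partition N p t \<longleftrightarrow> p 0 = 0 \<and> p N = t \<and> (\<forall>j<N. p j \<le> p (Suc j))"

definition step_function ::
    "nat \<Rightarrow> (nat \<Rightarrow> real) \<Rightarrow> (nat \<Rightarrow> 'n::finite l2_torus \<Rightarrow>\<^sub>L 'n l2_torus) \<Rightarrow>
      real \<Rightarrow> 'n l2_torus \<Rightarrow> 'n l2_torus"
  where "step_function N p A s v = (\<Sum>j<N. indicator {p j<..p (Suc j)} s *\<^sub>R blinfun_apply (A j) v)"

definition step_integral ::
    "(real \<Rightarrow> 'a \<Rightarrow> 'n::finite l2_torus) \<Rightarrow> nat \<Rightarrow> (nat \<Rightarrow> real) \<Rightarrow> (nat \<Rightarrow> 'n l2_torus \<Rightarrow>\<^sub>L 'n l2_torus) \<Rightarrow>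
      'a \<Rightarrow> 'n l2_torus"
  where "step_integral W N p A \<omega> = (\<Sum>j<N. blinfun_apply (A j) (W (p (Suc j)) \<omega> - W (p j) \<omega>))"

text \<open>
  Ito's construction: \<open>X\<close> is (a version of) $\int_0^t \Phi(s)\,\mathrm{d}W^Q(s)$ if it is the limit in
  $L^2(\Omega; L^2)$ of integrals of step functions converging to $\Phi$ in the norm
  $\bigl(\int_0^t \|\Phi(s) Q^{1/2}\|_{\mathrm{HS}}^2\,\mathrm{d}s\bigr)^{1/2}$, where
  $\|\Phi Q^{1/2}\|_{\mathrm{HS}}^2 = \sum_k \|\Phi(\gamma_k e_k)\|^2$.
\<close>

definition has_stochastic_integral ::
    "'a measure \<Rightarrow> (nat \<Rightarrow> complex) \<Rightarrow> (nat \<Rightarrow> 'n::finite l2_torus) \<Rightarrow> (nat \<Rightarrow> real \<Rightarrow> 'a \<Rightarrow> real) \<Rightarrow>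
      real \<Rightarrow> (real \<Rightarrow> 'n l2_torus \<Rightarrow> 'n l2_torus) \<Rightarrow> ('a \<Rightarrow> 'n l2_torus) \<Rightarrow> bool"
  where "has_stochastic_integral M \<gamma> e \<beta> t \<Phi> X \<longleftrightarrow> X \<in> borel_measurable M \<and>
    (\<exists>N p A. (\<forall>m. partition (N m) (p m) t) \<and>
      (\<lambda>m. \<integral>\<^sup>+s\<in>{0..t}. (\<Sum>k. ennreal ((norm
        (step_function (N m) (p m) (A m) s (\<gamma> k *\<^sub>C e k) - \<Phi> s (\<gamma> k *\<^sub>C e k)))\<^sup>2)) \<partial>lborel) \<longlonglongrightarrow> 0 \<and>
      (\<lambda>m. \<integral>\<^sup>+\<omega>. ennreal ((norm
        (step_integral (wiener_Q \<gamma> e \<beta>) (N m) (p m) (A m) \<omega> - X \<omega>))\<^sup>2) \<partial>M) \<longlonglongrightarrow> 0)"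

section \<open>The equation and the splitting scheme\<close>

text \<open>
  \<open>Z t\<close> is the stochastic convolution at time \<open>t\<close>.  It is determined up to a null set for each \<open>t\<close>;
  requiring the equation to hold for all times simultaneously selects the continuous version.
\<close>

definition mild_solution ::
    "'a measure \<Rightarrow> (real \<Rightarrow> 'a measure) \<Rightarrow> (nat \<Rightarrow> complex) \<Rightarrow> (nat \<Rightarrow> 'n::finite l2_torus) \<Rightarrow>
      (nat \<Rightarrow> real \<Rightarrow> 'a \<Rightarrow> real) \<Rightarrow> real \<Rightarrow> ('n l2_torus \<Rightarrow> real ^ 'n \<Rightarrow> real) \<Rightarrow>
      ('a \<Rightarrow> 'n l2_torus) \<Rightarrow> (real \<Rightarrow> 'a \<Rightarrow> 'n l2_torus) \<Rightarrow> bool"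
  where "mild_solution M F \<gamma> e \<beta> \<alpha> V u\<^sub>0 u \<longleftrightarrow>
    (\<forall>t\<ge>0. u t \<in> borel_measurable (F t)) \<and>
    (\<forall>\<omega>\<in>space M. continuous_on {0..} (\<lambda>t. u t \<omega>)) \<and>
    (\<exists>Z. (\<forall>t\<ge>0. has_stochastic_integral M \<gamma> e \<beta> t (\<lambda>s. schroedinger_group (t - s)) (Z t)) \<and>
      (AE \<omega> in M.
        (AE s in lebesgue. 0 \<le> s \<longrightarrow>
          square_integrable (\<lambda>x. complex_of_real (V (u s \<omega>) x) * rep_l2_torus (u s \<omega>) x)) \<and>
        (\<forall>T\<ge>0. set_integrable lebesgue {0..T} (\<lambda>s. nonlinearity V (u s \<omega>))) \<and>
        (\<forall>t\<ge>0. u t \<omega> = schroedinger_group t (u\<^sub>0 \<omega>)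
          - \<i> *\<^sub>C (LINT s:{0..t}|lebesgue. schroedinger_group (t - s) (nonlinearity V (u s \<omega>)))
          - (\<i> * complex_of_real \<alpha>) *\<^sub>C Z t \<omega>)))"

primrec splitting_scheme ::
    "(nat \<Rightarrow> complex) \<Rightarrow> (nat \<Rightarrow> 'n::finite l2_torus) \<Rightarrow> (nat \<Rightarrow> real \<Rightarrow> 'a \<Rightarrow> real) \<Rightarrow> real \<Rightarrow>
      ('n l2_torus \<Rightarrow> real ^ 'n \<Rightarrow> real) \<Rightarrow> real \<Rightarrow> ('a \<Rightarrow> 'n l2_torus) \<Rightarrow> nat \<Rightarrow> 'a \<Rightarrow> 'n l2_torus"
  where
    "splitting_scheme \<gamma> e \<beta> \<alpha> V \<tau> u\<^sub>0 0 \<omega> = u\<^sub>0 \<omega>"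
  | "splitting_scheme \<gamma> e \<beta> \<alpha> V \<tau> u\<^sub>0 (Suc n) \<omega> =
      schroedinger_group \<tau> (phase_flow V \<tau> (splitting_scheme \<gamma> e \<beta> \<alpha> V \<tau> u\<^sub>0 n \<omega>)
        - (\<i> * complex_of_real \<alpha>) *\<^sub>C
            (wiener_Q \<gamma> e \<beta> (real (Suc n) * \<tau>) \<omega> - wiener_Q \<gamma> e \<beta> (real n * \<tau>) \<omega>))"

end

theory Submission
  imports Defs
begin

text \<open>
  In the interaction picture $v(t) = S(-t)u(t)$ the mild equation reads
  $v(t) = u_0 + \int_0^t g(s)\,\mathrm{d}s + Y(t)$, where the drift $g$ is pointwise orthogonal to $v$
  because $V[u]$ is real, and $Y(t) = -\mathrm{i}\alpha\int_0^t S(-s)\,\mathrm{d}W^Q(s)$.  Expanding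
  $\|v\|^2$ along a grid of $[0,t]$ leaves a martingale term, the quadratic variation of $Y$, with
  expectation $t\alpha^2\mathrm{Tr}(Q)$, and a remainder that tends to zero pathwise.  As nothing is known
  about moments of the drift, the expectation is taken in two steps.  Applying the bounded concave function
  $x/(1+\delta x)$ to the mass, where concavity makes the second-order term superfluous, bounds the
  martingale term; $\delta\to0$ gives one inequality and, with it, square integrability of $v$.  Then the
  martingale term of the mass itself is bounded in $L^2(\Omega)$, and so is the quadratic variation, by
  fourth moments; uniform integrability yields the other inequality.

  One step of the scheme is an isometry applied to the sum of an $\mathcal{F}(t_n)$-measurable variable of
  unchanged mass and an orthogonal increment of the noise.
\<close>

section \<open>Completeness of the Fourier modes\<close>

text \<open>The detour through v is forced: a mild solution gives no meaning to Delta u in L^2,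
  while v has an L^2-valued drift. That u and v have equal mass is the isometry of S(t); as S(t) is
  given by a Fourier series, this, and even S(0) = id, rests on the completeness of the modes.

  On the noise side every Z(t) comes with its own approximating partitions of [0, t], unrelated for
  different t, whereas the expansion along a grid needs Y(b) - Y(a) conditionally on F(a). So each
  increment of Y is approximated afresh by left-point sums on uniform grids of [a, b], and an Ito
  inequality identifies the limit. The coefficients of these sums are |alpha| times isometries; this
  keeps the squared norm of a single step diagonal in k, where independence of one beta_k at a time
  from F(a) is enough.

  Fourth moments enter through the constants 3 and 9: 3 is the Gaussian kurtosis, inherited by one
  step, and 9 is a constant that survives appending further steps of constant 3, so it bounds
  increments over any interval.\<close>

lemma torus_measurable_of_borel [measurable (raw)]:
  "f \<in> borel_measurable borel \<Longrightarrow> f \<in> borel_measurable torus"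
  unfolding torus_def by (rule measurable_restrict_space1) simp

lemma space_torus: "space (torus :: (real ^ 'n::finite) measure) = {x. \<forall>i. x $ i \<in> {0..<2 * pi}}"
  by (simp add: torus_def space_restrict_space)

lemma borel_measurable_cis [measurable]: "cis \<in> borel_measurable borel"
  by (intro borel_measurable_continuous_onI continuous_intros)

lemma borel_measurable_vec_nth [measurable]: "(\<lambda>x :: 'a::euclidean_space ^ 'n::finite. x $ i) \<in> borel_measurable borel"
  by (intro borel_measurable_continuous_onI continuous_intros)

section \<open>Plane waves and their orthogonality\<close>

definition wave :: "int ^ 'n::finite \<Rightarrow> real ^ 'n \<Rightarrow> complex"
  where "wave k x = cis (\<Sum>i\<in>UNIV. real_of_int (k $ i) * x $ i)"

lemma borel_measurable_wave [measurable]: "wave k \<in> borel_measurable borel"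
  unfolding wave_def by measurable

lemma norm_wave [simp]: "cmod (wave k x) = 1"
  by (simp add: wave_def)

lemma wave_mult: "wave k x * wave l x = wave (k + l) x"
  by (simp add: wave_def cis_mult sum.distrib distrib_right)

lemma cnj_wave: "cnj (wave k x) = wave (- k) x"
  by (simp add: wave_def cis_cnj sum_negf)

lemma wave_0 [simp]: "wave 0 x = 1"
  by (simp add: wave_def)

lemma wave_eq_prod: "wave k x = (\<Prod>i\<in>UNIV. cis (real_of_int (k $ i) * x $ i))"
proof -
  have "cis (\<Sum>i\<in>I. real_of_int (k $ i) * x $ i) = (\<Prod>i\<in>I. cis (real_of_int (k $ i) * x $ i))"
    if "finite I" for I
    using that by (induction I) (simp_all add: cis_mult[symmetric])
  then show ?thesis
    by (simp add: wave_def)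
qed

text \<open>Fundamental theorem of calculus with an antiderivative that is 2 pi periodic unless m =
  0. Integrability is part of the conclusion because Fubini for the product of coordinates asks for
  it.\<close>

lemma cis_period_integral:
  fixes m :: int
  shows "integrable lborel (\<lambda>y. indicator {0..<2 * pi} y *\<^sub>R cis (real_of_int m * y))" (is ?A)
    and "(\<integral>y. indicator {0..<2 * pi} y *\<^sub>R cis (real_of_int m * y) \<partial>lborel) = (if m = 0 then complex_of_real (2 * pi) else 0)" (is ?B)
proof -
  define P where "P y = (if m = 0 then complex_of_real y else cis (real_of_int m * y) / (\<i> * of_int m))" for y
  have d: "(P has_vector_derivative cis (real_of_int m * y)) (at y within S)" for y S
  proof (cases "m = 0")
    case True
    then show ?thesis
      unfolding P_def has_vector_derivative_def
      by (auto intro!: derivative_eq_intros simp: scaleR_conv_of_real)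
  next
    case False
    then show ?thesis
      unfolding P_def has_vector_derivative_def
      by (auto intro!: derivative_eq_intros simp: scaleR_conv_of_real field_simps)
  qed
  have "has_bochner_integral lborel (\<lambda>y. indicator {0..2 * pi} y *\<^sub>R cis (real_of_int m * y)) (P (2 * pi) - P 0)"
    by (intro has_bochner_integral_FTC_Icc d continuous_intros) auto
  \<comment> \<open>The fundamental cell is half-open while the fundamental theorem speaks of a
    closed interval; they differ by the null set {2 pi}.\<close>
  moreover have "AE y in lborel. indicator {0..2 * pi} y *\<^sub>R cis (real_of_int m * y)
      = indicator {0..<2 * pi} y *\<^sub>R cis (real_of_int m * y)"
    using AE_lborel_singleton[of "2 * pi"] by eventually_elim (auto simp: indicator_def)
  ultimately have "has_bochner_integral lborel (\<lambda>y. indicator {0..<2 * pi} y *\<^sub>R cis (real_of_int m * y)) (P (2 * pi) - P 0)"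
    by (subst (asm) has_bochner_integral_cong_AE) (auto simp: measurable)
  moreover have "P (2 * pi) - P 0 = (if m = 0 then complex_of_real (2 * pi) else 0)"
  proof -
    have "cis (real_of_int m * (2 * pi)) = 1"
      using cis_multiple_2pi[of "real_of_int m"] by (simp add: mult.commute)
    then show ?thesis by (simp add: P_def)
  qed
  ultimately show ?A ?B
    by (simp_all add: has_bochner_integral_iff)
qed

text \<open>The wave and the indicator of the cell are both products over the coordinates, so Fubini
  reduces the integral to \<open>cis_period_integral\<close> in each coordinate; one nonzero
  frequency annihilates the product.\<close>

lemma wave_integral:
  "(\<integral>x. wave k x \<partial>(torus :: (real ^ 'n::finite) measure)) = (if k = 0 then complex_of_real ((2 * pi) ^ CARD('n)) else 0)"
proof -
  let ?C = "{x :: real ^ 'n. \<forall>i. x $ i \<in> {0..<2 * pi}}"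
  define h where "h i y = indicator {0..<2 * pi} y *\<^sub>R cis (real_of_int (k $ i) * y)" for i :: 'n and y :: real
  \<comment> \<open>Lebesgue measure on \<open>real ^ 'n\<close> is the image of a product measure
    indexed by basis vectors, whereas the factors \<open>h\<close> are indexed by coordinates;
    \<open>c\<close> translates.\<close>
  define c where "c b = (THE i. b = axis i 1)" for b :: "real ^ 'n"
  have c [simp]: "c (axis i 1) = i" for i
    unfolding c_def by (rule the_equality) (auto simp: axis_eq_axis)
  have B: "(Basis :: (real ^ 'n) set) = (\<lambda>i. axis i 1) ` UNIV"
    by (auto simp: Basis_vec_def)
  have inj: "inj (\<lambda>i. axis i 1 :: real ^ 'n)"
    by (auto simp: inj_def axis_eq_axis)
  have ind: "indicator ?C x *\<^sub>R wave k x = (\<Prod>i\<in>UNIV. h i (x $ i))" for x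
  proof (cases "x \<in> ?C")
    case True
    then show ?thesis by (simp add: h_def wave_eq_prod)
  next
    case False
    then obtain i where "x $ i \<notin> {0..<2 * pi}" by auto
    then have "h i (x $ i) = 0" by (simp add: h_def)
    then have "(\<Prod>i\<in>UNIV. h i (x $ i)) = 0" by (metis UNIV_I finite prod_zero)
    then show ?thesis using False by simp
  qed
  have hm [measurable]: "h i \<in> borel_measurable borel" for i
    unfolding h_def by measurable
  interpret product_sigma_finite "\<lambda>b :: real ^ 'n. lborel :: real measure" ..
  have "(\<integral>x. wave k x \<partial>torus) = (\<integral>x. indicator ?C x *\<^sub>R wave k x \<partial>lborel)"
    unfolding torus_def using torus_cell_borel by (subst integral_restrict_space) auto
  also have "\<dots> = (\<integral>x. (\<Prod>i\<in>UNIV. h i (x $ i)) \<partial>lborel)"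
    by (simp only: ind)
  also have "\<dots> = (\<integral>f. (\<Prod>i\<in>UNIV. h i ((\<Sum>b\<in>Basis. f b *\<^sub>R b) $ i)) \<partial>(\<Pi>\<^sub>M b\<in>(Basis :: (real ^ 'n) set). lborel))"
    by (subst lborel_eq, subst integral_distr) (auto intro!: borel_measurable_prod)
  also have "\<dots> = (\<integral>f. (\<Prod>b\<in>Basis. h (c b) (f b)) \<partial>(\<Pi>\<^sub>M b\<in>(Basis :: (real ^ 'n) set). lborel))"
  proof (rule Bochner_Integration.integral_cong[OF refl])
    fix f :: "real ^ 'n \<Rightarrow> real"
    have "(\<Sum>b\<in>Basis. f b *\<^sub>R b) $ i = f (axis i 1)" for i
    proof -
      have "(\<Sum>b\<in>Basis. f b *\<^sub>R b) $ i = (\<Sum>b\<in>Basis. f b *\<^sub>R b) \<bullet> axis i 1"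
        by (simp add: inner_axis)
      also have "\<dots> = f (axis i 1)"
        by (subst inner_sum_left_Basis) (auto simp: Basis_vec_def)
      finally show ?thesis .
    qed
    then show "(\<Prod>i\<in>UNIV. h i ((\<Sum>b\<in>Basis. f b *\<^sub>R b) $ i)) = (\<Prod>b\<in>Basis. h (c b) (f b))"
      unfolding B by (subst prod.reindex[OF inj]) simp
  qed
  also have "\<dots> = (\<Prod>b\<in>(Basis :: (real ^ 'n) set). \<integral>y. h (c b) y \<partial>lborel)"
    by (rule product_integral_prod) (auto simp: h_def cis_period_integral)
  also have "\<dots> = (\<Prod>i\<in>UNIV. \<integral>y. h i y \<partial>lborel)"
    unfolding B by (subst prod.reindex[OF inj]) simp
  also have "\<dots> = (\<Prod>i\<in>UNIV. if k $ i = 0 then complex_of_real (2 * pi) else 0)"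
    by (simp add: h_def cis_period_integral)
  also have "\<dots> = (if k = 0 then complex_of_real ((2 * pi) ^ CARD('n)) else 0)"
  proof (cases "k = 0")
    case True then show ?thesis by simp
  next
    case False
    then obtain i where "k $ i \<noteq> 0" by (auto simp: vec_eq_iff)
    then have "(\<Prod>i\<in>UNIV. if k $ i = 0 then complex_of_real (2 * pi) else 0) = 0"
      by (intro prod_zero) auto
    with False show ?thesis by simp
  qed
  finally show ?thesis .
qed

lemma square_integrable_wave: "square_integrable (\<lambda>x. c * wave k x)"
  by (auto simp: square_integrable_def norm_mult intro!: torus_measurable_of_borel)

text \<open>Kept apart from \<open>wave\<close>, so that products and conjugates of waves are waves
  again. The factor depends on the dimension only, that is on a type, hence the type
  argument.\<close>

definition wave_norm :: "'n::finite itself \<Rightarrow> complex" where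
  "wave_norm _ = complex_of_real (1 / sqrt ((2 * pi) ^ CARD('n)))"

lemma fourier_mode_eq: "fourier_mode (k :: int ^ 'n::finite) = L2_class (\<lambda>x. wave_norm TYPE('n) * wave k x)"
  by (simp add: fourier_mode_def wave_def wave_norm_def)

lemma cinner_L2_class:
  assumes "square_integrable f" "square_integrable g"
  shows "cinner (L2_class f) (L2_class g) = (\<integral>x. cnj (f x) * g x \<partial>torus)"
  using assms by (simp add: L2_class_def cinner.abs_eq)

lemma cinner_fourier_mode:
  "cinner (fourier_mode k) (fourier_mode (l :: int ^ 'n::finite)) = (if k = l then 1 else 0)"
proof -
  have "cinner (fourier_mode k) (fourier_mode l) = (\<integral>x. (cnj (wave_norm TYPE('n)) * wave_norm TYPE('n)) * wave (l - k) x \<partial>torus)"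
    unfolding fourier_mode_eq cinner_L2_class[OF square_integrable_wave square_integrable_wave]
  proof (rule Bochner_Integration.integral_cong[OF refl])
    fix x :: "real ^ 'n"
    have "wave (l - k) x = cnj (wave k x) * wave l x" by (simp add: cnj_wave wave_mult)
    then show "cnj (wave_norm TYPE('n) * wave k x) * (wave_norm TYPE('n) * wave l x) =
         cnj (wave_norm TYPE('n)) * wave_norm TYPE('n) * wave (l - k) x" by simp
  qed
  also have "\<dots> = (cnj (wave_norm TYPE('n)) * wave_norm TYPE('n)) * (if l - k = 0 then complex_of_real ((2 * pi) ^ CARD('n)) else 0)"
    by (simp only: integral_mult_right_zero wave_integral)
  also have "cnj (wave_norm TYPE('n)) * wave_norm TYPE('n) = 1 / complex_of_real ((2 * pi) ^ CARD('n))"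
    by (simp add: wave_norm_def of_real_mult[symmetric] del: of_real_mult) 
  finally show ?thesis by auto
qed

section \<open>Density of trigonometric polynomials\<close>

inductive trig_poly :: "(real ^ 'n::finite \<Rightarrow> complex) \<Rightarrow> bool" where
  wave: "trig_poly (\<lambda>x. c * wave k x)"
| add: "trig_poly f \<Longrightarrow> trig_poly g \<Longrightarrow> trig_poly (\<lambda>x. f x + g x)"

text \<open>Waves are characters: a product of two of them is a wave, and the rest is
  bilinearity.\<close>

lemma trig_poly_mult:
  assumes "trig_poly f" "trig_poly g"
  shows "trig_poly (\<lambda>x. f x * g x)"
  using assms(1)
proof induction
  case (wave c k)
  from assms(2) show ?case
  proof induction
    case (wave d l)
    have "c * wave k x * (d * wave l x) = (c * d) * wave (k + l) x" for x
      by (simp add: wave_mult[symmetric])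
    then show ?case by (simp only: trig_poly.wave)
  qed (simp add: distrib_left trig_poly.add)
qed (simp add: distrib_right trig_poly.add)

lemma trig_poly_const: "trig_poly (\<lambda>x. c)"
  using trig_poly.wave[of c 0] by simp

lemma trig_poly_sum: "(\<And>i. i \<in> I \<Longrightarrow> trig_poly (f i)) \<Longrightarrow> trig_poly (\<lambda>x. \<Sum>i\<in>I. f i x)"
  by (induction I rule: infinite_finite_induct) (auto intro: trig_poly_const trig_poly.add)

text \<open>The half-open cell is not compact. Wrapping each coordinate around the unit circle
  embeds it into a compact product of circles, on which Stone-Weierstrass applies.\<close>

definition to_circles :: "real ^ 'n::finite \<Rightarrow> complex ^ 'n" where
  "to_circles x = (\<chi> i. cis (x $ i))"

lemma wave_axis: "wave (axis i m) x = cis (real_of_int m * x $ i)"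
proof -
  have "(\<Sum>j\<in>UNIV. real_of_int (axis i m $ j) * x $ j) = (\<Sum>j\<in>UNIV. if j = i then real_of_int m * x $ i else 0)"
    by (intro sum.cong) (auto simp: axis_def)
  then show ?thesis by (simp add: wave_def)
qed

text \<open>Real and imaginary parts of \<open>cis (x $ i)\<close> combine the two waves of
  frequency 1 and -1 in direction i; so linear functionals of the wrapped point are trigonometric
  polynomials, and constants, sums and products follow by closure.\<close>

lemma trig_poly_of_real_polynomial:
  fixes p :: "complex ^ 'n::finite \<Rightarrow> real"
  assumes "real_polynomial_function p"
  shows "trig_poly (\<lambda>x. complex_of_real (p (to_circles x)))"
  using assms
proof induction
  case (linear f)
  interpret bounded_linear f by fact
  have comp: "trig_poly (\<lambda>x. complex_of_real (to_circles x \<bullet> b))" if "b \<in> Basis" for b :: "complex ^ 'n"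
  proof -
    from that obtain i w where b: "b = axis i w" "w \<in> {1, \<i>}" by (auto simp: Basis_vec_def Basis_complex_def)
    \<comment> \<open>The real part of \<open>cnj w * z\<close> as the mean of
      \<open>cnj w * z\<close> and its conjugate \<open>w * cnj z\<close>, with z standing for
      \<open>cis (x $ i)\<close>.\<close>
    have eq: "complex_of_real (to_circles x \<bullet> b) = cnj w / 2 * wave (axis i 1) x + w / 2 * wave (axis i (-1)) x" for x :: "real ^ 'n"
    proof -
      have "to_circles x \<bullet> b = cis (x $ i) \<bullet> w"
        by (simp add: b to_circles_def inner_axis)
      then show ?thesis using b by (auto simp: wave_axis complex_eq_iff inner_complex_def)
    qed
    show ?thesis unfolding eq by (intro trig_poly.intros)
  qed
  have "complex_of_real (f z) = (\<Sum>b\<in>Basis. complex_of_real (f b) * complex_of_real (z \<bullet> b))" for z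
  proof -
    have "f z = f (\<Sum>b\<in>Basis. (z \<bullet> b) *\<^sub>R b)" by (simp add: euclidean_representation)
    then show ?thesis by (simp add: sum scaleR mult.commute)
  qed
  then have eq: "(\<lambda>x. complex_of_real (f (to_circles x)))
      = (\<lambda>x. \<Sum>b\<in>Basis. complex_of_real (f b) * complex_of_real (to_circles x \<bullet> b))"
    by (rule ext)
  show ?case
    unfolding eq by (intro trig_poly_sum trig_poly_mult trig_poly_const comp)
next
  case (const c) show ?case by (rule trig_poly_const)
next
  case (add f g) then show ?case by (simp add: trig_poly.add)
next
  case (mult f g) then show ?case by (simp add: trig_poly_mult)
qed

text \<open>Discontinuous only across the non-negative real axis, where its value is 0.\<close>

lemma borel_measurable_Arg2pi [measurable]: "Arg2pi \<in> borel_measurable borel"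
proof -
  have "(\<lambda>z. if z \<in> \<real>\<^sub>\<ge>\<^sub>0 then (\<lambda>_. 0) z else Arg2pi z) \<in> borel_measurable borel"
  proof (rule borel_measurable_continuous_on_if)
    show "continuous_on (- \<real>\<^sub>\<ge>\<^sub>0) Arg2pi"
      using continuous_at_Arg2pi by (auto intro!: continuous_at_imp_continuous_on)
  qed (auto intro: borel_closed)
  moreover have "(if z \<in> \<real>\<^sub>\<ge>\<^sub>0 then (\<lambda>_. 0) z else Arg2pi z) = Arg2pi z" for z
    using Arg2pi_eq_0[of z] by (auto simp: complex_nonneg_Reals_iff complex_is_Real_iff)
  ultimately show ?thesis by simp
qed

lemma borel_measurable_to_circles [measurable]: "to_circles \<in> borel_measurable borel"
  unfolding to_circles_def
  by (intro borel_measurable_continuous_onI continuous_intros)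

lemma integrable_mult_bounded:
  fixes f g :: "'a \<Rightarrow> complex"
  assumes "integrable M f" "g \<in> borel_measurable M" "\<And>x. x \<in> space M \<Longrightarrow> cmod (g x) \<le> B"
  shows "integrable M (\<lambda>x. g x * f x)"
proof (rule Bochner_Integration.integrable_bound)
  show "integrable M (\<lambda>x. B * cmod (f x))" using assms(1) by simp
  have "0 \<le> B" if "x \<in> space M" for x using assms(3)[OF that] norm_ge_zero order_trans by blast
  then show "AE x in M. norm (g x * f x) \<le> norm (B * cmod (f x))"
    using assms(3) by (auto intro!: AE_I2 mult_mono simp: norm_mult abs_mult)
qed (use assms in auto)

text \<open>Integration against f annihilates trigonometric polynomials, then by Stone-Weierstrass
  continuous functions of \<open>to_circles x\<close>, then indicators of closed sets, and by a
  Dynkin argument those of all Borel sets. Since \<open>to_circles\<close> is injective on the cell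
  with a Borel inverse, every measurable subset of the torus arises, and an integrable function with
  vanishing integral over every measurable set is zero almost everywhere.\<close>

lemma ae_zero_of_orthogonal_waves:
  fixes f :: "real ^ 'n::finite \<Rightarrow> complex"
  assumes int: "integrable torus f"
    and orth: "\<And>k. (\<integral>x. wave k x * f x \<partial>torus) = 0"
  shows "AE x in torus. f x = 0"
proof -
  let ?T = "torus :: (real ^ 'n) measure"
  have [measurable]: "f \<in> borel_measurable torus" using int by auto
  have trig: "integrable torus (\<lambda>x. p x * f x) \<and> (\<integral>x. p x * f x \<partial>torus) = 0" if "trig_poly p" for p
    using that
  proof induction
    case (wave c k)
    have "integrable torus (\<lambda>x. wave k x * f x)"
      using int by (rule integrable_mult_bounded[where B = 1]) auto
    then show ?case using orth[of k] by (simp add: mult.assoc)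
  next
    case (add p q)
    then show ?case by (simp add: distrib_right)
  qed
  define K where "K = {z :: complex ^ 'n. \<forall>i. cmod (z $ i) = 1}"
  have "compact K"
  proof (rule compact_eq_bounded_closed[THEN iffD2], intro conjI)
    have "norm z \<le> real CARD('n)" if "z \<in> K" for z
      using L2_set_le_sum[of UNIV "\<lambda>i. cmod (z $ i)"] that by (simp add: K_def norm_vec_def)
    then show "bounded K" by (auto simp: bounded_iff)
    have "K = (\<Inter>i. {z. cmod (z $ i) = 1})" by (auto simp: K_def)
    then show "closed K" by (auto intro!: closed_INT closed_Collect_eq continuous_intros)
  qed
  have in_K: "to_circles x \<in> K" for x by (simp add: K_def to_circles_def)
  have cont: "(\<integral>x. complex_of_real (h (to_circles x)) * f x \<partial>torus) = 0"
    if h: "continuous_on UNIV h" for h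
  proof -
    have hm [measurable]: "h \<in> borel_measurable borel"
      using h by (rule borel_measurable_continuous_onI)
    obtain B where B: "\<And>z. z \<in> K \<Longrightarrow> \<bar>h z\<bar> \<le> B"
      using compact_imp_bounded[OF compact_continuous_image[OF continuous_on_subset[OF h] \<open>compact K\<close>]]
      by (auto simp: bounded_iff)
    have ih: "integrable torus (\<lambda>x. complex_of_real (h (to_circles x)) * f x)"
      using int by (rule integrable_mult_bounded[where B = B]) (auto intro: B in_K)
    have "cmod (\<integral>x. complex_of_real (h (to_circles x)) * f x \<partial>torus) \<le> e * (\<integral>x. cmod (f x) \<partial>torus)" if "0 < e" for e
    proof -
      obtain g where g: "real_polynomial_function g" "\<And>z. z \<in> K \<Longrightarrow> \<bar>h z - g z\<bar> < e"
        using Stone_Weierstrass_real_polynomial_function[OF \<open>compact K\<close> continuous_on_subset[OF h subset_UNIV] \<open>0 < e\<close>]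
        by blast
      note tg = trig[OF trig_poly_of_real_polynomial[OF g(1)]]
      have "(\<integral>x. complex_of_real (h (to_circles x)) * f x \<partial>torus)
          = (\<integral>x. complex_of_real (h (to_circles x) - g (to_circles x)) * f x \<partial>torus)"
        using tg ih by (simp add: left_diff_distrib)
      also have "cmod \<dots> \<le> (\<integral>x. e * cmod (f x) \<partial>torus)"
      proof (rule Bochner_Integration.integral_norm_bound_integral)
        show "integrable torus (\<lambda>x. complex_of_real (h (to_circles x) - g (to_circles x)) * f x)"
          using tg ih by (simp add: left_diff_distrib)
        show "cmod (complex_of_real (h (to_circles x) - g (to_circles x)) * f x) \<le> e * cmod (f x)" for x
          using g(2)[OF in_K, of x] unfolding norm_mult norm_of_real by (intro mult_right_mono) auto
      qed (use int in simp)
      finally show ?thesis by simp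
    qed
    note le = this
    define I where "I = (\<integral>x. cmod (f x) \<partial>torus)"
    have "0 \<le> I" by (simp add: I_def)
    have "cmod (\<integral>x. complex_of_real (h (to_circles x)) * f x \<partial>torus) \<le> 0"
    proof (rule field_le_epsilon)
      fix e :: real assume "0 < e"
      \<comment> \<open>The bound e * I is available for every positive e; dividing by I + 1 instead
        of I covers I = 0.\<close>
      have "cmod (\<integral>x. complex_of_real (h (to_circles x)) * f x \<partial>torus) \<le> e / (I + 1) * I"
        unfolding I_def by (rule le) (use \<open>0 < e\<close> \<open>0 \<le> I\<close> in \<open>simp add: I_def[symmetric]\<close>)
      also have "\<dots> \<le> e"
        using \<open>0 < e\<close> \<open>0 \<le> I\<close> by (simp add: field_simps)
      finally show "cmod (\<integral>x. complex_of_real (h (to_circles x)) * f x \<partial>torus) \<le> 0 + e" by simp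
    qed
    then show ?thesis by simp
  qed
  have ind_int: "integrable torus (\<lambda>x. indicator B (to_circles x) * f x)" if "B \<in> sets borel" for B
    using int by (rule integrable_mult_bounded[where B = 1]) (use that in \<open>auto simp: indicator_def\<close>)
  have closed: "(\<integral>x. indicator C (to_circles x) * f x \<partial>torus) = 0" if "closed C" for C
  proof (cases "C = {}")
    case False
    \<comment> \<open>Continuous functions decreasing to the indicator of C. The distance to the
      empty set is 0 by convention, which is why C = {} is treated apart.\<close>
    define h where "h n z = max 0 (1 - real n * infdist z C)" for n z
    have hm [measurable]: "h n \<in> borel_measurable borel" for n
      unfolding h_def by (intro borel_measurable_continuous_onI continuous_intros)
    have Cm [measurable]: "C \<in> sets borel" using that by (rule borel_closed)
    have "(\<lambda>n. \<integral>x. complex_of_real (h n (to_circles x)) * f x \<partial>torus) \<longlonglongrightarrow> (\<integral>x. indicator C (to_circles x) * f x \<partial>torus)"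
    proof (rule Bochner_Integration.integral_dominated_convergence)
      show "integrable torus (\<lambda>x. cmod (f x))" using int by simp
      have "(\<lambda>n. h n z) \<longlonglongrightarrow> indicator C z" for z
      proof (cases "z \<in> C")
        case True
        then show ?thesis by (simp add: h_def)
      next
        case False
        then have "0 < infdist z C"
          using in_closed_iff_infdist_zero[OF \<open>closed C\<close> \<open>C \<noteq> {}\<close>] infdist_nonneg[of z C] by (metis le_neq_trans)
        then obtain N where N: "1 < real N * infdist z C"
          using reals_Archimedean3 by blast
        have "h n z = 0" if "N \<le> n" for n
        proof -
          have "real N * infdist z C \<le> real n * infdist z C" using that by (intro mult_right_mono infdist_nonneg) simp
          then show ?thesis using N by (simp add: h_def)
        qed
        then show ?thesis using False
          by (intro tendsto_eventually) (auto intro: eventually_sequentiallyI)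
      qed
      then have "(\<lambda>n. complex_of_real (h n z) * w) \<longlonglongrightarrow> indicator C z * w" for z w
        using tendsto_of_real[of "\<lambda>n. h n z" "indicator C z" sequentially, where 'a = complex]
        by (intro tendsto_mult_right) (simp add: of_real_indicator)
      then show "AE x in torus. (\<lambda>n. complex_of_real (h n (to_circles x)) * f x) \<longlonglongrightarrow> indicator C (to_circles x) * f x"
        by simp
      have "\<bar>h n z\<bar> \<le> 1" for n z by (auto simp: h_def infdist_nonneg)
      then show "AE x in torus. cmod (complex_of_real (h n (to_circles x)) * f x) \<le> cmod (f x)" for n
        by (auto intro!: AE_I2 mult_left_le_one_le simp: norm_mult)
    qed measurable
    moreover have "(\<integral>x. complex_of_real (h n (to_circles x)) * f x \<partial>torus) = 0" for n
      by (rule cont) (auto simp: h_def intro!: continuous_intros)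
    ultimately show ?thesis by (simp add: LIMSEQ_const_iff)
  qed simp
  have borel: "(\<integral>x. indicator B (to_circles x) * f x \<partial>torus) = 0" if "B \<in> sets borel" for B :: "(complex ^ 'n) set"
  proof -
    have "Int_stable (Collect closed :: (complex ^ 'n) set set)"
      by (auto simp: Int_stable_def)
    moreover have "Collect closed \<subseteq> Pow (UNIV :: (complex ^ 'n) set)" by simp
    moreover have "B \<in> sigma_sets UNIV (Collect closed)"
      using that unfolding borel_eq_closed by simp
    ultimately show ?thesis
    proof (induction B rule: sigma_sets_induct_disjoint)
      case (basic A)
      then show ?case by (simp add: closed)
    next
      case empty
      show ?case by simp
    next
      case (compl A)
      then have A: "A \<in> sets borel" by (simp add: borel_eq_closed)
      have "(indicator (UNIV - A) z :: complex) = 1 - indicator A z" for z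
        by (simp add: indicator_def)
      then show ?case
        using compl ind_int[OF A] int closed[of UNIV] by (simp add: left_diff_distrib)
    next
      case (union A)
      then have A: "A i \<in> sets borel" for i by (auto simp: borel_eq_closed)
      have "(\<lambda>i. \<integral>x. indicator (A i) (to_circles x) * f x \<partial>torus) sums (\<integral>x. indicator (\<Union>i. A i) (to_circles x) * f x \<partial>torus)"
      proof -
        have "(\<lambda>n. \<integral>x. indicator (\<Union>i<n. A i) (to_circles x) * f x \<partial>torus) \<longlonglongrightarrow> (\<integral>x. indicator (\<Union>i. A i) (to_circles x) * f x \<partial>torus)"
        proof (rule Bochner_Integration.integral_dominated_convergence)
          show "integrable torus (\<lambda>x. cmod (f x))" using int by simp
          show "AE x in torus. (\<lambda>n. indicator (\<Union>i<n. A i) (to_circles x) * f x) \<longlonglongrightarrow> indicator (\<Union>i. A i) (to_circles x) * f x"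
            by (intro AE_I2 tendsto_mult_right LIMSEQ_indicator_UN)
          show "AE x in torus. cmod (indicator (\<Union>i<n. A i) (to_circles x) * f x) \<le> cmod (f x)" for n
            by (auto simp: indicator_def)
        qed (use A in \<open>auto intro!: borel_measurable_integrable[OF ind_int]\<close>)
        moreover have "(\<integral>x. indicator (\<Union>i<n. A i) (to_circles x) * f x \<partial>torus) = (\<Sum>i<n. \<integral>x. indicator (A i) (to_circles x) * f x \<partial>torus)" for n
        proof -
          have "(indicator (\<Union>i<n. A i) z :: complex) = (\<Sum>i<n. indicator (A i) z)" for z
            by (rule indicator_UN_disjoint) (use union(1) in \<open>auto intro: disjoint_family_on_mono\<close>)
          then show ?thesis
            by (simp only: sum_distrib_right Bochner_Integration.integral_sum[OF ind_int[OF A]])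
        qed
        ultimately show ?thesis by (simp add: sums_def)
      qed
      then show ?case using union by (simp add: sums_iff)
    qed
  qed
  show ?thesis
  proof (rule torus.density_zero[OF int])
    fix A assume A: "A \<in> sets ?T"
    then have A': "A \<in> sets borel"
      using torus_cell_borel by (auto simp: torus_def sets_restrict_space)
    \<comment> \<open>The inverse of \<open>to_circles\<close> on the cell: angles in [0, 2 pi) are
      unique, and this is exactly the range of a coordinate of the cell.\<close>
    define \<psi> where "\<psi> z = (\<chi> i. Arg2pi (z $ i))" for z :: "complex ^ 'n"
    have [measurable]: "\<psi> \<in> borel_measurable borel"
      by (subst borel_measurable_euclidean_space) (auto simp: \<psi>_def Basis_vec_def inner_axis)
    have inv: "\<psi> (to_circles x) = x" if "x \<in> space torus" for x
    proof -
      have "Arg2pi (cis (x $ i)) = x $ i" for i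
        using that by (intro Arg2pi_unique[of 1]) (auto simp: space_torus cis_conv_exp)
      then show ?thesis by (simp add: \<psi>_def to_circles_def vec_eq_iff)
    qed
    have "(LINT x:A|torus. f x) = (\<integral>x. indicator (\<psi> -` A) (to_circles x) * f x \<partial>torus)"
      unfolding set_lebesgue_integral_def
      by (rule Bochner_Integration.integral_cong) (auto simp: inv indicator_def)
    also have "\<dots> = 0"
      using measurable_sets[of \<psi> borel borel A] A' by (intro borel) simp
    finally show "(LINT x:A|torus. f x) = 0" .
  qed
qed

section \<open>The free Schroedinger group\<close>

text \<open>By Pythagoras a block of terms has squared norm equal to the same block of the numerical
  series, so the partial sums over finite sets form a Cauchy net. Sums are unordered because the
  Fourier modes are indexed by \<open>int ^ 'n\<close>.\<close>

lemma orthogonal_summable: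
  fixes f :: "'i \<Rightarrow> 'h::{real_inner, banach}"
  assumes orth: "\<And>i j. i \<noteq> j \<Longrightarrow> inner (f i) (f j) = 0"
    and sq: "(\<lambda>i. (norm (f i))\<^sup>2) summable_on UNIV"
  shows "f summable_on UNIV" (is ?A)
    and "(norm (infsum f UNIV))\<^sup>2 = (\<Sum>\<^sub>\<infinity>i. (norm (f i))\<^sup>2)" (is ?B)
proof -
  let ?q = "\<lambda>i. (norm (f i))\<^sup>2" and ?F = "finite_subsets_at_top (UNIV :: 'i set)"
  define S where "S = infsum ?q UNIV"
  have lim_q: "(sum ?q \<longlongrightarrow> S) ?F"
    using sq unfolding S_def by (rule infsum_tendsto)
  have pyth: "(norm (sum f I))\<^sup>2 = sum ?q I" if "finite I" for I
    using that by (intro norm_sum_Pythagorean) (auto simp: pairwise_def orthogonal_def orth)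
  have bound: "sum ?q I \<le> S" if "finite I" for I
    unfolding S_def using sq that by (intro finite_sum_le_infsum) auto
  have "\<exists>P. eventually P ?F \<and> (\<forall>I J. P I \<and> P J \<longrightarrow> dist (sum f I) (sum f J) < e)" if "0 < e" for e
  proof -
    have "eventually (\<lambda>I. finite I \<and> S - (e / 2)\<^sup>2 < sum ?q I) ?F"
      using that by (intro eventually_conj order_tendstoD(1)[OF lim_q] eventually_finite_subsets_at_top_weakI) auto
    \<comment> \<open>\<open>I0\<close> carries all but (e/2)^2 of the total; the sum over any
      finite set containing it lies within e/2 of the sum over \<open>I0\<close>.\<close>
    then obtain I0 where I0: "finite I0" "S - (e / 2)\<^sup>2 < sum ?q I0"
      unfolding eventually_finite_subsets_at_top by auto
    have near: "dist (sum f I) (sum f I0) < e / 2" if "finite I" "I0 \<subseteq> I" for I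
    proof -
      have "(norm (sum f I - sum f I0))\<^sup>2 = sum ?q (I - I0)"
        using that by (simp add: sum_diff[symmetric] pyth)
      also have "\<dots> < (e / 2)\<^sup>2"
        using bound[OF that(1)] I0 that by (simp add: sum_diff)
      finally show ?thesis
        using \<open>0 < e\<close> unfolding dist_norm by (rule_tac power2_less_imp_less) auto
    qed
    have "eventually (\<lambda>I. finite I \<and> I0 \<subseteq> I) ?F"
      unfolding eventually_finite_subsets_at_top using I0(1) by blast
    then show ?thesis
    proof (intro exI[of _ "\<lambda>I. finite I \<and> I0 \<subseteq> I"] conjI allI impI)
      fix I J assume "(finite I \<and> I0 \<subseteq> I) \<and> finite J \<and> I0 \<subseteq> J"
      then show "dist (sum f I) (sum f J) < e"
        using near[of I] near[of J] by (auto intro: dist_triangle_half_l)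
    qed
  qed
  then have "cauchy_filter (filtermap (sum f) ?F)"
    by (simp add: cauchy_filter_metric_filtermap)
  moreover have "Topological_Spaces.complete (UNIV :: 'h set)"
    by (meson Cauchy_convergent UNIV_I complete_def convergent_def)
  ultimately obtain L where "(sum f \<longlongrightarrow> L) ?F"
    using complete_uniform[where S=UNIV] by (force simp add: filterlim_def)
  then show ?A
    unfolding summable_on_def has_sum_def by blast
  then have "(sum f \<longlongrightarrow> infsum f UNIV) ?F"
    by (rule infsum_tendsto)
  then have "((\<lambda>I. (norm (sum f I))\<^sup>2) \<longlongrightarrow> (norm (infsum f UNIV))\<^sup>2) ?F"
    by (intro tendsto_intros)
  then have "(sum ?q \<longlongrightarrow> (norm (infsum f UNIV))\<^sup>2) ?F"
    by (rule Lim_transform_eventually) (auto intro: eventually_finite_subsets_at_top_weakI simp: pyth)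
  then show ?B
    unfolding S_def[symmetric] by (rule tendsto_unique[OF finite_subsets_at_top_neq_bot _ lim_q])
qed

lemma Re_cinner: "Re (cinner u v) = inner u v"
  by (simp add: inner_l2_torus_def)

lemma cinner_scaleC_right: "cinner u (c *\<^sub>C v) = c * cinner u v"
  by transfer (simp add: mult.left_commute)

lemma cinner_scaleC_left: "cinner (c *\<^sub>C u) v = cnj c * cinner u v"
  by transfer (simp add: mult.assoc)

lemma cinner_add_right: "cinner u (v + w) = cinner u v + cinner u w"
  by transfer (simp add: distrib_left integrable_mult_cnj)

text \<open>Turning v by the conjugate phase of the product makes the product real, where the
  Cauchy-Schwarz inequality of the real inner product applies.\<close>

lemma cinner_Cauchy_Schwarz: "cmod (cinner u v) \<le> norm u * norm v"
proof -
  define z where "z = cinner u v"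
  define w where "w = cnj (sgn z)"
  have "w * z = of_real (cmod z)"
    unfolding w_def by (cases "z = 0") (simp_all add: sgn_eq complex_norm_square[symmetric] power2_eq_square field_simps)
  then have "cmod z = inner u (w *\<^sub>C v)"
    unfolding Re_cinner[symmetric] cinner_scaleC_right z_def[symmetric] by simp
  also have "\<dots> \<le> norm u * norm (w *\<^sub>C v)"
    by (rule norm_cauchy_schwarz)
  \<comment> \<open>The phase w has modulus at most 1; it is 0 if the product is 0.\<close>
  also have "\<dots> \<le> norm u * norm v"
    by (intro mult_left_mono) (auto simp: norm_scaleC w_def norm_sgn mult_left_le_one_le)
  finally show ?thesis by (simp add: z_def)
qed

lemma bounded_linear_cinner: "bounded_linear (cinner u)"
  by (rule bounded_linear_intro[where K = "norm u"])
    (simp_all add: cinner_add_right scaleR_eq_scaleC cinner_scaleC_right scaleR_conv_of_real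
      cinner_Cauchy_Schwarz mult.commute[of _ "norm u"])

lemma bounded_linear_scaleC: "bounded_linear (\<lambda>v. c *\<^sub>C v)"
  by (rule bounded_linear_intro[where K = "cmod c"])
    (simp_all add: scaleC_add_right scaleR_eq_scaleC scaleC_scaleC norm_scaleC mult.commute)

lemma scaleC_minus_one: "(- 1) *\<^sub>C u = - u"
  using scaleR_eq_scaleC[of "-1" u] by simp

lemma scaleC_minus_left: "(- c) *\<^sub>C u = - (c *\<^sub>C u)"
  using scaleC_scaleC[of "-1" c u] by (simp add: scaleC_minus_one)

lemma inner_scaleC_cross: "inner (a *\<^sub>C u) (b *\<^sub>C v) = Re (cnj a * b * cinner u v)"
  by (simp add: Re_cinner[symmetric] cinner_scaleC_left cinner_scaleC_right mult.assoc mult.left_commute)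

section \<open>Fourier coefficients and Bessel's inequality\<close>

abbreviation fourier_coeff :: "'n::finite l2_torus \<Rightarrow> int ^ 'n \<Rightarrow> complex"
  where "fourier_coeff u k \<equiv> cinner (fourier_mode k) u"

text \<open>On a set of finite measure an L^2 function is integrable, here by pairing it with the
  constant 1. Conjugation turns the coefficient at -k into the integral against the wave at k, and
  \<open>ae_zero_of_orthogonal_waves\<close> applies.\<close>

lemma fourier_complete:
  fixes u :: "'n::finite l2_torus"
  assumes "\<And>k. fourier_coeff u k = 0"
  shows "u = 0"
proof -
  have c0: "wave_norm TYPE('n) \<noteq> 0" by (simp add: wave_norm_def)
  have sq: "square_integrable (\<lambda>x :: real ^ 'n. 1 :: complex)" using square_integrable_wave[of 1 "0 :: int ^ 'n"] by simp
  have "AE x in torus. rep_l2_torus u x = 0"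
  proof (rule ae_zero_of_orthogonal_waves)
    show "integrable torus (rep_l2_torus u)"
      using integrable_mult_cnj[OF sq square_integrable_rep[of u]] by simp
    fix k :: "int ^ 'n"
    have "0 = cinner (L2_class (\<lambda>x. wave_norm TYPE('n) * wave (- k) x)) (L2_class (rep_l2_torus u))"
      using assms[of "- k"] by (simp add: fourier_mode_eq)
    also have "\<dots> = (\<integral>x. cnj (wave_norm TYPE('n)) * (wave k x * rep_l2_torus u x) \<partial>torus)"
      by (subst cinner_L2_class[OF square_integrable_wave square_integrable_rep]) (simp add: cnj_wave mult.assoc)
    also have "\<dots> = cnj (wave_norm TYPE('n)) * (\<integral>x. wave k x * rep_l2_torus u x \<partial>torus)"
      by (rule integral_mult_right_zero)
    finally show "(\<integral>x. wave k x * rep_l2_torus u x \<partial>torus) = 0" using c0 by simp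
  qed
  then have "AE x in torus. rep_l2_torus u x = rep_l2_torus 0 x"
    using rep_L2_class[OF square_integrable_zero, where 'a = 'n] by (auto simp: L2_class_zero)
  then show ?thesis by (rule l2_torus_eqI)
qed

lemma fourier_coeff_diff: "fourier_coeff (u - v) k = fourier_coeff u k - fourier_coeff v k"
  by (rule linear_diff[OF bounded_linear.linear[OF bounded_linear_cinner]])

text \<open>Reduces the algebraic identities of the group below to scalar identities between
  multipliers.\<close>

lemma fourier_coeff_eqI:
  assumes "\<And>k. fourier_coeff u k = fourier_coeff v k"
  shows "u = v"
  using fourier_complete[of "u - v"] assms by (simp add: fourier_coeff_diff)

lemma norm_fourier_mode [simp]: "norm (fourier_mode k) = 1"
  using cinner_fourier_mode[of k k] Re_cinner[of "fourier_mode k" "fourier_mode k"] by (simp add: norm_eq_sqrt_inner)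

text \<open>With p the orthogonal projection of u on the span of the modes in I, the inner product
  of p and u is the squared norm of p, so Cauchy-Schwarz bounds the norm of p by that of u.\<close>

lemma bessel:
  assumes I: "finite I"
  shows "(\<Sum>k\<in>I. (cmod (fourier_coeff u k))\<^sup>2) \<le> (norm u)\<^sup>2"
proof -
  define p where "p = (\<Sum>k\<in>I. fourier_coeff u k *\<^sub>C fourier_mode k)"
  have "(norm p)\<^sup>2 = (\<Sum>k\<in>I. (norm (fourier_coeff u k *\<^sub>C fourier_mode k))\<^sup>2)"
    unfolding p_def using I
    by (intro norm_sum_Pythagorean) (auto simp: pairwise_def orthogonal_def inner_scaleC_cross cinner_fourier_mode)
  then have np: "(norm p)\<^sup>2 = (\<Sum>k\<in>I. (cmod (fourier_coeff u k))\<^sup>2)"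
    by (simp add: norm_scaleC)
  have "inner p u = (\<Sum>k\<in>I. Re (cnj (fourier_coeff u k) * fourier_coeff u k))"
    unfolding p_def inner_sum_left by (simp only: Re_cinner[symmetric] cinner_scaleC_left)
  also have "\<dots> = (norm p)\<^sup>2"
    unfolding np by (intro sum.cong) (auto simp: cmod_power2 power2_eq_square[symmetric])
  finally have "norm p * norm p \<le> norm p * norm u"
    using norm_cauchy_schwarz[of p u] by (simp add: power2_eq_square)
  then have "norm p \<le> norm u"
    by (cases "norm p = 0") auto
  then show ?thesis
    unfolding np[symmetric] by (intro power_mono) auto
qed

lemma fourier_coeff_square_summable: "(\<lambda>k. (cmod (fourier_coeff u k))\<^sup>2) summable_on UNIV"
proof (rule nonneg_bdd_above_summable_on)
  show "bdd_above (sum (\<lambda>k. (cmod (fourier_coeff u k))\<^sup>2) ` {F. F \<subseteq> UNIV \<and> finite F})"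
    by (rule bdd_aboveI2[where M = "(norm u)\<^sup>2"]) (auto intro: bessel)
qed simp

lemma fourier_series:
  assumes "(\<lambda>k. (cmod (a k))\<^sup>2) summable_on UNIV"
  shows "(\<lambda>k. a k *\<^sub>C fourier_mode k) summable_on UNIV"
    and "(norm (\<Sum>\<^sub>\<infinity>k. a k *\<^sub>C fourier_mode k))\<^sup>2 = (\<Sum>\<^sub>\<infinity>k. (cmod (a k))\<^sup>2)"
    and "fourier_coeff (\<Sum>\<^sub>\<infinity>k. a k *\<^sub>C fourier_mode k) l = a l"
proof -
  have sq: "(norm (a k *\<^sub>C fourier_mode k))\<^sup>2 = (cmod (a k))\<^sup>2" for k
    by (simp add: norm_scaleC)
  have orth: "inner (a i *\<^sub>C fourier_mode i) (a j *\<^sub>C fourier_mode j) = 0" if "i \<noteq> j" for i j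
    using that by (simp add: inner_scaleC_cross cinner_fourier_mode)
  note os = orthogonal_summable[of "\<lambda>k. a k *\<^sub>C fourier_mode k", unfolded sq, OF orth assms]
  show summ: "(\<lambda>k. a k *\<^sub>C fourier_mode k) summable_on UNIV" by (rule os(1))
  show "(norm (\<Sum>\<^sub>\<infinity>k. a k *\<^sub>C fourier_mode k))\<^sup>2 = (\<Sum>\<^sub>\<infinity>k. (cmod (a k))\<^sup>2)"
    by (rule os(2))
  have "((\<lambda>k. fourier_coeff (a k *\<^sub>C fourier_mode k) l) has_sum fourier_coeff (\<Sum>\<^sub>\<infinity>k. a k *\<^sub>C fourier_mode k) l) UNIV"
    using has_sum_bounded_linear[OF bounded_linear_cinner has_sum_infsum[OF summ]] by (simp add: comp_def)
  then have "fourier_coeff (\<Sum>\<^sub>\<infinity>k. a k *\<^sub>C fourier_mode k) l = (\<Sum>\<^sub>\<infinity>k. fourier_coeff (a k *\<^sub>C fourier_mode k) l)"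
    by (simp add: infsumI)
  also have "\<dots> = (\<Sum>\<^sub>\<infinity>k\<in>{l}. fourier_coeff (a k *\<^sub>C fourier_mode k) l)"
    by (rule infsum_cong_neutral) (auto simp: cinner_scaleC_right cinner_fourier_mode)
  finally show "fourier_coeff (\<Sum>\<^sub>\<infinity>k. a k *\<^sub>C fourier_mode k) l = a l"
    by (simp add: cinner_scaleC_right cinner_fourier_mode)
qed

text \<open>Eigenvalue of minus the Laplacian on the mode k.\<close>

definition laplace_symbol :: "int ^ 'n::finite \<Rightarrow> real"
  where "laplace_symbol k = (\<Sum>i\<in>UNIV. (real_of_int (k $ i))\<^sup>2)"

lemma schroedinger_coeff_summable:
  "(\<lambda>k. (cmod (cis (t * laplace_symbol k) * fourier_coeff u k))\<^sup>2) summable_on UNIV"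
  using fourier_coeff_square_summable[of u] by (simp add: norm_mult)

lemma schroedinger_eq:
  "schroedinger_group t u = (\<Sum>\<^sub>\<infinity>k. (cis (t * laplace_symbol k) * fourier_coeff u k) *\<^sub>C fourier_mode k)"
  by (simp add: schroedinger_group_def laplace_symbol_def)

lemma fourier_coeff_schroedinger:
  "fourier_coeff (schroedinger_group t u) k = cis (t * laplace_symbol k) * fourier_coeff u k"
  unfolding schroedinger_eq by (rule fourier_series(3)[OF schroedinger_coeff_summable])

lemma schroedinger_group_0 [simp]: "schroedinger_group 0 u = u"
  by (rule fourier_coeff_eqI) (simp add: fourier_coeff_schroedinger)

lemma schroedinger_group_add: "schroedinger_group s (schroedinger_group t u) = schroedinger_group (s + t) u"
  by (rule fourier_coeff_eqI) (simp add: fourier_coeff_schroedinger distrib_right cis_mult[symmetric] mult.assoc)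

text \<open>Parseval expresses the norm through the moduli of the coefficients, which the unimodular
  multipliers leave unchanged; the case t = 0 then identifies the value as the norm of u.\<close>

lemma norm_schroedinger_group [simp]: "norm (schroedinger_group t u) = norm u"
proof -
  have "(norm (schroedinger_group t u))\<^sup>2 = (\<Sum>\<^sub>\<infinity>k. (cmod (fourier_coeff u k))\<^sup>2)" for t
    unfolding schroedinger_eq fourier_series(2)[OF schroedinger_coeff_summable] by (simp add: norm_mult)
  from this[of t] this[of 0] have "(norm (schroedinger_group t u))\<^sup>2 = (norm u)\<^sup>2" by simp
  then show ?thesis by (rule power2_eq_imp_eq) simp_all
qed

lemma schroedinger_group_scaleC: "schroedinger_group t (c *\<^sub>C u) = c *\<^sub>C schroedinger_group t u"
  by (rule fourier_coeff_eqI) (simp add: fourier_coeff_schroedinger cinner_scaleC_right)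

lemma bounded_linear_schroedinger: "bounded_linear (schroedinger_group t)"
proof (rule bounded_linear_intro[where K = 1])
  show "schroedinger_group t (u + v) = schroedinger_group t u + schroedinger_group t v" for u v :: "'a l2_torus"
    by (rule fourier_coeff_eqI) (simp add: fourier_coeff_schroedinger cinner_add_right distrib_left)
qed (simp_all add: scaleR_eq_scaleC schroedinger_group_scaleC)

lemmas linear_schroedinger = bounded_linear.linear[OF bounded_linear_schroedinger]
lemmas schroedinger_add = linear_add[OF linear_schroedinger]
lemmas schroedinger_diff = linear_diff[OF linear_schroedinger]
lemmas schroedinger_sum = linear_sum[OF linear_schroedinger]

lemma inner_schroedinger_group [simp]: "inner (schroedinger_group t u) (schroedinger_group t v) = inner u v"
proof -
  show ?thesis
    by (simp add: dot_norm schroedinger_add[symmetric])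
qed

text \<open>A partial Fourier sum moves continuously under the group because each mode is only
  multiplied by a phase. As the group is isometric, the partial sums converge uniformly in
  t.\<close>

lemma continuous_on_schroedinger_time: "continuous_on UNIV (\<lambda>t. schroedinger_group t u)"
proof (rule uniform_limit_theorem)
  let ?p = "\<lambda>I. \<Sum>k\<in>I. fourier_coeff u k *\<^sub>C fourier_mode k"
  have "((\<lambda>k. fourier_coeff u k *\<^sub>C fourier_mode k) has_sum (schroedinger_group 0 u)) UNIV"
    using fourier_series(1)[OF fourier_coeff_square_summable[of u]] schroedinger_eq[of 0 u] by (simp add: has_sum_iff)
  then have lim: "(?p \<longlongrightarrow> u) (finite_subsets_at_top UNIV)"
    by (simp add: has_sum_def)
  show "uniform_limit UNIV (\<lambda>I t. schroedinger_group t (?p I)) (\<lambda>t. schroedinger_group t u) (finite_subsets_at_top UNIV)"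
    using lim unfolding uniform_limit_iff tendsto_iff
    by (simp add: dist_norm schroedinger_diff[symmetric])
  have mode: "schroedinger_group t (c *\<^sub>C fourier_mode k) = cis (t * laplace_symbol k) *\<^sub>C c *\<^sub>C fourier_mode k" for t c k
    by (rule fourier_coeff_eqI) (auto simp: fourier_coeff_schroedinger cinner_scaleC_right cinner_fourier_mode)
  have cont: "continuous_on UNIV (\<lambda>t. z t *\<^sub>C v)" if "continuous_on UNIV z" for z :: "real \<Rightarrow> complex" and v :: "'a l2_torus"
  proof -
    have "bounded_linear (\<lambda>c. c *\<^sub>C v)"
      by (rule bounded_linear_intro[where K = "norm v"])
        (simp_all add: scaleC_add_left scaleR_eq_scaleC scaleC_scaleC norm_scaleC scaleR_conv_of_real)
    then show ?thesis
      using that by (rule bounded_linear.continuous_on)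
  qed
  show "\<forall>\<^sub>F I in finite_subsets_at_top UNIV. continuous_on UNIV (\<lambda>t. schroedinger_group t (?p I))"
    by (intro always_eventually allI)
      (auto simp: schroedinger_sum mode intro!: continuous_on_sum cont continuous_intros)
qed (rule finite_subsets_at_top_neq_bot)

text \<open>S(s)w is split as S(s)u + S(s)(w - u): the first term converges by continuity in time,
  the second by isometry. Joint continuity yields measurability of integrands such as S(c - s)f(s)
  and continuity of v in time.\<close>

lemma continuous_on_schroedinger:
  "continuous_on UNIV (\<lambda>(t, u). schroedinger_group t u)"
  unfolding continuous_on_def
proof
  fix p :: "real \<times> 'a l2_torus"
  obtain t u where p: "p = (t, u)" by (cases p)
  have "((\<lambda>q. schroedinger_group (fst q) u) \<longlongrightarrow> schroedinger_group t u) (at p)"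
  proof -
    have "((\<lambda>s. schroedinger_group s u) \<longlongrightarrow> schroedinger_group t u) (nhds t)"
      using continuous_on_schroedinger_time[of u] by (simp add: continuous_on_eq_continuous_at isCont_def tendsto_nhds_iff)
    moreover have "filterlim fst (nhds t) (at p)"
      using tendsto_fst[OF tendsto_ident_at, of p UNIV] by (simp add: p)
    ultimately show ?thesis
      by (rule filterlim_compose)
  qed
  moreover have "((\<lambda>q. schroedinger_group (fst q) (snd q - u)) \<longlongrightarrow> 0) (at p)"
  proof (rule tendsto_norm_zero_cancel)
    have "((\<lambda>q. norm (snd q - u)) \<longlongrightarrow> norm (snd p - u)) (at p)"
      by (intro tendsto_intros)
    then show "((\<lambda>q. norm (schroedinger_group (fst q) (snd q - u))) \<longlongrightarrow> 0) (at p)"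
      by (simp add: p)
  qed
  ultimately have "((\<lambda>q. schroedinger_group (fst q) u + schroedinger_group (fst q) (snd q - u)) \<longlongrightarrow> schroedinger_group t u + 0) (at p)"
    by (rule tendsto_add)
  then show "((\<lambda>(t, u). schroedinger_group t u) \<longlongrightarrow> (case p of (t, u) \<Rightarrow> schroedinger_group t u)) (at p)"
    by (simp add: schroedinger_add[symmetric] case_prod_unfold p)
qed

lemma borel_measurable_schroedinger [measurable]: "schroedinger_group t \<in> borel_measurable borel"
  by (intro borel_measurable_continuous_onI linear_continuous_on bounded_linear_schroedinger)

section \<open>Conservation of mass by the nonlinear part\<close>

lemma norm_phase_flow:
  fixes V :: "'n::finite l2_torus \<Rightarrow> real ^ 'n \<Rightarrow> real"
  assumes "V u \<in> borel_measurable torus"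
  shows "norm (phase_flow V t u) = norm u"
proof -
  have "mass (phase_flow V t u) = mass u"
    unfolding mass_eq_integral
  proof (rule integral_cong_AE)
    show "AE x in torus. (cmod (rep_l2_torus (phase_flow V t u) x))\<^sup>2 = (cmod (rep_l2_torus u x))\<^sup>2"
      using rep_phase_flow[of V u t, OF assms] by eventually_elim (simp add: norm_mult)
  qed (use square_integrable_rep in \<open>auto simp: square_integrable_def\<close>)
  then show ?thesis
    unfolding mass_def by (rule power2_eq_imp_eq) simp_all
qed

text \<open>This is where the reality of $V[u]$ enters.\<close>

lemma inner_nonlinearity: "inner u (\<i> *\<^sub>C nonlinearity V u) = 0"
proof (cases "square_integrable (\<lambda>x. complex_of_real (V u x) * rep_l2_torus u x)")
  case True
  have "cinner (L2_class (rep_l2_torus u)) (nonlinearity V u)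
      = (\<integral>x. complex_of_real (V u x * (cmod (rep_l2_torus u x))\<^sup>2) \<partial>torus)"
    unfolding nonlinearity_def
    by (subst cinner_L2_class[OF square_integrable_rep True], rule Bochner_Integration.integral_cong)
      (auto simp: complex_norm_square simp del: of_real_power)
  also have "Im \<dots> = 0"
    by (simp only: integral_complex_of_real Im_complex_of_real)
  finally have "Im (cinner u (nonlinearity V u)) = 0" by simp
  then show ?thesis
    by (simp add: Re_cinner[symmetric] cinner_scaleC_right)
next
  case False
  then have "nonlinearity V u = 0"
    using L2_class_zero by (simp add: nonlinearity_def L2_class_def)
  then show ?thesis by simp
qed

section \<open>The driving noise\<close>

text \<open>Translates independence of sigma-algebras, the form used in
  \<open>wiener_process\<close>, into independence of random variables: the sigma-algebra generated
  by a G-measurable X lies inside G.\<close>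

lemma (in prob_space) indep_var_of_indep_set_vimage:
  assumes ind: "indep_set (sets G) (sets (vimage_algebra (space M) Y N))"
    and G: "subalgebra M G" and X: "X \<in> measurable G S" and Y: "Y \<in> measurable M N"
  shows "indep_var S X N Y"
  unfolding indep_var_eq
proof (intro conjI)
  show "random_variable S X" using G X by (rule measurable_from_subalg)
  have "sigma_sets (space M) {X -` A \<inter> space M |A. A \<in> sets S} \<subseteq> sets G"
  proof (rule sets.sigma_sets_subset[of _ G, unfolded conjunct1[OF G[unfolded subalgebra_def]]])
    show "{X -` A \<inter> space M |A. A \<in> sets S} \<subseteq> sets G"
      using measurable_sets[OF X] G by (auto simp: subalgebra_def)
  qed
  then show "indep_set (sigma_sets (space M) {X -` A \<inter> space M |A. A \<in> sets S})
      (sigma_sets (space M) {Y -` A \<inter> space M |A. A \<in> sets N})"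
    using ind unfolding sets_vimage_algebra indep_set_def
    by (elim indep_sets_mono_sets) (auto split: bool.split)
qed (rule Y)

lemma (in prob_space) indep_var_nn_integral:
  fixes X Y :: "'a \<Rightarrow> ennreal"
  assumes "indep_var borel X borel Y"
  shows "(\<integral>\<^sup>+\<omega>. X \<omega> * Y \<omega> \<partial>M) = (\<integral>\<^sup>+\<omega>. X \<omega> \<partial>M) * (\<integral>\<^sup>+\<omega>. Y \<omega> \<partial>M)"
proof -
  have eq: "case_bool borel borel = (\<lambda>_. borel :: ennreal measure)"
    by (rule ext) (simp split: bool.split)
  have "(\<integral>\<^sup>+\<omega>. (\<Prod>b\<in>UNIV. case_bool X Y b \<omega>) \<partial>M) = (\<Prod>b\<in>UNIV. \<integral>\<^sup>+\<omega>. case_bool X Y b \<omega> \<partial>M)"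
    by (rule indep_vars_nn_integral) (use assms in \<open>auto simp: indep_var_def eq\<close>)
  then show ?thesis by (simp add: UNIV_bool mult.commute)
qed

text \<open>Source of the kurtosis constant: 3 is 4! divided by 2^2 times 2!.\<close>

lemma normal_moment_4:
  assumes "0 < \<sigma>"
  shows "has_bochner_integral lborel (\<lambda>x. normal_density 0 \<sigma> x * x ^ 4) (3 * \<sigma> ^ 4)"
  using normal_moment_even[OF assms, of 0 2] assms by (simp add: fact_numeral power2_eq_square power4_eq_xxxx field_simps)

text \<open>Noise, filtration and noise strength only; u, V and the initial value stay outside, so
  that the exact solution and the scheme draw on the same facts.\<close>

locale noise = prob_space M for M :: "'a measure" +
  fixes F :: "real \<Rightarrow> 'a measure" and \<gamma> :: "nat \<Rightarrow> complex" and e :: "nat \<Rightarrow> 'n::finite l2_torus"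
    and \<beta> :: "nat \<Rightarrow> real \<Rightarrow> 'a \<Rightarrow> real" and \<alpha> :: real
  assumes basis: "stochastic_basis M F"
    and ons: "complete_orthonormal_system e"
    and wiener: "\<And>k. wiener_process M F (\<beta> k)"
    and indep_paths: "indep_vars (\<lambda>_. \<Pi>\<^sub>M t\<in>{0..}. borel) (\<lambda>k \<omega>. \<lambda>t\<in>{0..}. \<beta> k t \<omega>) UNIV"
    and summable_\<gamma>: "summable (\<lambda>k. (cmod (\<gamma> k))\<^sup>2)"
begin

lemma subalg: "0 \<le> t \<Longrightarrow> subalgebra M (F t)"
  using basis by (simp add: stochastic_basis_def)

lemma space_F: "0 \<le> t \<Longrightarrow> space (F t) = space M"
  using subalg by (simp add: subalgebra_def)

lemma sets_F: "0 \<le> t \<Longrightarrow> A \<in> sets (F t) \<Longrightarrow> A \<in> sets M"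
  using subalg by (auto simp: subalgebra_def)

lemma measurable_F_M: "0 \<le> t \<Longrightarrow> X \<in> measurable (F t) N \<Longrightarrow> X \<in> measurable M N"
  using measurable_from_subalg[OF subalg] by blast

lemma subalg_F: "0 \<le> s \<Longrightarrow> s \<le> t \<Longrightarrow> subalgebra (F t) (F s)"
  using basis space_F[of s] space_F[of t] by (simp add: stochastic_basis_def subalgebra_def)

lemma measurable_F_mono: "0 \<le> s \<Longrightarrow> s \<le> t \<Longrightarrow> X \<in> measurable (F s) N \<Longrightarrow> X \<in> measurable (F t) N"
  using measurable_from_subalg[OF subalg_F] by blast

section \<open>Moments of the scalar Wiener processes\<close>

definition inc :: "nat \<Rightarrow> real \<Rightarrow> real \<Rightarrow> 'a \<Rightarrow> real"
  where "inc k a b \<omega> = \<beta> k b \<omega> - \<beta> k a \<omega>"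

lemma \<beta>_measurable: "0 \<le> t \<Longrightarrow> \<beta> k t \<in> borel_measurable (F t)"
  using wiener[of k] by (simp add: wiener_process_def)

lemma inc_measurable_F: "0 \<le> a \<Longrightarrow> a \<le> b \<Longrightarrow> inc k a b \<in> borel_measurable (F b)"
  unfolding inc_def by (intro borel_measurable_diff \<beta>_measurable measurable_F_mono[of a b]) auto

lemma inc_measurable: "0 \<le> a \<Longrightarrow> a \<le> b \<Longrightarrow> inc k a b \<in> borel_measurable M"
  using inc_measurable_F measurable_F_M by (meson order_trans)

lemma inc_distributed:
  "0 \<le> a \<Longrightarrow> a < b \<Longrightarrow> distributed M lborel (inc k a b) (normal_density 0 (sqrt (b - a)))"
  using wiener[of k] by (simp add: wiener_process_def inc_def[abs_def])

lemma inc_refl [simp]: "inc k a a = (\<lambda>\<omega>. 0)"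
  by (simp add: inc_def[abs_def])

lemma inc_moment:
  assumes ab: "0 \<le> a" "a < b"
    and m: "has_bochner_integral lborel (\<lambda>x. normal_density 0 (sqrt (b - a)) x * g x) m"
    and g: "g \<in> borel_measurable borel"
  shows "integrable M (\<lambda>\<omega>. g (inc k a b \<omega>))" and "(\<integral>\<omega>. g (inc k a b \<omega>) \<partial>M) = m"
proof -
  show "integrable M (\<lambda>\<omega>. g (inc k a b \<omega>))"
    using distributed_integrable[OF inc_distributed[OF ab], of g k] m g by (simp add: has_bochner_integral_iff)
  show "(\<integral>\<omega>. g (inc k a b \<omega>) \<partial>M) = m"
    using distributed_integral[OF inc_distributed[OF ab], of g k] m g by (simp add: has_bochner_integral_iff)
qed

lemma inc_mean:
  assumes "0 \<le> a" "a \<le> b"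
  shows "integrable M (inc k a b)" and "(\<integral>\<omega>. inc k a b \<omega> \<partial>M) = 0"
proof -
  have "integrable M (inc k a b) \<and> (\<integral>\<omega>. inc k a b \<omega> \<partial>M) = 0"
  \<comment> \<open>The normal law is available for a < b only, as the density degenerates; the zero
    increment is checked separately, here and in the lemmas below.\<close>
  proof (cases "a = b")
    case False
    then have "a < b" "0 < sqrt (b - a)" using assms by auto
    moreover have "has_bochner_integral lborel (\<lambda>x. normal_density 0 (sqrt (b - a)) x * x) (0)"
      using normal_moment_nz_1[OF \<open>0 < sqrt (b - a)\<close>, of 0] \<open>a < b\<close> by simp
    ultimately show ?thesis
      using inc_moment[of a b "\<lambda>x. x" "0" k] assms by simp
  qed simp
  then show "integrable M (inc k a b)" "(\<integral>\<omega>. inc k a b \<omega> \<partial>M) = 0" by auto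
qed

lemma inc_variance:
  assumes "0 \<le> a" "a \<le> b"
  shows "integrable M (\<lambda>\<omega>. (inc k a b \<omega>)\<^sup>2)" and "(\<integral>\<omega>. (inc k a b \<omega>)\<^sup>2 \<partial>M) = b - a"
proof -
  have "integrable M (\<lambda>\<omega>. (inc k a b \<omega>)\<^sup>2) \<and> (\<integral>\<omega>. (inc k a b \<omega>)\<^sup>2 \<partial>M) = b - a"
  proof (cases "a = b")
    case False
    then have "a < b" "0 < sqrt (b - a)" using assms by auto
    moreover have "has_bochner_integral lborel (\<lambda>x. normal_density 0 (sqrt (b - a)) x * x\<^sup>2) (b - a)"
      using normal_moment_even[OF \<open>0 < sqrt (b - a)\<close>, of 0 1] \<open>a < b\<close>
      by (simp add: fact_numeral diff_divide_distrib)
    ultimately show ?thesis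
      using inc_moment[of a b "\<lambda>x. x\<^sup>2" "b - a" k] assms by simp
  qed simp
  then show "integrable M (\<lambda>\<omega>. (inc k a b \<omega>)\<^sup>2)" "(\<integral>\<omega>. (inc k a b \<omega>)\<^sup>2 \<partial>M) = b - a" by auto
qed

lemma inc_fourth_moment:
  assumes "0 \<le> a" "a \<le> b"
  shows "integrable M (\<lambda>\<omega>. (inc k a b \<omega>) ^ 4)" and "(\<integral>\<omega>. (inc k a b \<omega>) ^ 4 \<partial>M) = 3 * (b - a)\<^sup>2"
proof -
  have "integrable M (\<lambda>\<omega>. (inc k a b \<omega>) ^ 4) \<and> (\<integral>\<omega>. (inc k a b \<omega>) ^ 4 \<partial>M) = 3 * (b - a)\<^sup>2"
  proof (cases "a = b")
    case False
    then have "a < b" "0 < sqrt (b - a)" using assms by auto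
    moreover have "has_bochner_integral lborel (\<lambda>x. normal_density 0 (sqrt (b - a)) x * x ^ 4) (3 * (b - a)\<^sup>2)"
      using normal_moment_4[OF \<open>0 < sqrt (b - a)\<close>] \<open>a < b\<close> by (simp add: power4_eq_xxxx power2_eq_square mult.assoc)
    ultimately show ?thesis
      using inc_moment[of a b "\<lambda>x. x ^ 4" "3 * (b - a)\<^sup>2" k] assms by simp
  qed simp
  then show "integrable M (\<lambda>\<omega>. (inc k a b \<omega>) ^ 4)" "(\<integral>\<omega>. (inc k a b \<omega>) ^ 4 \<partial>M) = 3 * (b - a)\<^sup>2" by auto
qed

lemma inc_indep:
  assumes "0 \<le> a" "a < b" "X \<in> measurable (F a) N"
  shows "indep_var N X borel (inc k a b)"
proof (rule indep_var_of_indep_set_vimage[OF _ subalg[OF assms(1)] assms(3)])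
  show "indep_set (sets (F a)) (sets (vimage_algebra (space M) (inc k a b) borel))"
    using wiener[of k] assms by (simp add: wiener_process_def inc_def[abs_def])
  show "inc k a b \<in> borel_measurable M" using assms inc_measurable by simp
qed

lemma inc_nn_integral:
  assumes "0 \<le> a" "a \<le> b" "f \<in> borel_measurable (F a)"
  shows "(\<integral>\<^sup>+\<omega>. f \<omega> * ennreal ((inc k a b \<omega>)\<^sup>2) \<partial>M) = (\<integral>\<^sup>+\<omega>. f \<omega> \<partial>M) * ennreal (b - a)"
proof (cases "a = b")
  case False
  then have ab: "a < b" using assms by simp
  \<comment> \<open>\<^const>\<open>indep_var\<close> wants both variables in the same type, so \<open>f\<close> is coded by a real variable.\<close>
  define code where "code x = (if x = \<top> then - 1 else enn2real x)" for x :: ennreal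
  define decode where "decode y = (if y < 0 then \<top> else ennreal y)" for y :: real
  have dc: "decode (code x) = x" for x
    by (auto simp: code_def decode_def less_top)
  have [measurable]: "code \<in> borel_measurable borel" "decode \<in> borel_measurable borel"
    unfolding code_def decode_def by measurable
  have "indep_var borel (decode \<circ> (\<lambda>\<omega>. code (f \<omega>))) borel ((\<lambda>x. ennreal (x\<^sup>2)) \<circ> inc k a b)"
    by (rule indep_var_compose[OF inc_indep[OF assms(1) ab]])
      (use assms(3) in measurable)
  then have "indep_var borel f borel (\<lambda>\<omega>. ennreal ((inc k a b \<omega>)\<^sup>2))"
    by (simp add: comp_def dc)
  then have "(\<integral>\<^sup>+\<omega>. f \<omega> * ennreal ((inc k a b \<omega>)\<^sup>2) \<partial>M) = (\<integral>\<^sup>+\<omega>. f \<omega> \<partial>M) * (\<integral>\<^sup>+\<omega>. ennreal ((inc k a b \<omega>)\<^sup>2) \<partial>M)"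
    by (rule indep_var_nn_integral)
  also have "(\<integral>\<^sup>+\<omega>. ennreal ((inc k a b \<omega>)\<^sup>2) \<partial>M) = ennreal (b - a)"
    using inc_variance[OF assms(1,2), of k] by (simp add: nn_integral_eq_integral)
  finally show ?thesis .
qed simp

lemma inc_cross:
  assumes "0 \<le> a" "a \<le> b" "X \<in> borel_measurable (F a)" "integrable M X"
  shows "integrable M (\<lambda>\<omega>. X \<omega> * inc k a b \<omega>)" and "(\<integral>\<omega>. X \<omega> * inc k a b \<omega> \<partial>M) = 0"
proof -
  have "integrable M (\<lambda>\<omega>. X \<omega> * inc k a b \<omega>) \<and> (\<integral>\<omega>. X \<omega> * inc k a b \<omega> \<partial>M) = 0" if "a < b"
    using indep_var_integrable[OF inc_indep[OF assms(1) that assms(3)] assms(4) inc_mean(1)]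
      indep_var_lebesgue_integral[OF inc_indep[OF assms(1) that assms(3)] assms(4) inc_mean(1)]
      inc_mean(2) assms by simp
  then show "integrable M (\<lambda>\<omega>. X \<omega> * inc k a b \<omega>)" "(\<integral>\<omega>. X \<omega> * inc k a b \<omega> \<partial>M) = 0"
    using assms(2) by (cases "a = b"; simp)+
qed

lemma \<beta>_eq_inc: "AE \<omega> in M. \<beta> k t \<omega> = inc k 0 t \<omega>"
proof -
  have "AE \<omega> in M. \<beta> k 0 \<omega> = 0 \<and> continuous_on {0..} (\<lambda>t. \<beta> k t \<omega>)"
    using wiener[of k] by (simp add: wiener_process_def)
  then show ?thesis by eventually_elim (simp add: inc_def)
qed

lemma \<beta>_square_integrable:
  assumes "0 \<le> t"
  shows "integrable M (\<beta> k t)" "(\<integral>\<omega>. \<beta> k t \<omega> \<partial>M) = 0"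
    and "integrable M (\<lambda>\<omega>. (\<beta> k t \<omega>)\<^sup>2)" "(\<integral>\<omega>. (\<beta> k t \<omega>)\<^sup>2 \<partial>M) = t"
proof -
  have [measurable]: "\<beta> k t \<in> borel_measurable M" "inc k 0 t \<in> borel_measurable M"
    using measurable_F_M[OF assms \<beta>_measurable[OF assms]] inc_measurable assms by auto
  have ae: "AE \<omega> in M. \<beta> k t \<omega> = inc k 0 t \<omega>" "AE \<omega> in M. (\<beta> k t \<omega>)\<^sup>2 = (inc k 0 t \<omega>)\<^sup>2"
    using \<beta>_eq_inc[of k t] by auto
  show "integrable M (\<beta> k t)" "(\<integral>\<omega>. \<beta> k t \<omega> \<partial>M) = 0"
    using integrable_cong_AE[OF _ _ ae(1)] integral_cong_AE[OF _ _ ae(1)] inc_mean[of 0 t k] assms by auto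
  show "integrable M (\<lambda>\<omega>. (\<beta> k t \<omega>)\<^sup>2)" "(\<integral>\<omega>. (\<beta> k t \<omega>)\<^sup>2 \<partial>M) = t"
    using integrable_cong_AE[OF _ _ ae(2)] integral_cong_AE[OF _ _ ae(2)] inc_variance[of 0 t k] assms by auto
qed

text \<open>For k = l the later value is the earlier one plus an increment independent of it. For k
  different from l the independence of the paths as random functions is evaluated at one time
  each.\<close>

lemma \<beta>_covariance:
  assumes "0 \<le> s" "0 \<le> t"
  shows "integrable M (\<lambda>\<omega>. \<beta> k s \<omega> * \<beta> l t \<omega>)"
    and "(\<integral>\<omega>. \<beta> k s \<omega> * \<beta> l t \<omega> \<partial>M) = (if k = l then min s t else 0)"
proof -
  have same: "integrable M (\<lambda>\<omega>. \<beta> k s \<omega> * \<beta> k t \<omega>) \<and> (\<integral>\<omega>. \<beta> k s \<omega> * \<beta> k t \<omega> \<partial>M) = s" if "0 \<le> s" "s \<le> t" for s t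
  proof -
    have eq: "\<beta> k s \<omega> * \<beta> k t \<omega> = (\<beta> k s \<omega>)\<^sup>2 + \<beta> k s \<omega> * inc k s t \<omega>" for \<omega>
      by (simp add: inc_def power2_eq_square algebra_simps)
    show ?thesis
      unfolding eq
      using \<beta>_square_integrable[OF that(1), of k] inc_cross[OF that \<beta>_measurable[OF that(1)], of k k] by simp
  qed
  have other: "integrable M (\<lambda>\<omega>. \<beta> k s \<omega> * \<beta> l t \<omega>) \<and> (\<integral>\<omega>. \<beta> k s \<omega> * \<beta> l t \<omega> \<partial>M) = 0" if "k \<noteq> l"
  proof -
    \<comment> \<open>The times are chosen per index, s for k and t for all others, so that the two
      values are coordinatewise images of the family of paths.\<close>
    have "indep_vars (\<lambda>i. borel) (\<lambda>i \<omega>. (\<lambda>f. f (if i = k then s else t)) (\<lambda>t\<in>{0..}. \<beta> i t \<omega>)) UNIV"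
      by (rule indep_vars_compose2[OF indep_paths]) (use assms in \<open>auto intro!: measurable_component_singleton\<close>)
    moreover have "0 \<le> (if i = k then s else t)" for i
      using assms by simp
    ultimately have "indep_vars (\<lambda>i. borel) (\<lambda>i \<omega>. \<beta> i (if i = k then s else t) \<omega>) UNIV"
      by simp
    then have iv: "indep_vars (\<lambda>i. borel) (\<lambda>i \<omega>. \<beta> i (if i = k then s else t) \<omega>) {k, l}"
      by (rule indep_vars_subset) simp
    have int: "integrable M (\<lambda>\<omega>. \<beta> i (if i = k then s else t) \<omega>)" if "i \<in> {k, l}" for i
      using \<beta>_square_integrable(1)[of s i] \<beta>_square_integrable(1)[of t i] assms by auto
    show ?thesis
      using indep_vars_lebesgue_integral[OF _ iv int] indep_vars_integrable[OF _ iv int] that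
        \<beta>_square_integrable(2)[OF assms(1), of k] by simp
  qed
  show "integrable M (\<lambda>\<omega>. \<beta> k s \<omega> * \<beta> l t \<omega>)"
    "(\<integral>\<omega>. \<beta> k s \<omega> * \<beta> l t \<omega> \<partial>M) = (if k = l then min s t else 0)"
    using other same[of s t] same[of t s] assms by (cases "k = l"; cases "s \<le> t"; simp add: mult.commute)+
qed

text \<open>Bilinear in the covariances min s t. The overlap is written as the measure of an
  intersection because the same number is the time integral of a product of two indicators; their
  agreement is the Ito isometry.\<close>

lemma inc_covariance:
  assumes "0 \<le> a" "a \<le> b" "0 \<le> c" "c \<le> d"
  shows "integrable M (\<lambda>\<omega>. inc k a b \<omega> * inc l c d \<omega>)"
    and "(\<integral>\<omega>. inc k a b \<omega> * inc l c d \<omega> \<partial>M) = (if k = l then measure lborel ({a<..b} \<inter> {c<..d}) else 0)"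
proof -
  have eq: "inc k a b \<omega> * inc l c d \<omega> = \<beta> k b \<omega> * \<beta> l d \<omega> - \<beta> k b \<omega> * \<beta> l c \<omega> - \<beta> k a \<omega> * \<beta> l d \<omega> + \<beta> k a \<omega> * \<beta> l c \<omega>" for \<omega>
    by (simp add: inc_def algebra_simps)
  have pos: "0 \<le> b" "0 \<le> d" using assms by auto
  note cov = \<beta>_covariance
  show "integrable M (\<lambda>\<omega>. inc k a b \<omega> * inc l c d \<omega>)"
    unfolding eq using assms pos by (intro Bochner_Integration.integrable_add Bochner_Integration.integrable_diff cov)
  have "{a<..b} \<inter> {c<..d} = {max a c<..min b d}" by auto
  moreover have "measure lborel {x<..y} = max 0 (y - x)" for x y :: real
    by (cases "x \<le> y") auto
  ultimately have m: "measure lborel ({a<..b} \<inter> {c<..d}) = max 0 (min b d - max a c)"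
    by metis
  have arith: "min b d - min b c - min a d + min a c = max 0 (min b d - max a c)"
    using assms by (smt (verit) min_def max_def)
  have bi: "has_bochner_integral M (\<lambda>\<omega>. \<beta> k s \<omega> * \<beta> l t \<omega>) (if k = l then min s t else 0)" if "0 \<le> s" "0 \<le> t" for s t
    using cov[OF that] by (simp add: has_bochner_integral_iff)
  have "has_bochner_integral M (\<lambda>\<omega>. inc k a b \<omega> * inc l c d \<omega>)
      ((if k = l then min b d else 0) - (if k = l then min b c else 0) - (if k = l then min a d else 0) + (if k = l then min a c else 0))"
    unfolding eq using assms pos by (intro has_bochner_integral_add has_bochner_integral_diff bi)
  then show "(\<integral>\<omega>. inc k a b \<omega> * inc l c d \<omega> \<partial>M) = (if k = l then measure lborel ({a<..b} \<inter> {c<..d}) else 0)"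
    unfolding m arith[symmetric] by (simp add: has_bochner_integral_iff split: if_splits)
qed


section \<open>The Q-Wiener process and the moments of its increments\<close>

definition noise_vec :: "nat \<Rightarrow> 'n l2_torus" where "noise_vec k = \<gamma> k *\<^sub>C e k"

abbreviation W where "W \<equiv> wiener_Q \<gamma> e \<beta>"

definition dW :: "real \<Rightarrow> real \<Rightarrow> 'a \<Rightarrow> 'n l2_torus" where "dW a b \<omega> = W b \<omega> - W a \<omega>"

text \<open>Mean gain of mass per unit of time.\<close>

definition \<kappa> :: real where "\<kappa> = \<alpha>\<^sup>2 * trace_Q \<gamma>"

lemma trace_nonneg: "0 \<le> trace_Q \<gamma>"
  unfolding trace_Q_def by (rule suminf_nonneg[OF summable_\<gamma>]) simp

lemma \<kappa>_nonneg: "0 \<le> \<kappa>"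
  unfolding \<kappa>_def by (simp add: trace_nonneg)

lemma suminf_ennreal_trace: "(\<Sum>k. ennreal ((cmod (\<gamma> k))\<^sup>2)) = ennreal (trace_Q \<gamma>)"
  unfolding trace_Q_def by (rule suminf_ennreal2[OF _ summable_\<gamma>]) simp

lemma inner_vec: "inner (noise_vec j) (noise_vec k) = (if j = k then (cmod (\<gamma> k))\<^sup>2 else 0)"
  using ons unfolding noise_vec_def inner_scaleC_cross complete_orthonormal_system_def
  by (auto simp: cmod_power2 power2_eq_square[symmetric])

lemma norm_vec: "norm (noise_vec k) = cmod (\<gamma> k)"
  by (simp add: norm_eq_sqrt_inner inner_vec)

lemma norm_sum_vec: "finite I \<Longrightarrow> (norm (\<Sum>k\<in>I. x k *\<^sub>R noise_vec k))\<^sup>2 = (\<Sum>k\<in>I. (cmod (\<gamma> k))\<^sup>2 * (x k)\<^sup>2)"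
  by (subst norm_sum_Pythagorean)
    (auto simp: pairwise_def orthogonal_def inner_vec norm_vec power_mult_distrib mult.commute)

text \<open>With gamma_k absorbed into \<open>noise_vec\<close>, W becomes a series with real
  coefficients along vectors that are orthogonal for the real inner product; all norms of W are
  computed in this form.\<close>

lemma W_eq: "W t \<omega> = (\<Sum>k. \<beta> k t \<omega> *\<^sub>R noise_vec k)"
  by (simp add: wiener_Q_def noise_vec_def scaleR_eq_scaleC scaleC_scaleC mult.commute)

lemma W_measurable_F: "0 \<le> t \<Longrightarrow> W t \<in> borel_measurable (F t)"
  unfolding W_eq[abs_def] by (intro borel_measurable_suminf borel_measurable_scaleR \<beta>_measurable) auto

lemma W_measurable: "0 \<le> t \<Longrightarrow> W t \<in> borel_measurable M"
  using W_measurable_F measurable_F_M by blast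

lemma dW_measurable_F: "0 \<le> a \<Longrightarrow> a \<le> b \<Longrightarrow> dW a b \<in> borel_measurable (F b)"
  unfolding dW_def[abs_def] by (intro borel_measurable_diff W_measurable_F measurable_F_mono[of a b]) auto

lemma dW_measurable: "0 \<le> a \<Longrightarrow> a \<le> b \<Longrightarrow> dW a b \<in> borel_measurable M"
  using dW_measurable_F measurable_F_M by (meson order_trans)

text \<open>\<open>wiener_Q\<close> is a \<open>suminf\<close> and carries information only where
  the series converges. The squared norms of its terms have total expectation t Tr(Q), so their sum
  is almost surely finite, and orthogonality turns this into convergence.\<close>

lemma W_sums:
  assumes t: "0 \<le> t"
  shows "AE \<omega> in M. (\<lambda>k. \<beta> k t \<omega> *\<^sub>R noise_vec k) sums W t \<omega>"
proof -
  have [measurable]: "\<beta> k t \<in> borel_measurable M" for k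
    using measurable_F_M[OF t \<beta>_measurable[OF t]] .
  have "(\<integral>\<^sup>+\<omega>. (\<Sum>k. ennreal ((cmod (\<gamma> k))\<^sup>2 * (\<beta> k t \<omega>)\<^sup>2)) \<partial>M) = (\<Sum>k. \<integral>\<^sup>+\<omega>. ennreal ((cmod (\<gamma> k))\<^sup>2 * (\<beta> k t \<omega>)\<^sup>2) \<partial>M)"
    by (intro nn_integral_suminf) measurable
  also have "\<dots> = (\<Sum>k. ennreal ((cmod (\<gamma> k))\<^sup>2 * t))"
    using \<beta>_square_integrable[OF t] by (intro suminf_cong) (simp add: nn_integral_eq_integral)
  also have "\<dots> = ennreal (\<Sum>k. (cmod (\<gamma> k))\<^sup>2 * t)"
    using t by (intro suminf_ennreal2 summable_mult2 summable_\<gamma>) simp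
  finally have "AE \<omega> in M. (\<Sum>k. ennreal ((cmod (\<gamma> k))\<^sup>2 * (\<beta> k t \<omega>)\<^sup>2)) \<noteq> \<infinity>"
    by (intro nn_integral_PInf_AE) auto
  then show ?thesis
  proof eventually_elim
    case (elim \<omega>)
    let ?f = "\<lambda>k. \<beta> k t \<omega> *\<^sub>R noise_vec k"
    have "summable (\<lambda>k. (cmod (\<gamma> k))\<^sup>2 * (\<beta> k t \<omega>)\<^sup>2)"
      using elim by (intro summable_suminf_not_top) auto
    then have "(\<lambda>k. (norm (?f k))\<^sup>2) summable_on UNIV"
      by (intro summable_nonneg_imp_summable_on) (simp_all add: norm_vec power_mult_distrib mult.commute)
    then have "?f summable_on UNIV"
      by (rule orthogonal_summable(1)[rotated]) (simp add: inner_vec)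
    then have "summable ?f"
      by (rule summable_on_imp_summable)
    then show ?case
      unfolding W_eq by (rule summable_sums)
  qed
qed

lemma dW_sums:
  assumes "0 \<le> a" "a \<le> b"
  shows "AE \<omega> in M. (\<lambda>k. inc k a b \<omega> *\<^sub>R noise_vec k) sums dW a b \<omega>"
proof -
  have "0 \<le> b" using assms by simp
  from W_sums[OF assms(1)] W_sums[OF this] show ?thesis
    by eventually_elim (auto simp: inc_def dW_def scaleR_diff_left intro: sums_diff)
qed

lemma norm_square_sums_vec:
  assumes "(\<lambda>k. x k *\<^sub>R noise_vec k) sums w"
  shows "(\<lambda>k. (cmod (\<gamma> k))\<^sup>2 * (x k)\<^sup>2) sums (norm w)\<^sup>2"
proof -
  have "(\<lambda>n. (norm (\<Sum>k<n. x k *\<^sub>R noise_vec k))\<^sup>2) \<longlonglongrightarrow> (norm w)\<^sup>2"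
    using assms unfolding sums_def by (intro tendsto_intros)
  then show ?thesis
    by (simp add: sums_def norm_sum_vec)
qed

text \<open>Supplies the dominating function when partial sums over the modes are passed to the
  limit.\<close>

lemma norm_sum_vec_le:
  assumes "(\<lambda>k. x k *\<^sub>R noise_vec k) sums w"
  shows "norm (\<Sum>k<n. x k *\<^sub>R noise_vec k) \<le> norm w"
proof -
  note s = norm_square_sums_vec[OF assms]
  have "(norm (\<Sum>k<n. x k *\<^sub>R noise_vec k))\<^sup>2 \<le> (norm w)\<^sup>2"
    using sum_le_suminf[of "\<lambda>k. (cmod (\<gamma> k))\<^sup>2 * (x k)\<^sup>2" "{..<n}"] s
    by (simp add: norm_sum_vec sums_iff)
  then show ?thesis by (rule power2_le_imp_le) simp
qed

text \<open>Orthogonality makes the squared norm of \<open>dW\<close> diagonal in k, so it is enough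
  to know each scalar increment separately against F(a); the sum over k is then exchanged with the
  integral by monotone convergence.\<close>

lemma norm_dW_nn_integral:
  assumes ab: "0 \<le> a" "a \<le> b" and f: "f \<in> borel_measurable (F a)"
  shows "(\<integral>\<^sup>+\<omega>. f \<omega> * ennreal ((norm (dW a b \<omega>))\<^sup>2) \<partial>M) = ennreal ((b - a) * trace_Q \<gamma>) * (\<integral>\<^sup>+\<omega>. f \<omega> \<partial>M)"
proof -
  have [measurable]: "f \<in> borel_measurable M" "\<And>k. inc k a b \<in> borel_measurable M"
    using measurable_F_M[OF ab(1) f] inc_measurable[OF ab] by auto
  have "AE \<omega> in M. f \<omega> * ennreal ((norm (dW a b \<omega>))\<^sup>2) = (\<Sum>k. ennreal ((cmod (\<gamma> k))\<^sup>2) * (f \<omega> * ennreal ((inc k a b \<omega>)\<^sup>2)))"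
    using dW_sums[OF ab]
  proof eventually_elim
    case (elim \<omega>)
    note s = norm_square_sums_vec[OF elim]
    have "ennreal ((norm (dW a b \<omega>))\<^sup>2) = (\<Sum>k. ennreal ((cmod (\<gamma> k))\<^sup>2 * (inc k a b \<omega>)\<^sup>2))"
      by (rule suminf_ennreal_eq[OF _ s, symmetric]) simp
    then have "f \<omega> * ennreal ((norm (dW a b \<omega>))\<^sup>2) = (\<Sum>k. f \<omega> * ennreal ((cmod (\<gamma> k))\<^sup>2 * (inc k a b \<omega>)\<^sup>2))"
      by (simp only: ennreal_suminf_cmult)
    also have "\<dots> = (\<Sum>k. ennreal ((cmod (\<gamma> k))\<^sup>2) * (f \<omega> * ennreal ((inc k a b \<omega>)\<^sup>2)))"
      by (intro suminf_cong) (simp add: ennreal_mult mult.left_commute)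
    finally show ?case .
  qed
  then have "(\<integral>\<^sup>+\<omega>. f \<omega> * ennreal ((norm (dW a b \<omega>))\<^sup>2) \<partial>M)
      = (\<integral>\<^sup>+\<omega>. (\<Sum>k. ennreal ((cmod (\<gamma> k))\<^sup>2) * (f \<omega> * ennreal ((inc k a b \<omega>)\<^sup>2))) \<partial>M)"
    by (rule nn_integral_cong_AE)
  also have "\<dots> = (\<Sum>k. \<integral>\<^sup>+\<omega>. ennreal ((cmod (\<gamma> k))\<^sup>2) * (f \<omega> * ennreal ((inc k a b \<omega>)\<^sup>2)) \<partial>M)"
    by (intro nn_integral_suminf) measurable
  also have "\<dots> = (\<Sum>k. ennreal ((cmod (\<gamma> k))\<^sup>2) * ((\<integral>\<^sup>+\<omega>. f \<omega> \<partial>M) * ennreal (b - a)))"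
    using inc_nn_integral[OF ab f] by (simp add: nn_integral_cmult)
  also have "\<dots> = ennreal (trace_Q \<gamma>) * ((\<integral>\<^sup>+\<omega>. f \<omega> \<partial>M) * ennreal (b - a))"
    by (simp add: suminf_ennreal_trace)
  also have "\<dots> = ennreal ((b - a) * trace_Q \<gamma>) * (\<integral>\<^sup>+\<omega>. f \<omega> \<partial>M)"
    using ab trace_nonneg by (simp add: ennreal_mult mult_ac)
  finally show ?thesis .
qed

text \<open>Cauchy-Schwarz with weights |gamma_k|^2 bounds the fourth power of the norm by Tr(Q)
  times the sum of |gamma_k|^2 times the fourth powers of the scalar increments. Thus only fourth
  moments of single increments enter, and the Gaussian constant 3 survives.\<close>

lemma norm_dW_fourth_moment:
  assumes ab: "0 \<le> a" "a \<le> b"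
  shows "(\<integral>\<^sup>+\<omega>. ennreal ((norm (dW a b \<omega>)) ^ 4) \<partial>M) \<le> ennreal (3 * ((b - a) * trace_Q \<gamma>)\<^sup>2)"
proof -
  have [measurable]: "\<And>k. inc k a b \<in> borel_measurable M"
    using inc_measurable[OF ab] by auto
  let ?g = "\<lambda>k. (cmod (\<gamma> k))\<^sup>2" and ?T = "trace_Q \<gamma>"
  have "AE \<omega> in M. ennreal ((norm (dW a b \<omega>)) ^ 4) \<le> (\<Sum>k. ennreal (?T * ?g k) * ennreal ((inc k a b \<omega>) ^ 4))"
    using dW_sums[OF ab]
  proof eventually_elim
    case (elim \<omega>)
    let ?x = "\<lambda>k. inc k a b \<omega>"
    have "(\<lambda>n. \<Sum>k<n. ?g k * (?x k)\<^sup>2) \<longlonglongrightarrow> (norm (dW a b \<omega>))\<^sup>2"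
      using norm_square_sums_vec[OF elim] by (simp add: sums_def)
    then have lim: "(\<lambda>n. ennreal ((\<Sum>k<n. ?g k * (?x k)\<^sup>2)\<^sup>2)) \<longlonglongrightarrow> ennreal (((norm (dW a b \<omega>))\<^sup>2)\<^sup>2)"
      by (intro tendsto_intros)
    have le: "ennreal ((\<Sum>k<n. ?g k * (?x k)\<^sup>2)\<^sup>2) \<le> (\<Sum>k. ennreal (?T * ?g k) * ennreal ((?x k) ^ 4))" for n
    proof -
      have "(\<Sum>k<n. ?g k * (?x k)\<^sup>2)\<^sup>2 = (\<Sum>k<n. cmod (\<gamma> k) * (cmod (\<gamma> k) * (?x k)\<^sup>2))\<^sup>2"
        by (simp add: power2_eq_square mult.assoc)
      also have "\<dots> \<le> (\<Sum>k<n. ?g k) * (\<Sum>k<n. (cmod (\<gamma> k) * (?x k)\<^sup>2)\<^sup>2)"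
        by (rule Cauchy_Schwarz_ineq_sum)
      also have "\<dots> \<le> ?T * (\<Sum>k<n. (cmod (\<gamma> k) * (?x k)\<^sup>2)\<^sup>2)"
        using sum_le_suminf[OF summable_\<gamma>, of "{..<n}"] by (intro mult_right_mono) (auto simp: trace_Q_def sum_nonneg)
      also have "\<dots> = (\<Sum>k<n. ?T * ?g k * (?x k) ^ 4)"
        by (simp add: sum_distrib_left power_mult_distrib power_mult[symmetric] mult.assoc)
      finally have "ennreal ((\<Sum>k<n. ?g k * (?x k)\<^sup>2)\<^sup>2) \<le> ennreal (\<Sum>k<n. ?T * ?g k * (?x k) ^ 4)"
        by (rule ennreal_leI)
      also have "\<dots> = (\<Sum>k<n. ennreal (?T * ?g k) * ennreal ((?x k) ^ 4))"
        by (subst sum_ennreal[symmetric]) (auto simp: trace_nonneg ennreal_mult intro!: sum.cong)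
      also have "\<dots> \<le> (\<Sum>k. ennreal (?T * ?g k) * ennreal ((?x k) ^ 4))"
        by (rule sum_le_suminf) auto
      finally show ?thesis .
    qed
    have "ennreal (((norm (dW a b \<omega>))\<^sup>2)\<^sup>2) \<le> (\<Sum>k. ennreal (?T * ?g k) * ennreal ((?x k) ^ 4))"
      by (rule LIMSEQ_le_const2[OF lim]) (use le in blast)
    then show ?case by (simp add: power_mult[symmetric])
  qed
  then have "(\<integral>\<^sup>+\<omega>. ennreal ((norm (dW a b \<omega>)) ^ 4) \<partial>M) \<le> (\<integral>\<^sup>+\<omega>. (\<Sum>k. ennreal (?T * ?g k) * ennreal ((inc k a b \<omega>) ^ 4)) \<partial>M)"
    by (rule nn_integral_mono_AE)
  also have "\<dots> = (\<Sum>k. \<integral>\<^sup>+\<omega>. ennreal (?T * ?g k) * ennreal ((inc k a b \<omega>) ^ 4) \<partial>M)"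
    by (intro nn_integral_suminf) measurable
  also have "\<dots> = (\<Sum>k. ennreal (?g k) * ennreal (?T * (3 * (b - a)\<^sup>2)))"
    using inc_fourth_moment[OF ab] trace_nonneg
    by (intro suminf_cong) (simp add: nn_integral_cmult nn_integral_eq_integral ennreal_mult[symmetric] mult_ac)
  also have "\<dots> = ennreal ?T * ennreal (?T * (3 * (b - a)\<^sup>2))"
    by (simp add: suminf_ennreal_trace)
  also have "\<dots> = ennreal (3 * ((b - a) * ?T)\<^sup>2)"
  proof -
    have "ennreal ?T * ennreal (?T * (3 * (b - a)\<^sup>2)) = ennreal (?T * (?T * (3 * (b - a)\<^sup>2)))"
      by (rule ennreal_mult[symmetric]) (simp_all add: trace_nonneg)
    then show ?thesis by (simp add: power2_eq_square mult_ac)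
  qed
  finally show ?thesis .
qed

end

section \<open>Square-integrable increments\<close>

lemma abs_inner_le_squares: "\<bar>inner x y\<bar> \<le> (norm x)\<^sup>2 + (norm y)\<^sup>2" for x y :: "'h::real_inner"
proof -
  have "\<bar>inner x y\<bar> \<le> norm x * norm y" by (rule Cauchy_Schwarz_ineq2)
  moreover have "2 * (norm x * norm y) \<le> (norm x)\<^sup>2 + (norm y)\<^sup>2"
    using sum_squares_bound[of "norm x" "norm y"] by simp
  moreover have "0 \<le> norm x * norm y" by simp
  ultimately show ?thesis by linarith
qed

lemma integrable_inner:
  fixes X Y :: "'a \<Rightarrow> 'h::{real_inner, second_countable_topology}"
  assumes [measurable]: "X \<in> borel_measurable M" "Y \<in> borel_measurable M"
    and "integrable M (\<lambda>\<omega>. (norm (X \<omega>))\<^sup>2)" "integrable M (\<lambda>\<omega>. (norm (Y \<omega>))\<^sup>2)"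
  shows "integrable M (\<lambda>\<omega>. inner (X \<omega>) (Y \<omega>))"
proof (rule Bochner_Integration.integrable_bound)
  show "integrable M (\<lambda>\<omega>. (norm (X \<omega>))\<^sup>2 + (norm (Y \<omega>))\<^sup>2)"
    using assms by simp
  show "AE \<omega> in M. norm (inner (X \<omega>) (Y \<omega>)) \<le> norm ((norm (X \<omega>))\<^sup>2 + (norm (Y \<omega>))\<^sup>2)"
    using abs_inner_le_squares by (auto intro!: AE_I2)
qed measurable

lemma norm_add_square_le: "(norm (x + y))\<^sup>2 \<le> 2 * (norm x)\<^sup>2 + 2 * (norm y)\<^sup>2" for x y :: "'h::real_normed_vector"
proof -
  have "(norm (x + y))\<^sup>2 \<le> (norm x + norm y)\<^sup>2"
    by (intro power_mono norm_triangle_ineq) simp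
  then show ?thesis
    using sum_squares_bound[of "norm x" "norm y"] by (simp add: power2_sum)
qed

lemma integrable_norm_square_add:
  fixes X Y :: "'a \<Rightarrow> 'h::{real_inner, second_countable_topology}"
  assumes [measurable]: "X \<in> borel_measurable M" "Y \<in> borel_measurable M"
    and "integrable M (\<lambda>\<omega>. (norm (X \<omega>))\<^sup>2)" "integrable M (\<lambda>\<omega>. (norm (Y \<omega>))\<^sup>2)"
  shows "integrable M (\<lambda>\<omega>. (norm (X \<omega> + Y \<omega>))\<^sup>2)"
proof (rule Bochner_Integration.integrable_bound)
  show "integrable M (\<lambda>\<omega>. 2 * (norm (X \<omega>))\<^sup>2 + 2 * (norm (Y \<omega>))\<^sup>2)"
    using assms by simp
  show "AE \<omega> in M. norm ((norm (X \<omega> + Y \<omega>))\<^sup>2) \<le> norm (2 * (norm (X \<omega>))\<^sup>2 + 2 * (norm (Y \<omega>))\<^sup>2)"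
    using norm_add_square_le by (auto intro!: AE_I2)
qed measurable

lemma integrable_of_nn_integral_le:
  fixes f :: "'a \<Rightarrow> real"
  assumes "f \<in> borel_measurable M" "\<And>\<omega>. 0 \<le> f \<omega>" "(\<integral>\<^sup>+\<omega>. ennreal (f \<omega>) \<partial>M) \<le> ennreal c"
  shows "integrable M f" and "0 \<le> c \<Longrightarrow> (\<integral>\<omega>. f \<omega> \<partial>M) \<le> c"
proof -
  show i: "integrable M f"
    using assms by (intro integrableI_nonneg) (auto intro: le_less_trans)
  show "0 \<le> c \<Longrightarrow> (\<integral>\<omega>. f \<omega> \<partial>M) \<le> c"
    using assms(3) nn_integral_eq_integral[OF i] assms(2) by simp
qed

context noise
begin

text \<open>
  \<open>increment C s t D\<close>: the variable \<open>D\<close> behaves like an increment over \<open>[s, t]\<close> of the noise with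
  covariance $\alpha^2 Q$, pushed through a unitary; \<open>C\<close> bounds the kurtosis.  The
  $\beta_k$ are not assumed to be jointly independent of $\mathcal{F}(s)$; for a single increment of $W^Q$ the
  mixed terms vanish by the orthogonality of the $e_k$ instead.
\<close>

definition increment :: "real \<Rightarrow> real \<Rightarrow> real \<Rightarrow> ('a \<Rightarrow> 'n l2_torus) \<Rightarrow> bool" where
  "increment C s t D \<longleftrightarrow> 0 \<le> s \<and> s \<le> t \<and> 0 \<le> C \<and> D \<in> borel_measurable (F t) \<and>
    (\<forall>A\<in>sets (F s). (\<integral>\<^sup>+\<omega>. ennreal ((norm (D \<omega>))\<^sup>2) * indicator A \<omega> \<partial>M) = ennreal ((t - s) * \<kappa>) * emeasure M A) \<and>
    (\<forall>X\<in>borel_measurable (F s). (\<exists>R. \<forall>\<omega>. norm (X \<omega>) \<le> R) \<longrightarrow> (\<integral>\<omega>. inner (X \<omega>) (D \<omega>) \<partial>M) = 0) \<and>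
    (\<integral>\<^sup>+\<omega>. ennreal ((norm (D \<omega>)) ^ 4) \<partial>M) \<le> ennreal (C * ((t - s) * \<kappa>)\<^sup>2)"

section \<open>Moments of an increment against the past\<close>

context
  fixes C s t D
  assumes inc: "increment C s t D"
begin

lemma increment_times: "0 \<le> s" "s \<le> t" "0 \<le> t" "0 \<le> C" "0 \<le> (t - s) * \<kappa>"
  using inc \<kappa>_nonneg by (auto simp: increment_def)

lemma increment_measurable_F: "D \<in> borel_measurable (F t)"
  using inc by (simp add: increment_def)

lemma increment_measurable: "D \<in> borel_measurable M"
  using measurable_F_M[OF increment_times(3) increment_measurable_F] .

lemma increment_nn_integral_set: "A \<in> sets (F s) \<Longrightarrow>
    (\<integral>\<^sup>+\<omega>. ennreal ((norm (D \<omega>))\<^sup>2) * indicator A \<omega> \<partial>M) = ennreal ((t - s) * \<kappa>) * emeasure M A"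
  using inc by (simp add: increment_def)

text \<open>The definition tests the conditional second moment on sets of F(s) only, a form that
  passes readily through sums and limits; the monotone class argument extends it to all weights with
  values in [0, \<infinity>].\<close>

lemma increment_nn_integral:
  assumes "f \<in> borel_measurable (F s)"
  shows "(\<integral>\<^sup>+\<omega>. f \<omega> * ennreal ((norm (D \<omega>))\<^sup>2) \<partial>M) = ennreal ((t - s) * \<kappa>) * (\<integral>\<^sup>+\<omega>. f \<omega> \<partial>M)"
proof -
  have [measurable]: "D \<in> borel_measurable M" by (rule increment_measurable)
  have mM: "g \<in> borel_measurable (F s) \<Longrightarrow> g \<in> borel_measurable M" for g :: "'a \<Rightarrow> ennreal"
    using measurable_F_M[OF increment_times(1)] .
  show ?thesis
    using assms
  proof (induction rule: borel_measurable_induct)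
    case (cong f g)
    then have "\<And>\<omega>. \<omega> \<in> space M \<Longrightarrow> f \<omega> = g \<omega>" using space_F[OF increment_times(1)] by simp
    then have "(\<integral>\<^sup>+\<omega>. f \<omega> * ennreal ((norm (D \<omega>))\<^sup>2) \<partial>M) = (\<integral>\<^sup>+\<omega>. g \<omega> * ennreal ((norm (D \<omega>))\<^sup>2) \<partial>M)"
      "(\<integral>\<^sup>+\<omega>. f \<omega> \<partial>M) = (\<integral>\<^sup>+\<omega>. g \<omega> \<partial>M)"
      by (auto intro!: nn_integral_cong)
    then show ?case using cong by simp
  next
    case (set A)
    then show ?case
      using increment_nn_integral_set[OF set] sets_F[OF increment_times(1) set] by (simp add: mult.commute)
  next
    case (mult g c)
    have gM [measurable]: "g \<in> borel_measurable M" using mult mM by blast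
    have "(\<integral>\<^sup>+\<omega>. c * g \<omega> * ennreal ((norm (D \<omega>))\<^sup>2) \<partial>M) = (\<integral>\<^sup>+\<omega>. c * (g \<omega> * ennreal ((norm (D \<omega>))\<^sup>2)) \<partial>M)"
      by (simp only: mult.assoc)
    also have "\<dots> = c * (\<integral>\<^sup>+\<omega>. g \<omega> * ennreal ((norm (D \<omega>))\<^sup>2) \<partial>M)"
      by (rule nn_integral_cmult) measurable
    also have "\<dots> = ennreal ((t - s) * \<kappa>) * (\<integral>\<^sup>+\<omega>. c * g \<omega> \<partial>M)"
      by (subst nn_integral_cmult[OF gM], subst mult.IH) (rule mult.left_commute)
    finally show ?case .
  next
    case (add g h)
    have gM [measurable]: "g \<in> borel_measurable M" "h \<in> borel_measurable M" using add mM by blast+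
    have "(\<integral>\<^sup>+\<omega>. (h \<omega> + g \<omega>) * ennreal ((norm (D \<omega>))\<^sup>2) \<partial>M)
        = (\<integral>\<^sup>+\<omega>. h \<omega> * ennreal ((norm (D \<omega>))\<^sup>2) \<partial>M) + (\<integral>\<^sup>+\<omega>. g \<omega> * ennreal ((norm (D \<omega>))\<^sup>2) \<partial>M)"
      unfolding distrib_right by (rule nn_integral_add) measurable
    also have "\<dots> = ennreal ((t - s) * \<kappa>) * (\<integral>\<^sup>+\<omega>. h \<omega> + g \<omega> \<partial>M)"
      unfolding nn_integral_add[OF gM(2,1)] add.IH by (rule distrib_left[symmetric])
    finally show ?case .
  next
    case (seq U)
    have U: "U i \<in> borel_measurable M" for i using seq mM by blast
    have inc': "incseq (\<lambda>i \<omega>. U i \<omega> * ennreal ((norm (D \<omega>))\<^sup>2))"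
      using seq by (auto simp: incseq_def le_fun_def intro!: mult_right_mono)
    have "(\<integral>\<^sup>+\<omega>. (SUP i. U i) \<omega> * ennreal ((norm (D \<omega>))\<^sup>2) \<partial>M) = (\<integral>\<^sup>+\<omega>. (SUP i. U i \<omega> * ennreal ((norm (D \<omega>))\<^sup>2)) \<partial>M)"
      by (simp add: SUP_mult_right_ennreal image_comp)
    also have "\<dots> = (SUP i. \<integral>\<^sup>+\<omega>. U i \<omega> * ennreal ((norm (D \<omega>))\<^sup>2) \<partial>M)"
      using U inc' by (intro nn_integral_monotone_convergence_SUP) auto
    also have "\<dots> = (SUP i. ennreal ((t - s) * \<kappa>) * (\<integral>\<^sup>+\<omega>. U i \<omega> \<partial>M))"
      using seq by simp
    also have "\<dots> = ennreal ((t - s) * \<kappa>) * (SUP i. \<integral>\<^sup>+\<omega>. U i \<omega> \<partial>M)"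
      by (simp add: SUP_mult_left_ennreal)
    also have "(SUP i. \<integral>\<^sup>+\<omega>. U i \<omega> \<partial>M) = (\<integral>\<^sup>+\<omega>. (SUP i. U i \<omega>) \<partial>M)"
      using U seq by (intro nn_integral_monotone_convergence_SUP[symmetric]) auto
    finally show ?case by (simp add: image_comp)
  qed
qed

lemma increment_square:
  shows "integrable M (\<lambda>\<omega>. (norm (D \<omega>))\<^sup>2)" and "(\<integral>\<omega>. (norm (D \<omega>))\<^sup>2 \<partial>M) = (t - s) * \<kappa>"
proof -
  have [measurable]: "D \<in> borel_measurable M" by (rule increment_measurable)
  have eq: "(\<integral>\<^sup>+\<omega>. ennreal ((norm (D \<omega>))\<^sup>2) \<partial>M) = ennreal ((t - s) * \<kappa>)"
    using increment_nn_integral[of "\<lambda>_. 1"] by (simp add: emeasure_space_1)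
  show i: "integrable M (\<lambda>\<omega>. (norm (D \<omega>))\<^sup>2)"
    by (rule integrable_of_nn_integral_le(1)) (use eq in auto)
  show "(\<integral>\<omega>. (norm (D \<omega>))\<^sup>2 \<partial>M) = (t - s) * \<kappa>"
    using eq nn_integral_eq_integral[OF i] increment_times by simp
qed

lemma increment_fourth:
  shows "integrable M (\<lambda>\<omega>. (norm (D \<omega>)) ^ 4)" and "(\<integral>\<omega>. (norm (D \<omega>)) ^ 4 \<partial>M) \<le> C * ((t - s) * \<kappa>)\<^sup>2"
  using integrable_of_nn_integral_le[of "\<lambda>\<omega>. (norm (D \<omega>)) ^ 4" M "C * ((t - s) * \<kappa>)\<^sup>2"]
    increment_measurable inc increment_times by (auto simp: increment_def)

lemma increment_weighted:
  assumes X: "X \<in> borel_measurable (F s)" and i: "integrable M (\<lambda>\<omega>. (norm (X \<omega>))\<^sup>2)"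
  shows "integrable M (\<lambda>\<omega>. (norm (X \<omega>))\<^sup>2 * (norm (D \<omega>))\<^sup>2)"
    and "(\<integral>\<omega>. (norm (X \<omega>))\<^sup>2 * (norm (D \<omega>))\<^sup>2 \<partial>M) = (t - s) * \<kappa> * (\<integral>\<omega>. (norm (X \<omega>))\<^sup>2 \<partial>M)"
proof -
  have [measurable]: "D \<in> borel_measurable M" "X \<in> borel_measurable M"
    using increment_measurable measurable_F_M[OF increment_times(1) X] by auto
  have "(\<lambda>\<omega>. ennreal ((norm (X \<omega>))\<^sup>2)) \<in> borel_measurable (F s)"
    using X by measurable
  from increment_nn_integral[OF this]
  have eq: "(\<integral>\<^sup>+\<omega>. ennreal ((norm (X \<omega>))\<^sup>2 * (norm (D \<omega>))\<^sup>2) \<partial>M) = ennreal ((t - s) * \<kappa> * (\<integral>\<omega>. (norm (X \<omega>))\<^sup>2 \<partial>M))"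
    using increment_times nn_integral_eq_integral[OF i] by (simp add: ennreal_mult)
  show i2: "integrable M (\<lambda>\<omega>. (norm (X \<omega>))\<^sup>2 * (norm (D \<omega>))\<^sup>2)"
    by (rule integrable_of_nn_integral_le(1)) (use eq in auto)
  show "(\<integral>\<omega>. (norm (X \<omega>))\<^sup>2 * (norm (D \<omega>))\<^sup>2 \<partial>M) = (t - s) * \<kappa> * (\<integral>\<omega>. (norm (X \<omega>))\<^sup>2 \<partial>M)"
    using eq nn_integral_eq_integral[OF i2] increment_times by simp
qed

text \<open>Truncation of X at norm n reduces to the bounded case. Only the product is assumed
  integrable, which admits the cubic weight of \<open>increment_add\<close> and the product weight
  of \<open>martingale_transform\<close>, whose squared norms need not be integrable.\<close>

lemma increment_cross:
  assumes X: "X \<in> borel_measurable (F s)" and i: "integrable M (\<lambda>\<omega>. inner (X \<omega>) (D \<omega>))"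
  shows "(\<integral>\<omega>. inner (X \<omega>) (D \<omega>) \<partial>M) = 0"
proof -
  have [measurable]: "D \<in> borel_measurable M" "X \<in> borel_measurable M"
    using increment_measurable measurable_F_M[OF increment_times(1) X] by auto
  define Y where "Y n \<omega> = (if norm (X \<omega>) \<le> real n then X \<omega> else 0)" for n \<omega>
  have Y: "Y n \<in> borel_measurable (F s)" for n
    unfolding Y_def using X by measurable
  then have [measurable]: "Y n \<in> borel_measurable M" for n
    using measurable_F_M[OF increment_times(1)] by blast
  have "(\<lambda>n. \<integral>\<omega>. inner (Y n \<omega>) (D \<omega>) \<partial>M) \<longlonglongrightarrow> (\<integral>\<omega>. inner (X \<omega>) (D \<omega>) \<partial>M)"
  proof (rule Bochner_Integration.integral_dominated_convergence)
    show "integrable M (\<lambda>\<omega>. \<bar>inner (X \<omega>) (D \<omega>)\<bar>)" using i by simp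
    show "AE \<omega> in M. (\<lambda>n. inner (Y n \<omega>) (D \<omega>)) \<longlonglongrightarrow> inner (X \<omega>) (D \<omega>)"
    proof (rule AE_I2)
      fix \<omega>
      obtain N :: nat where "norm (X \<omega>) \<le> real N" using real_arch_simple by blast
      then have "inner (Y n \<omega>) (D \<omega>) = inner (X \<omega>) (D \<omega>)" if "N \<le> n" for n
        using that by (simp add: Y_def)
      then show "(\<lambda>n. inner (Y n \<omega>) (D \<omega>)) \<longlonglongrightarrow> inner (X \<omega>) (D \<omega>)"
        by (intro tendsto_eventually) (auto intro: eventually_sequentiallyI)
    qed
  qed (auto simp: Y_def)
  moreover have "(\<integral>\<omega>. inner (Y n \<omega>) (D \<omega>) \<partial>M) = 0" for n
  proof -
    have "\<forall>\<omega>. norm (Y n \<omega>) \<le> real n" by (simp add: Y_def)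
    then show ?thesis using inc Y[of n] by (auto simp: increment_def)
  qed
  ultimately show ?thesis by (simp add: LIMSEQ_const_iff)
qed

lemma increment_cross_L2:
  assumes X: "X \<in> borel_measurable (F s)" and i: "integrable M (\<lambda>\<omega>. (norm (X \<omega>))\<^sup>2)"
  shows "integrable M (\<lambda>\<omega>. inner (X \<omega>) (D \<omega>))" and "(\<integral>\<omega>. inner (X \<omega>) (D \<omega>) \<partial>M) = 0"
proof -
  show ii: "integrable M (\<lambda>\<omega>. inner (X \<omega>) (D \<omega>))"
    by (rule integrable_inner[OF measurable_F_M[OF increment_times(1) X] increment_measurable i increment_square(1)])
  show "(\<integral>\<omega>. inner (X \<omega>) (D \<omega>) \<partial>M) = 0"
    by (rule increment_cross[OF X ii])
qed

lemma increment_cross_square: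
  assumes X: "X \<in> borel_measurable (F s)" and i: "integrable M (\<lambda>\<omega>. (norm (X \<omega>))\<^sup>2)"
  shows "integrable M (\<lambda>\<omega>. (inner (X \<omega>) (D \<omega>))\<^sup>2)"
    and "(\<integral>\<omega>. (inner (X \<omega>) (D \<omega>))\<^sup>2 \<partial>M) \<le> (t - s) * \<kappa> * (\<integral>\<omega>. (norm (X \<omega>))\<^sup>2 \<partial>M)"
proof -
  have [measurable]: "D \<in> borel_measurable M" "X \<in> borel_measurable M"
    using increment_measurable measurable_F_M[OF increment_times(1) X] by auto
  have le: "(inner (X \<omega>) (D \<omega>))\<^sup>2 \<le> (norm (X \<omega>))\<^sup>2 * (norm (D \<omega>))\<^sup>2" for \<omega>
    using Cauchy_Schwarz_ineq[of "X \<omega>" "D \<omega>"] by (simp add: power2_norm_eq_inner)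
  show ii: "integrable M (\<lambda>\<omega>. (inner (X \<omega>) (D \<omega>))\<^sup>2)"
    by (rule Bochner_Integration.integrable_bound[OF increment_weighted(1)[OF X i]]) (use le in auto)
  show "(\<integral>\<omega>. (inner (X \<omega>) (D \<omega>))\<^sup>2 \<partial>M) \<le> (t - s) * \<kappa> * (\<integral>\<omega>. (norm (X \<omega>))\<^sup>2 \<partial>M)"
    unfolding increment_weighted(2)[OF X i, symmetric]
    by (rule integral_mono[OF ii increment_weighted(1)[OF X i]]) (rule le)
qed

end

text \<open>Since \<open>C\<close> scales norms by |alpha|, the second and fourth moments come from
  those of \<open>dW\<close>. Orthogonality to a bounded past weight holds for partial sums in k, as
  each term is a past factor times a centred independent increment, and passes to the limit by
  domination.\<close>

lemma increment_base:
  assumes ab: "0 \<le> a" "a \<le> b" and C: "bounded_linear C" and nC: "\<And>x. norm (C x) = \<bar>\<alpha>\<bar> * norm x"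
  shows "increment 3 a b (\<lambda>\<omega>. C (dW a b \<omega>))"
proof -
  interpret C: bounded_linear C by (rule C)
  have Cm: "C \<in> borel_measurable borel"
    by (intro borel_measurable_continuous_onI linear_continuous_on C)
  have b: "0 \<le> b" using ab by simp
  have mF: "(\<lambda>\<omega>. C (dW a b \<omega>)) \<in> borel_measurable (F b)"
    using measurable_compose[OF dW_measurable_F[OF ab] Cm] .
  have [measurable]: "(\<lambda>\<omega>. C (dW a b \<omega>)) \<in> borel_measurable M" "dW a b \<in> borel_measurable M"
    using measurable_F_M[OF b mF] dW_measurable[OF ab] by auto
  have sq: "ennreal ((norm (C (dW a b \<omega>)))\<^sup>2) = ennreal (\<alpha>\<^sup>2) * ennreal ((norm (dW a b \<omega>))\<^sup>2)" for \<omega>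
    by (simp add: nC power_mult_distrib ennreal_mult)
  have P2: "(\<integral>\<^sup>+\<omega>. ennreal ((norm (C (dW a b \<omega>)))\<^sup>2) * indicator A \<omega> \<partial>M) = ennreal ((b - a) * \<kappa>) * emeasure M A"
    if A: "A \<in> sets (F a)" for A
  proof -
    have AM [measurable]: "A \<in> sets M" using sets_F[OF ab(1) A] .
    have "(\<integral>\<^sup>+\<omega>. ennreal ((norm (C (dW a b \<omega>)))\<^sup>2) * indicator A \<omega> \<partial>M)
        = (\<integral>\<^sup>+\<omega>. ennreal (\<alpha>\<^sup>2) * (indicator A \<omega> * ennreal ((norm (dW a b \<omega>))\<^sup>2)) \<partial>M)"
      by (simp add: sq mult_ac)
    also have "\<dots> = ennreal (\<alpha>\<^sup>2) * (\<integral>\<^sup>+\<omega>. indicator A \<omega> * ennreal ((norm (dW a b \<omega>))\<^sup>2) \<partial>M)"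
      by (rule nn_integral_cmult) measurable
    also have "\<dots> = ennreal (\<alpha>\<^sup>2) * (ennreal ((b - a) * trace_Q \<gamma>) * (\<integral>\<^sup>+\<omega>. indicator A \<omega> \<partial>M))"
      by (subst norm_dW_nn_integral[OF ab]) (use A in auto)
    also have "\<dots> = ennreal ((b - a) * \<kappa>) * emeasure M A"
      using ab trace_nonneg by (simp add: \<kappa>_def ennreal_mult mult_ac)
    finally show ?thesis .
  qed
  have "(\<integral>\<^sup>+\<omega>. ennreal ((norm (dW a b \<omega>))\<^sup>2) \<partial>M) \<le> ennreal ((b - a) * trace_Q \<gamma>)"
    using norm_dW_nn_integral[OF ab, of "\<lambda>_. 1"] by (simp add: emeasure_space_1)
  then have i2: "integrable M (\<lambda>\<omega>. (norm (dW a b \<omega>))\<^sup>2)"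
    by (intro integrable_of_nn_integral_le(1)) auto
  then have i1: "integrable M (\<lambda>\<omega>. norm (dW a b \<omega>))"
    by (rule square_integrable_imp_integrable[rotated]) measurable
  have P1: "(\<integral>\<omega>. inner (X \<omega>) (C (dW a b \<omega>)) \<partial>M) = 0"
    if X: "X \<in> borel_measurable (F a)" and R: "\<And>\<omega>. norm (X \<omega>) \<le> R" for X R
  proof -
    have [measurable]: "X \<in> borel_measurable M" using measurable_F_M[OF ab(1) X] .
    have [measurable]: "inc k a b \<in> borel_measurable M" for k using inc_measurable[OF ab] .
    have eq: "inner (X \<omega>) (C (\<Sum>k<n. inc k a b \<omega> *\<^sub>R noise_vec k)) = (\<Sum>k<n. inner (X \<omega>) (C (noise_vec k)) * inc k a b \<omega>)" for \<omega> n
      by (simp add: C.sum C.scaleR inner_sum_right mult.commute)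
    have Xk: "(\<lambda>\<omega>. inner (X \<omega>) (C (noise_vec k))) \<in> borel_measurable (F a)" for k
      using X by measurable
    have iXk: "integrable M (\<lambda>\<omega>. inner (X \<omega>) (C (noise_vec k)))" for k
    proof (rule integrable_const_bound[where B = "R * norm (C (noise_vec k))"])
      show "AE \<omega> in M. norm (inner (X \<omega>) (C (noise_vec k))) \<le> R * norm (C (noise_vec k))"
        using R by (auto intro!: AE_I2 order_trans[OF Cauchy_Schwarz_ineq2] mult_right_mono)
    qed measurable
    have "(\<integral>\<omega>. inner (X \<omega>) (C (\<Sum>k<n. inc k a b \<omega> *\<^sub>R noise_vec k)) \<partial>M) = 0" for n
      unfolding eq using inc_cross[OF ab Xk iXk] by simp
    moreover have "(\<lambda>n. \<integral>\<omega>. inner (X \<omega>) (C (\<Sum>k<n. inc k a b \<omega> *\<^sub>R noise_vec k)) \<partial>M) \<longlonglongrightarrow> (\<integral>\<omega>. inner (X \<omega>) (C (dW a b \<omega>)) \<partial>M)"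
    proof (rule Bochner_Integration.integral_dominated_convergence)
      show "integrable M (\<lambda>\<omega>. R * (\<bar>\<alpha>\<bar> * norm (dW a b \<omega>)))" using i1 by simp
      show "AE \<omega> in M. (\<lambda>n. inner (X \<omega>) (C (\<Sum>k<n. inc k a b \<omega> *\<^sub>R noise_vec k))) \<longlonglongrightarrow> inner (X \<omega>) (C (dW a b \<omega>))"
        using dW_sums[OF ab] by eventually_elim (auto simp: sums_def intro!: tendsto_inner tendsto_const C.tendsto)
      show "AE \<omega> in M. norm (inner (X \<omega>) (C (\<Sum>k<n. inc k a b \<omega> *\<^sub>R noise_vec k))) \<le> R * (\<bar>\<alpha>\<bar> * norm (dW a b \<omega>))" for n
        using dW_sums[OF ab]
      proof eventually_elim
        case (elim \<omega>)
        have "0 \<le> R" using R norm_ge_zero order_trans by blast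
        have "norm (inner (X \<omega>) (C (\<Sum>k<n. inc k a b \<omega> *\<^sub>R noise_vec k))) \<le> norm (X \<omega>) * (\<bar>\<alpha>\<bar> * norm (\<Sum>k<n. inc k a b \<omega> *\<^sub>R noise_vec k))"
          using Cauchy_Schwarz_ineq2[of "X \<omega>" "C (\<Sum>k<n. inc k a b \<omega> *\<^sub>R noise_vec k)"] by (simp add: nC)
        also have "\<dots> \<le> R * (\<bar>\<alpha>\<bar> * norm (dW a b \<omega>))"
          using norm_sum_vec_le[OF elim, of n] R \<open>0 \<le> R\<close> by (intro mult_mono) auto
        finally show ?case .
      qed
      show "(\<lambda>\<omega>. inner (X \<omega>) (C (\<Sum>k<n. inc k a b \<omega> *\<^sub>R noise_vec k))) \<in> borel_measurable M" for n
        unfolding eq by measurable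
    qed measurable
    ultimately show ?thesis by (simp add: LIMSEQ_const_iff)
  qed
  have P3: "(\<integral>\<^sup>+\<omega>. ennreal ((norm (C (dW a b \<omega>))) ^ 4) \<partial>M) \<le> ennreal (3 * ((b - a) * \<kappa>)\<^sup>2)"
  proof -
    have "(\<integral>\<^sup>+\<omega>. ennreal ((norm (C (dW a b \<omega>))) ^ 4) \<partial>M) = ennreal (\<alpha> ^ 4) * (\<integral>\<^sup>+\<omega>. ennreal ((norm (dW a b \<omega>)) ^ 4) \<partial>M)"
      by (subst nn_integral_cmult[symmetric]) (auto simp: nC power_mult_distrib ennreal_mult intro!: nn_integral_cong)
    also have "\<dots> \<le> ennreal (\<alpha> ^ 4) * ennreal (3 * ((b - a) * trace_Q \<gamma>)\<^sup>2)"
      by (intro mult_left_mono norm_dW_fourth_moment ab) simp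
    also have "\<dots> = ennreal (3 * ((b - a) * \<kappa>)\<^sup>2)"
    proof -
      have "ennreal (\<alpha> ^ 4) * ennreal (3 * ((b - a) * trace_Q \<gamma>)\<^sup>2) = ennreal (\<alpha> ^ 4 * (3 * ((b - a) * trace_Q \<gamma>)\<^sup>2))"
        by (rule ennreal_mult[symmetric]) simp_all
      then show ?thesis by (simp add: \<kappa>_def power2_eq_square power4_eq_xxxx mult_ac)
    qed
    finally show ?thesis .
  qed
  show ?thesis
    unfolding increment_def using ab mF P1 P2 P3 by auto
qed

end

lemma abs_integral_le:
  fixes f g :: "'a \<Rightarrow> real"
  assumes "integrable M f" "integrable M g" "\<And>x. \<bar>f x\<bar> \<le> g x"
  shows "\<bar>\<integral>x. f x \<partial>M\<bar> \<le> (\<integral>x. g x \<partial>M)"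
proof -
  have "\<bar>\<integral>x. f x \<partial>M\<bar> \<le> (\<integral>x. \<bar>f x\<bar> \<partial>M)"
    using integral_abs_bound by blast
  also have "\<dots> \<le> (\<integral>x. g x \<partial>M)"
    using assms by (intro integral_mono) auto
  finally show ?thesis .
qed

lemma divide_Suc_mult_le: "0 \<le> S \<Longrightarrow> 0 < \<epsilon> \<Longrightarrow> \<epsilon> / (S + 1) * S \<le> (\<epsilon> :: real)"
  by (simp add: field_simps)

section \<open>Sums and limits of increments\<close>

context noise
begin

text \<open>The later increment is orthogonal to the past, so second moments add. For the fourth
  moment, with a and b the variances of the two parts, the estimate is 9 a^2 + 8 a b + 3 * 3 b^2, at
  most 9 (a + b)^2: the constant 9 reproduces itself when a step of constant 3 is appended.\<close>

lemma increment_add: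
  assumes D: "increment 9 s t D" and D': "increment 3 t r D'"
  shows "increment 9 s r (\<lambda>\<omega>. D \<omega> + D' \<omega>)"
proof -
  note T = increment_times[OF D] increment_times[OF D']
  have [measurable]: "D \<in> borel_measurable M" "D' \<in> borel_measurable M"
    using increment_measurable[OF D] increment_measurable[OF D'] .
  have DF [measurable]: "D \<in> borel_measurable (F t)" by (rule increment_measurable_F[OF D])
  have mF: "(\<lambda>\<omega>. D \<omega> + D' \<omega>) \<in> borel_measurable (F r)"
    using measurable_F_mono[OF T(6,7) DF] increment_measurable_F[OF D'] by measurable
  note sq = increment_square[OF D] increment_square[OF D']
  have i: "integrable M (\<lambda>\<omega>. (norm (D \<omega> + D' \<omega>))\<^sup>2)"
    by (rule integrable_norm_square_add) (use sq in auto)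
  have expand: "(norm (D \<omega> + D' \<omega>))\<^sup>2 = (norm (D \<omega>))\<^sup>2 + (norm (D' \<omega>))\<^sup>2 + 2 * inner (D \<omega>) (D' \<omega>)" for \<omega>
    by (simp add: power2_norm_eq_inner inner_add_left inner_add_right inner_commute)
  have P2: "(\<integral>\<^sup>+\<omega>. ennreal ((norm (D \<omega> + D' \<omega>))\<^sup>2) * indicator A \<omega> \<partial>M) = ennreal ((r - s) * \<kappa>) * emeasure M A"
    if A: "A \<in> sets (F s)" for A
  proof -
    have AM [measurable]: "A \<in> sets M" using sets_F[OF T(1) A] .
    have At [measurable]: "A \<in> sets (F t)" using A subalg_F[OF T(1,2)] by (auto simp: subalgebra_def)
    have real: "(\<integral>\<omega>. indicator A \<omega> * (norm (D\<^sub>0 \<omega>))\<^sup>2 \<partial>M) = (t' - s') * \<kappa> * prob A"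
      if "increment C s' t' D\<^sub>0" "A \<in> sets (F s')" for C s' t' D\<^sub>0
    proof -
      note m = increment_measurable[OF that(1)]
      have int: "integrable M (\<lambda>\<omega>. indicator A \<omega> * (norm (D\<^sub>0 \<omega>))\<^sup>2)"
        using integrable_mult_indicator[OF AM increment_square(1)[OF that(1)]] by simp
      have "ennreal (\<integral>\<omega>. indicator A \<omega> * (norm (D\<^sub>0 \<omega>))\<^sup>2 \<partial>M) = (\<integral>\<^sup>+\<omega>. ennreal (indicator A \<omega> * (norm (D\<^sub>0 \<omega>))\<^sup>2) \<partial>M)"
        using nn_integral_eq_integral[OF int] by simp
      also have "\<dots> = (\<integral>\<^sup>+\<omega>. ennreal ((norm (D\<^sub>0 \<omega>))\<^sup>2) * indicator A \<omega> \<partial>M)"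
        by (intro nn_integral_cong) (simp add: indicator_def)
      also have "\<dots> = ennreal ((t' - s') * \<kappa> * prob A)"
        using increment_nn_integral_set[OF that] increment_times[OF that(1)] by (simp add: emeasure_eq_measure ennreal_mult)
      finally show ?thesis
        using increment_times[OF that(1)] by (subst (asm) ennreal_inj) auto
    qed
    have i1: "integrable M (\<lambda>\<omega>. indicator A \<omega> * (norm (D \<omega>))\<^sup>2)" "integrable M (\<lambda>\<omega>. indicator A \<omega> * (norm (D' \<omega>))\<^sup>2)"
      using integrable_mult_indicator[OF AM sq(1)] integrable_mult_indicator[OF AM sq(3)] by simp_all
    have X: "(\<lambda>\<omega>. indicator A \<omega> *\<^sub>R D \<omega>) \<in> borel_measurable (F t)" by measurable
    have iX: "integrable M (\<lambda>\<omega>. (norm (indicator A \<omega> *\<^sub>R D \<omega>))\<^sup>2)"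
      by (rule Bochner_Integration.integrable_bound[OF sq(1)]) (auto simp: indicator_def)
    note cr = increment_cross_L2[OF D' X iX]
    have eq: "indicator A \<omega> * (norm (D \<omega> + D' \<omega>))\<^sup>2
        = indicator A \<omega> * (norm (D \<omega>))\<^sup>2 + indicator A \<omega> * (norm (D' \<omega>))\<^sup>2 + 2 * inner (indicator A \<omega> *\<^sub>R D \<omega>) (D' \<omega>)" for \<omega>
      by (simp add: expand algebra_simps)
    have "has_bochner_integral M (\<lambda>\<omega>. indicator A \<omega> * (norm (D \<omega> + D' \<omega>))\<^sup>2)
        ((t - s) * \<kappa> * prob A + (r - t) * \<kappa> * prob A + 2 * 0)"
      unfolding eq
      using i1 real[OF D A] real[OF D' At] cr
      by (intro has_bochner_integral_add has_bochner_integral_mult_right) (auto simp: has_bochner_integral_iff)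
    then have hb: "has_bochner_integral M (\<lambda>\<omega>. indicator A \<omega> * (norm (D \<omega> + D' \<omega>))\<^sup>2) ((r - s) * \<kappa> * prob A)"
      by (simp add: algebra_simps)
    have "(\<integral>\<^sup>+\<omega>. ennreal ((norm (D \<omega> + D' \<omega>))\<^sup>2) * indicator A \<omega> \<partial>M)
        = (\<integral>\<^sup>+\<omega>. ennreal (indicator A \<omega> * (norm (D \<omega> + D' \<omega>))\<^sup>2) \<partial>M)"
      by (intro nn_integral_cong) (simp add: indicator_def)
    also have "\<dots> = ennreal ((r - s) * \<kappa> * prob A)"
      using hb nn_integral_eq_integral[of M "\<lambda>\<omega>. indicator A \<omega> * (norm (D \<omega> + D' \<omega>))\<^sup>2"]
      by (simp add: has_bochner_integral_iff)
    finally show ?thesis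
      using T \<kappa>_nonneg by (simp add: emeasure_eq_measure ennreal_mult)
  qed
  have P1: "(\<integral>\<omega>. inner (X \<omega>) (D \<omega> + D' \<omega>) \<partial>M) = 0"
    if X: "X \<in> borel_measurable (F s)" and R: "\<And>\<omega>. norm (X \<omega>) \<le> R" for X R
  proof -
    have Xt: "X \<in> borel_measurable (F t)" using measurable_F_mono[OF T(1,2) X] .
    have [measurable]: "X \<in> borel_measurable M" using measurable_F_M[OF T(1) X] .
    have iX: "integrable M (\<lambda>\<omega>. (norm (X \<omega>))\<^sup>2)"
      by (rule integrable_const_bound[where B = "R\<^sup>2"]) (use R in \<open>auto intro!: AE_I2 power_mono\<close>)
    show ?thesis
      using increment_cross_L2[OF D X iX] increment_cross_L2[OF D' Xt iX] by (simp add: inner_add_right)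
  qed
  define a b where "a = (t - s) * \<kappa>" and "b = (r - t) * \<kappa>"
  have ab: "0 \<le> a" "0 \<le> b" using T unfolding a_def b_def by auto
  define x y p where "x \<omega> = (norm (D \<omega>))\<^sup>2" and "y \<omega> = (norm (D' \<omega>))\<^sup>2" and "p \<omega> = inner (D \<omega>) (D' \<omega>)" for \<omega>
  have [measurable]: "x \<in> borel_measurable M" "y \<in> borel_measurable M" "p \<in> borel_measurable M"
    unfolding x_def y_def p_def by measurable
  have x0: "0 \<le> x \<omega>" "0 \<le> y \<omega>" for \<omega> by (auto simp: x_def y_def)
  have ppos: "(p \<omega>)\<^sup>2 \<le> x \<omega> * y \<omega>" for \<omega>
    using Cauchy_Schwarz_ineq[of "D \<omega>" "D' \<omega>"] by (simp add: p_def x_def y_def power2_norm_eq_inner)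
  have pabs: "\<bar>p \<omega>\<bar> \<le> x \<omega> + y \<omega>" for \<omega>
    unfolding p_def x_def y_def by (rule abs_inner_le_squares)
  have ix2: "integrable M (\<lambda>\<omega>. (x \<omega>)\<^sup>2)" "(\<integral>\<omega>. (x \<omega>)\<^sup>2 \<partial>M) \<le> 9 * a\<^sup>2"
    and iy2: "integrable M (\<lambda>\<omega>. (y \<omega>)\<^sup>2)" "(\<integral>\<omega>. (y \<omega>)\<^sup>2 \<partial>M) \<le> 3 * b\<^sup>2"
    using increment_fourth[OF D] increment_fourth[OF D'] by (simp_all add: x_def y_def a_def b_def power_mult[symmetric])
  have ixy: "integrable M (\<lambda>\<omega>. x \<omega> * y \<omega>)" "(\<integral>\<omega>. x \<omega> * y \<omega> \<partial>M) = b * a"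
    using increment_weighted[OF D' DF sq(1)] sq(2) by (simp_all add: x_def y_def a_def b_def)
  have xD: "(\<lambda>\<omega>. x \<omega> *\<^sub>R D \<omega>) \<in> borel_measurable (F t)" unfolding x_def by measurable
  have ixp: "integrable M (\<lambda>\<omega>. x \<omega> * p \<omega>)"
  proof (rule Bochner_Integration.integrable_bound)
    show "integrable M (\<lambda>\<omega>. (x \<omega>)\<^sup>2 + x \<omega> * y \<omega>)" using ix2 ixy by simp
    have "\<bar>x \<omega> * p \<omega>\<bar> \<le> (x \<omega>)\<^sup>2 + x \<omega> * y \<omega>" for \<omega>
      using mult_left_mono[OF pabs[of \<omega>] x0(1)[of \<omega>]] x0[of \<omega>] by (simp add: abs_mult power2_eq_square distrib_left)
    then show "AE \<omega> in M. norm (x \<omega> * p \<omega>) \<le> norm ((x \<omega>)\<^sup>2 + x \<omega> * y \<omega>)"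
      by (intro AE_I2) (smt (verit) real_norm_def)
  qed measurable
  have xp0: "(\<integral>\<omega>. x \<omega> * p \<omega> \<partial>M) = 0"
    using increment_cross[OF D' xD] ixp by (simp add: p_def)
  \<comment> \<open>In the expansion of (x + y + 2 p)^2 the term 4 p y is cubic in the later
    increment and its mean is not controlled, so it is absorbed by 4 p y \<le> 2 p^2 + 2 y^2, and
    then 6 p^2 \<le> 6 x y. The term 4 x p is kept: it is linear in the later increment and has mean
    zero.\<close>
  define h where "h \<omega> = (x \<omega>)\<^sup>2 + 8 * (x \<omega> * y \<omega>) + 3 * (y \<omega>)\<^sup>2 + 4 * (x \<omega> * p \<omega>)" for \<omega>
  have ih: "integrable M h" unfolding h_def using ix2 iy2 ixy ixp by simp
  have le_h: "(norm (D \<omega> + D' \<omega>)) ^ 4 \<le> h \<omega>" for \<omega>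
  proof -
    have "(norm (D \<omega> + D' \<omega>)) ^ 4 = (x \<omega> + y \<omega> + 2 * p \<omega>)\<^sup>2"
      unfolding x_def y_def p_def expand[symmetric] by (simp add: power_mult[symmetric])
    also have "\<dots> = (x \<omega>)\<^sup>2 + (y \<omega>)\<^sup>2 + 4 * (p \<omega>)\<^sup>2 + 2 * (x \<omega> * y \<omega>) + 4 * (x \<omega> * p \<omega>) + 4 * (p \<omega> * y \<omega>)"
      by (simp add: power2_eq_square algebra_simps)
    also have "\<dots> \<le> h \<omega>"
    proof -
      have "4 * (p \<omega> * y \<omega>) \<le> 2 * (p \<omega>)\<^sup>2 + 2 * (y \<omega>)\<^sup>2"
        using sum_squares_bound[of "p \<omega>" "y \<omega>"] by simp
      then show ?thesis using ppos[of \<omega>] by (simp add: h_def)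
    qed
    finally show ?thesis .
  qed
  have "(\<integral>\<omega>. h \<omega> \<partial>M) = (\<integral>\<omega>. (x \<omega>)\<^sup>2 \<partial>M) + 8 * (b * a) + 3 * (\<integral>\<omega>. (y \<omega>)\<^sup>2 \<partial>M)"
    unfolding h_def using ix2 iy2 ixy ixp xp0 by simp
  also have "\<dots> \<le> 9 * (a + b)\<^sup>2"
    using ix2(2) iy2(2) mult_nonneg_nonneg[OF ab] by (simp add: power2_sum mult.commute)
  finally have Eh: "(\<integral>\<omega>. h \<omega> \<partial>M) \<le> 9 * ((r - s) * \<kappa>)\<^sup>2"
    by (simp add: a_def b_def algebra_simps)
  have "(\<integral>\<^sup>+\<omega>. ennreal ((norm (D \<omega> + D' \<omega>)) ^ 4) \<partial>M) \<le> (\<integral>\<^sup>+\<omega>. ennreal (h \<omega>) \<partial>M)"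
    by (intro nn_integral_mono ennreal_leI le_h)
  also have "\<dots> = ennreal (\<integral>\<omega>. h \<omega> \<partial>M)"
  proof (rule nn_integral_eq_integral[OF ih])
    have "0 \<le> h \<omega>" for \<omega> using le_h[of \<omega>] by (rule order_trans[rotated]) simp
    then show "AE \<omega> in M. 0 \<le> h \<omega>" by simp
  qed
  also have "\<dots> \<le> ennreal (9 * ((r - s) * \<kappa>)\<^sup>2)"
    by (rule ennreal_leI[OF Eh])
  finally have P3: "(\<integral>\<^sup>+\<omega>. ennreal ((norm (D \<omega> + D' \<omega>)) ^ 4) \<partial>M) \<le> ennreal (9 * ((r - s) * \<kappa>)\<^sup>2)" .
  show ?thesis
    unfolding increment_def using T mF P1 P2 P3 by auto
qed

text \<open>The induction starts from the zero increment, which admits every constant, and appends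
  single steps; hence the constant does not grow with n.\<close>

lemma increment_sum:
  fixes p :: "nat \<Rightarrow> real"
  assumes "0 \<le> p 0" "\<And>j. j < n \<Longrightarrow> increment 3 (p j) (p (Suc j)) (D j)"
  shows "increment 9 (p 0) (p n) (\<lambda>\<omega>. \<Sum>j<n. D j \<omega>)"
  using assms(2)
proof (induction n)
  case 0
  then show ?case using assms(1) by (simp add: increment_def)
next
  case (Suc n)
  then have "increment 9 (p 0) (p n) (\<lambda>\<omega>. \<Sum>j<n. D j \<omega>)" "increment 3 (p n) (p (Suc n)) (D n)"
    by auto
  then show ?case using increment_add by simp
qed

text \<open>Conditional first and second moments pass to an L^2 limit exactly, the fourth only by
  Fatou, so an upper bound is what \<open>increment\<close> can ask for there. The limit Y is merely
  M-measurable; the version D' is the limit of an almost surely convergent subsequence.\<close>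

lemma increment_limit:
  assumes D: "\<And>m. increment C s t (D m)" and Y [measurable]: "Y \<in> borel_measurable M"
    and lim: "(\<lambda>m. \<integral>\<^sup>+\<omega>. ennreal ((norm (D m \<omega> - Y \<omega>))\<^sup>2) \<partial>M) \<longlonglongrightarrow> 0"
  shows "\<exists>D'. increment C s t D' \<and> (AE \<omega> in M. Y \<omega> = D' \<omega>)"
proof -
  note T = increment_times[OF D]
  have DM [measurable]: "D m \<in> borel_measurable M" for m by (rule increment_measurable[OF D])
  \<comment> \<open>The vanishing limit makes the distances finite eventually; from
    \<open>m0\<close> on they can be written as Bochner integrals.\<close>
  obtain m0 where m0: "\<And>m. m0 \<le> m \<Longrightarrow> (\<integral>\<^sup>+\<omega>. ennreal ((norm (D m \<omega> - Y \<omega>))\<^sup>2) \<partial>M) < 1"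
    using order_tendstoD(2)[OF lim, of 1] by (auto simp: eventually_sequentially)
  define E where "E m = D (m + m0)" for m
  have E: "increment C s t (E m)" and [measurable]: "E m \<in> borel_measurable M" for m
    using D by (auto simp: E_def)
  have iE: "integrable M (\<lambda>\<omega>. (norm (E m \<omega> - Y \<omega>))\<^sup>2)" for m
    using m0[of "m + m0"] unfolding E_def
    by (intro integrable_of_nn_integral_le(1)[where c = 1]) (auto intro: less_imp_le)
  have limE: "(\<lambda>m. \<integral>\<omega>. (norm (E m \<omega> - Y \<omega>))\<^sup>2 \<partial>M) \<longlonglongrightarrow> 0"
  proof -
    have "(\<lambda>m. ennreal (\<integral>\<omega>. (norm (E m \<omega> - Y \<omega>))\<^sup>2 \<partial>M)) \<longlonglongrightarrow> ennreal 0"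
      using LIMSEQ_ignore_initial_segment[OF lim, of m0] nn_integral_eq_integral[OF iE] by (simp add: E_def)
    then show ?thesis by (subst (asm) tendsto_ennreal_iff) auto
  qed
  have "(\<lambda>m. \<integral>\<omega>. norm ((norm (E m \<omega> - Y \<omega>))\<^sup>2) \<partial>M) \<longlonglongrightarrow> 0"
    using limE by simp
  from tendsto_L1_AE_subseq[of M "\<lambda>m \<omega>. (norm (E m \<omega> - Y \<omega>))\<^sup>2", OF iE this]
  obtain r where r: "strict_mono r" "AE \<omega> in M. (\<lambda>m. (norm (E (r m) \<omega> - Y \<omega>))\<^sup>2) \<longlonglongrightarrow> 0"
    by blast
  have conv: "AE \<omega> in M. (\<lambda>m. E (r m) \<omega>) \<longlonglongrightarrow> Y \<omega>"
    using r(2)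
  proof eventually_elim
    case (elim \<omega>)
    then have "(\<lambda>m. norm (E (r m) \<omega> - Y \<omega>)) \<longlonglongrightarrow> 0"
      by simp
    then show ?case
      by (simp add: tendsto_norm_zero_iff LIM_zero_iff)
  qed
  \<comment> \<open>A \<open>lim\<close> of F(t)-measurable variables is F(t)-measurable everywhere,
    whatever it returns on the null set of divergence.\<close>
  define D' where "D' \<omega> = lim (\<lambda>m. E (r m) \<omega>)" for \<omega>
  have mF: "D' \<in> borel_measurable (F t)"
    unfolding D'_def by (intro borel_measurable_lim_metric increment_measurable_F[OF E])
  then have [measurable]: "D' \<in> borel_measurable M" using measurable_F_M T by blast
  have ae: "AE \<omega> in M. Y \<omega> = D' \<omega>"
    using conv by eventually_elim (auto simp: D'_def limI)
  have eps: "AE \<omega> in M. (norm (E m \<omega> - Y \<omega>))\<^sup>2 = (norm (E m \<omega> - D' \<omega>))\<^sup>2" for m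
    using ae by eventually_elim simp
  have iE': "integrable M (\<lambda>\<omega>. (norm (E m \<omega> - D' \<omega>))\<^sup>2)" for m
    using iE[of m] by (subst integrable_cong_AE[OF _ _ eps[of m, THEN AE_symmetric]]) auto
  have limE': "(\<lambda>m. \<integral>\<omega>. (norm (E m \<omega> - D' \<omega>))\<^sup>2 \<partial>M) \<longlonglongrightarrow> 0"
    using limE by (subst (asm) integral_cong_AE[OF _ _ eps]) auto
  have iD': "integrable M (\<lambda>\<omega>. (norm (D' \<omega>))\<^sup>2)"
    using integrable_norm_square_add[OF _ _ increment_square(1)[OF E[of 0]], of "\<lambda>\<omega>. D' \<omega> - E 0 \<omega>"] iE'[of 0]
    by (simp add: norm_minus_commute)
  have P1: "(\<integral>\<omega>. inner (X \<omega>) (D' \<omega>) \<partial>M) = 0"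
    if X: "X \<in> borel_measurable (F s)" and R: "\<And>\<omega>. norm (X \<omega>) \<le> R" for X R
  proof -
    have [measurable]: "X \<in> borel_measurable M" using measurable_F_M[OF T(1) X] .
    have iX: "integrable M (\<lambda>\<omega>. (norm (X \<omega>))\<^sup>2)"
      by (rule integrable_const_bound[where B = "R\<^sup>2"]) (use R in \<open>auto intro!: AE_I2 power_mono\<close>)
    have R0: "0 \<le> R" using R norm_ge_zero order_trans by blast
    let ?I = "\<integral>\<omega>. inner (X \<omega>) (D' \<omega>) \<partial>M"
    have iXD: "integrable M (\<lambda>\<omega>. inner (X \<omega>) (D' \<omega>))" by (rule integrable_inner[OF _ _ iX iD']) auto
    \<comment> \<open>Young's inequality with a free parameter \<eta> takes the place of
      Cauchy-Schwarz in L^2(Omega): the limit in m is taken for fixed \<eta>, and \<eta> tends to 0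
      afterwards.\<close>
    have bound: "\<bar>?I\<bar> \<le> R * (\<eta> + (\<integral>\<omega>. (norm (E m \<omega> - D' \<omega>))\<^sup>2 \<partial>M) / \<eta>)" if "0 < \<eta>" for \<eta> m
    proof -
      have pw: "\<bar>inner (X \<omega>) (D' \<omega> - E m \<omega>)\<bar> \<le> R * (\<eta> + (norm (E m \<omega> - D' \<omega>))\<^sup>2 / \<eta>)" for \<omega>
      proof -
        let ?z = "norm (E m \<omega> - D' \<omega>)"
        have "2 * (\<eta> * ?z) \<le> \<eta>\<^sup>2 + ?z\<^sup>2" using sum_squares_bound[of \<eta> ?z] by simp
        moreover have "0 \<le> \<eta> * ?z" using that by simp
        ultimately have "\<eta> * ?z \<le> \<eta>\<^sup>2 + ?z\<^sup>2" by linarith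
        then have "?z \<le> \<eta> + ?z\<^sup>2 / \<eta>" using that by (simp add: field_simps power2_eq_square)
        moreover have "\<bar>inner (X \<omega>) (D' \<omega> - E m \<omega>)\<bar> \<le> R * ?z"
          unfolding norm_minus_commute[of "E m \<omega>"]
          by (rule order_trans[OF Cauchy_Schwarz_ineq2 mult_right_mono[OF R]]) simp
        ultimately show ?thesis using mult_left_mono[OF _ R0] order_trans by blast
      qed
      have "?I = (\<integral>\<omega>. inner (X \<omega>) (D' \<omega> - E m \<omega>) \<partial>M)"
        using increment_cross_L2[OF E X iX, of m] iXD by (simp add: inner_diff_right)
      also have "\<bar>\<dots>\<bar> \<le> (\<integral>\<omega>. R * (\<eta> + (norm (E m \<omega> - D' \<omega>))\<^sup>2 / \<eta>) \<partial>M)"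
        by (rule abs_integral_le)
          (use increment_cross_L2[OF E X iX, of m] iXD iE'[of m] pw in \<open>auto simp: inner_diff_right\<close>)
      also have "\<dots> = R * (\<eta> + (\<integral>\<omega>. (norm (E m \<omega> - D' \<omega>))\<^sup>2 \<partial>M) / \<eta>)"
        using iE'[of m] by (simp add: prob_space)
      finally show ?thesis .
    qed
    have "\<bar>?I\<bar> \<le> R * (\<eta> + 0 / \<eta>)" if "0 < \<eta>" for \<eta>
    proof (rule LIMSEQ_le_const)
      show "(\<lambda>m. R * (\<eta> + (\<integral>\<omega>. (norm (E m \<omega> - D' \<omega>))\<^sup>2 \<partial>M) / \<eta>)) \<longlonglongrightarrow> R * (\<eta> + 0 / \<eta>)"
        using that by (intro tendsto_intros limE') simp
    qed (use bound[OF that] in blast)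
    then have *: "\<bar>?I\<bar> \<le> R * \<eta>" if "0 < \<eta>" for \<eta> using that by simp
    have "\<bar>?I\<bar> \<le> 0"
    proof (rule field_le_epsilon)
      fix \<epsilon> :: real assume "0 < \<epsilon>"
      have "\<bar>?I\<bar> \<le> R * (\<epsilon> / (R + 1))" using \<open>0 < \<epsilon>\<close> R0 by (intro *) simp
      also have "\<dots> \<le> \<epsilon>" using \<open>0 < \<epsilon>\<close> R0 by (simp add: field_simps)
      finally show "\<bar>?I\<bar> \<le> 0 + \<epsilon>" by simp
    qed
    then show ?thesis by simp
  qed
  have P2: "(\<integral>\<^sup>+\<omega>. ennreal ((norm (D' \<omega>))\<^sup>2) * indicator A \<omega> \<partial>M) = ennreal ((t - s) * \<kappa>) * emeasure M A"
    if A: "A \<in> sets (F s)" for A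
  proof -
    have AM [measurable]: "A \<in> sets M" using sets_F[OF T(1) A] .
    have nn: "(\<integral>\<^sup>+\<omega>. ennreal ((norm (Z \<omega>))\<^sup>2) * indicator A \<omega> \<partial>M) = ennreal (\<integral>\<omega>. indicator A \<omega> * (norm (Z \<omega>))\<^sup>2 \<partial>M)"
      and iA: "integrable M (\<lambda>\<omega>. indicator A \<omega> * (norm (Z \<omega>))\<^sup>2)"
      if "integrable M (\<lambda>\<omega>. (norm (Z \<omega>))\<^sup>2)" for Z :: "'a \<Rightarrow> 'n l2_torus"
    proof -
      show int: "integrable M (\<lambda>\<omega>. indicator A \<omega> * (norm (Z \<omega>))\<^sup>2)"
        using integrable_mult_indicator[OF AM that] by simp
      have "(\<integral>\<^sup>+\<omega>. ennreal ((norm (Z \<omega>))\<^sup>2) * indicator A \<omega> \<partial>M) = (\<integral>\<^sup>+\<omega>. ennreal (indicator A \<omega> * (norm (Z \<omega>))\<^sup>2) \<partial>M)"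
        by (intro nn_integral_cong) (simp add: indicator_def)
      then show "(\<integral>\<^sup>+\<omega>. ennreal ((norm (Z \<omega>))\<^sup>2) * indicator A \<omega> \<partial>M) = ennreal (\<integral>\<omega>. indicator A \<omega> * (norm (Z \<omega>))\<^sup>2 \<partial>M)"
        using nn_integral_eq_integral[OF int] by simp
    qed
    let ?c = "(t - s) * \<kappa> * prob A" and ?J = "\<integral>\<omega>. indicator A \<omega> * (norm (D' \<omega>))\<^sup>2 \<partial>M"
    let ?S = "\<integral>\<omega>. (norm (D' \<omega>))\<^sup>2 \<partial>M"
    have c: "(\<integral>\<omega>. indicator A \<omega> * (norm (E m \<omega>))\<^sup>2 \<partial>M) = ?c" for m
    proof -
      have "ennreal (\<integral>\<omega>. indicator A \<omega> * (norm (E m \<omega>))\<^sup>2 \<partial>M) = ennreal ?c"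
        using increment_nn_integral_set[OF E A, of m] nn[OF increment_square(1)[OF E[of m]]] T
        by (simp add: emeasure_eq_measure ennreal_mult)
      then show ?thesis using T by (subst (asm) ennreal_inj) auto
    qed
    \<comment> \<open>The same scheme: with z the error, the difference of the squares is |z|^2 plus
      twice the product of z and D', and Young's inequality leaves \<eta> times the fixed second
      moment of D'.\<close>
    have bound: "\<bar>?c - ?J\<bar> \<le> (1 + 1 / \<eta>) * (\<integral>\<omega>. (norm (E m \<omega> - D' \<omega>))\<^sup>2 \<partial>M) + \<eta> * ?S" if "0 < \<eta>" for \<eta> m
    proof -
      have pw: "\<bar>indicator A \<omega> * (norm (E m \<omega>))\<^sup>2 - indicator A \<omega> * (norm (D' \<omega>))\<^sup>2\<bar>
          \<le> (1 + 1 / \<eta>) * (norm (E m \<omega> - D' \<omega>))\<^sup>2 + \<eta> * (norm (D' \<omega>))\<^sup>2" for \<omega>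
      proof -
        let ?z = "E m \<omega> - D' \<omega>"
        have eq: "(norm (E m \<omega>))\<^sup>2 - (norm (D' \<omega>))\<^sup>2 = (norm ?z)\<^sup>2 + 2 * inner ?z (D' \<omega>)"
          by (simp add: power2_norm_eq_inner inner_diff_left inner_diff_right inner_commute)
        have "\<bar>inner ?z (D' \<omega>)\<bar> \<le> norm ?z * norm (D' \<omega>)" by (rule Cauchy_Schwarz_ineq2)
        moreover have "2 * (norm ?z * norm (D' \<omega>)) \<le> (norm ?z)\<^sup>2 / \<eta> + \<eta> * (norm (D' \<omega>))\<^sup>2"
        proof -
          have "2 * (norm ?z * norm (D' \<omega>)) * \<eta> \<le> (norm ?z)\<^sup>2 + (\<eta> * norm (D' \<omega>))\<^sup>2"
            using sum_squares_bound[of "norm ?z" "\<eta> * norm (D' \<omega>)"] by (simp add: mult_ac)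
          then show ?thesis using that by (simp add: field_simps power2_eq_square)
        qed
        ultimately have "\<bar>(norm (E m \<omega>))\<^sup>2 - (norm (D' \<omega>))\<^sup>2\<bar> \<le> (norm ?z)\<^sup>2 + ((norm ?z)\<^sup>2 / \<eta> + \<eta> * (norm (D' \<omega>))\<^sup>2)"
          unfolding eq by (smt (verit) zero_le_power2)
        moreover have "(norm ?z)\<^sup>2 + ((norm ?z)\<^sup>2 / \<eta> + \<eta> * (norm (D' \<omega>))\<^sup>2) = (1 + 1 / \<eta>) * (norm ?z)\<^sup>2 + \<eta> * (norm (D' \<omega>))\<^sup>2"
          by (simp add: distrib_right)
        ultimately show ?thesis using that by (auto simp: indicator_def)
      qed
      have "\<bar>?c - ?J\<bar> = \<bar>\<integral>\<omega>. indicator A \<omega> * (norm (E m \<omega>))\<^sup>2 - indicator A \<omega> * (norm (D' \<omega>))\<^sup>2 \<partial>M\<bar>"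
        using c[of m] iA[OF increment_square(1)[OF E[of m]]] iA[OF iD'] by simp
      also have "\<dots> \<le> (\<integral>\<omega>. (1 + 1 / \<eta>) * (norm (E m \<omega> - D' \<omega>))\<^sup>2 + \<eta> * (norm (D' \<omega>))\<^sup>2 \<partial>M)"
        by (rule abs_integral_le)
          (use iA[OF increment_square(1)[OF E[of m]]] iA[OF iD'] iE'[of m] iD' pw in \<open>auto\<close>)
      also have "\<dots> = (1 + 1 / \<eta>) * (\<integral>\<omega>. (norm (E m \<omega> - D' \<omega>))\<^sup>2 \<partial>M) + \<eta> * ?S"
        using iE'[of m] iD' by simp
      finally show ?thesis .
    qed
    have *: "\<bar>?c - ?J\<bar> \<le> (1 + 1 / \<eta>) * 0 + \<eta> * ?S" if "0 < \<eta>" for \<eta>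
    proof (rule LIMSEQ_le_const)
      show "(\<lambda>m. (1 + 1 / \<eta>) * (\<integral>\<omega>. (norm (E m \<omega> - D' \<omega>))\<^sup>2 \<partial>M) + \<eta> * ?S) \<longlonglongrightarrow> (1 + 1 / \<eta>) * 0 + \<eta> * ?S"
        by (intro tendsto_intros limE')
    qed (use bound[OF that] in blast)
    have S0: "0 \<le> ?S" by simp
    have "\<bar>?c - ?J\<bar> \<le> 0"
    proof (rule field_le_epsilon)
      fix \<epsilon> :: real assume "0 < \<epsilon>"
      have "\<bar>?c - ?J\<bar> \<le> \<epsilon> / (?S + 1) * ?S" using *[of "\<epsilon> / (?S + 1)"] \<open>0 < \<epsilon>\<close> S0 by simp
      also have "\<dots> \<le> \<epsilon>" using \<open>0 < \<epsilon>\<close> S0 by (intro divide_Suc_mult_le)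
      finally show "\<bar>?c - ?J\<bar> \<le> 0 + \<epsilon>" by simp
    qed
    then have "?J = ?c" by simp
    then show ?thesis using nn[OF iD'] T by (simp add: emeasure_eq_measure ennreal_mult)
  qed
  have P3: "(\<integral>\<^sup>+\<omega>. ennreal ((norm (D' \<omega>)) ^ 4) \<partial>M) \<le> ennreal (C * ((t - s) * \<kappa>)\<^sup>2)"
  proof -
    have "AE \<omega> in M. ennreal ((norm (D' \<omega>)) ^ 4) = liminf (\<lambda>m. ennreal ((norm (E (r m) \<omega>)) ^ 4))"
      using conv ae
    proof eventually_elim
      case (elim \<omega>)
      then have "(\<lambda>m. ennreal ((norm (E (r m) \<omega>)) ^ 4)) \<longlonglongrightarrow> ennreal ((norm (D' \<omega>)) ^ 4)"
        by (intro tendsto_intros) simp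
      then show ?case by (intro lim_imp_Liminf[symmetric]) simp_all
    qed
    then have "(\<integral>\<^sup>+\<omega>. ennreal ((norm (D' \<omega>)) ^ 4) \<partial>M) = (\<integral>\<^sup>+\<omega>. liminf (\<lambda>m. ennreal ((norm (E (r m) \<omega>)) ^ 4)) \<partial>M)"
      by (rule nn_integral_cong_AE)
    also have "\<dots> \<le> liminf (\<lambda>m. \<integral>\<^sup>+\<omega>. ennreal ((norm (E (r m) \<omega>)) ^ 4) \<partial>M)"
      by (intro nn_integral_liminf) measurable
    also have "\<dots> \<le> liminf (\<lambda>m :: nat. ennreal (C * ((t - s) * \<kappa>)\<^sup>2))"
      using E by (intro Liminf_mono always_eventually) (auto simp: increment_def)
    also have "\<dots> = ennreal (C * ((t - s) * \<kappa>)\<^sup>2)"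
      by (simp add: Liminf_const)
    finally show ?thesis .
  qed
  have "increment C s t D'"
    unfolding increment_def using T mF P1 P2 P3 by auto
  then show ?thesis using ae by blast
qed

end

section \<open>The stochastic convolution\<close>

text \<open>Expansion into a Gram matrix. It serves twice in \<open>ito_isometry_le\<close>, over
  time with indicator functions and over the probability space with scalar increments.\<close>

lemma integral_norm_square_sum:
  fixes c :: "'i \<Rightarrow> 'h::real_inner" and \<xi> :: "'i \<Rightarrow> 'b \<Rightarrow> real"
  assumes "\<And>i j. i \<in> I \<Longrightarrow> j \<in> I \<Longrightarrow> integrable N (\<lambda>x. \<xi> i x * \<xi> j x)"
  shows "integrable N (\<lambda>x. (norm (\<Sum>i\<in>I. \<xi> i x *\<^sub>R c i))\<^sup>2)"
    and "(\<integral>x. (norm (\<Sum>i\<in>I. \<xi> i x *\<^sub>R c i))\<^sup>2 \<partial>N) = (\<Sum>i\<in>I. \<Sum>j\<in>I. (\<integral>x. \<xi> i x * \<xi> j x \<partial>N) * inner (c i) (c j))"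
proof -
  have eq: "(norm (\<Sum>i\<in>I. \<xi> i x *\<^sub>R c i))\<^sup>2 = (\<Sum>i\<in>I. \<Sum>j\<in>I. (\<xi> i x * \<xi> j x) * inner (c i) (c j))" for x
    by (simp add: power2_norm_eq_inner inner_sum_left inner_sum_right sum_distrib_left mult.assoc mult.left_commute inner_commute)
  show "integrable N (\<lambda>x. (norm (\<Sum>i\<in>I. \<xi> i x *\<^sub>R c i))\<^sup>2)"
    unfolding eq using assms by (intro Bochner_Integration.integrable_sum integrable_mult_left) auto
  have "(\<integral>x. (norm (\<Sum>i\<in>I. \<xi> i x *\<^sub>R c i))\<^sup>2 \<partial>N) = (\<Sum>i\<in>I. \<integral>x. (\<Sum>j\<in>I. (\<xi> i x * \<xi> j x) * inner (c i) (c j)) \<partial>N)"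
    unfolding eq using assms by (intro Bochner_Integration.integral_sum Bochner_Integration.integrable_sum integrable_mult_left) auto
  also have "\<dots> = (\<Sum>i\<in>I. \<Sum>j\<in>I. \<integral>x. (\<xi> i x * \<xi> j x) * inner (c i) (c j) \<partial>N)"
    using assms by (intro sum.cong refl Bochner_Integration.integral_sum integrable_mult_left) auto
  finally show "(\<integral>x. (norm (\<Sum>i\<in>I. \<xi> i x *\<^sub>R c i))\<^sup>2 \<partial>N) = (\<Sum>i\<in>I. \<Sum>j\<in>I. (\<integral>x. \<xi> i x * \<xi> j x \<partial>N) * inner (c i) (c j))"
    by simp
qed

lemma norm_add3_square_le:
  "(norm (x + y + z))\<^sup>2 \<le> 3 * (norm x)\<^sup>2 + 3 * (norm y)\<^sup>2 + 3 * (norm z)\<^sup>2" for x y z :: "'h::real_normed_vector"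
proof -
  have "norm (x + y + z) \<le> norm x + norm y + norm z"
    using norm_triangle_ineq[of "x + y" z] norm_triangle_ineq[of x y] by linarith
  then have "(norm (x + y + z))\<^sup>2 \<le> (norm x + norm y + norm z)\<^sup>2"
    by (intro power_mono) auto
  also have "\<dots> \<le> 3 * (norm x)\<^sup>2 + 3 * (norm y)\<^sup>2 + 3 * (norm z)\<^sup>2"
    using sum_squares_bound[of "norm x" "norm y"] sum_squares_bound[of "norm y" "norm z"] sum_squares_bound[of "norm x" "norm z"]
    by (simp add: power2_eq_square algebra_simps)
  finally show ?thesis .
qed

text \<open>The intervals in a list of steps may overlap: step functions on unrelated partitions are
  added by concatenation, without a common refinement.\<close>

type_synonym 'n step = "real \<times> real \<times> ('n l2_torus \<Rightarrow> 'n l2_torus)"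

definition step_value :: "'n::finite step list \<Rightarrow> real \<Rightarrow> 'n l2_torus \<Rightarrow> 'n l2_torus"
  where "step_value xs s v = (\<Sum>(a, b, C)\<leftarrow>xs. indicator {a<..b} s *\<^sub>R C v)"

definition admissible :: "'n::finite step list \<Rightarrow> bool"
  where "admissible xs \<longleftrightarrow> (\<forall>(a, b, C)\<in>set xs. 0 \<le> a \<and> a \<le> b \<and> bounded_linear C)"

lemma step_value_append: "step_value (xs @ ys) s v = step_value xs s v + step_value ys s v"
  by (simp add: step_value_def)

lemma admissible_append: "admissible (xs @ ys) \<longleftrightarrow> admissible xs \<and> admissible ys"
  by (simp add: admissible_def ball_Un)

lemma borel_measurable_step_value [measurable]: "(\<lambda>s. step_value xs s v) \<in> borel_measurable borel"
proof (induction xs)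
  case (Cons x xs)
  then show ?case by (cases x) (simp add: step_value_def)
qed (simp add: step_value_def)

context noise
begin

definition step_noise :: "'n step list \<Rightarrow> 'a \<Rightarrow> 'n l2_torus"
  where "step_noise xs \<omega> = (\<Sum>(a, b, C)\<leftarrow>xs. C (dW a b \<omega>))"

lemma step_noise_append: "step_noise (xs @ ys) \<omega> = step_noise xs \<omega> + step_noise ys \<omega>"
  by (simp add: step_noise_def)

text \<open>Truncated to K modes, the two sides are the same Gram sum, because the covariance of two
  scalar increments is the overlap of their intervals or, for different modes, zero. As K grows,
  Fatou on the left gives an inequality, the direction that shows step integrals to be
  small.\<close>

lemma ito_isometry_le:
  assumes xs: "admissible xs"
  shows "(\<integral>\<^sup>+\<omega>. ennreal ((norm (step_noise xs \<omega>))\<^sup>2) \<partial>M) \<le> (\<integral>\<^sup>+s. (\<Sum>k. ennreal ((norm (step_value xs s (noise_vec k)))\<^sup>2)) \<partial>lborel)"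
proof -
  define n where "n = length xs"
  define a b C where "a r = fst (xs ! r)" and "b r = fst (snd (xs ! r))" and "C r = snd (snd (xs ! r))" for r
  have mem: "(a r, b r, C r) \<in> set xs" if "r < n" for r
    using that nth_mem[of r xs] by (simp add: a_def b_def C_def n_def)
  have ab: "0 \<le> a r" "a r \<le> b r" and Cl: "bounded_linear (C r)" if "r < n" for r
    using mem[OF that] xs by (auto simp: admissible_def)
  have val: "step_value xs s v = (\<Sum>r<n. indicator {a r<..b r} s *\<^sub>R C r v)" for s v
    unfolding step_value_def n_def a_def b_def C_def
    by (simp add: sum_list_sum_nth case_prod_unfold atLeast0LessThan)
  have noi: "step_noise xs \<omega> = (\<Sum>r<n. C r (dW (a r) (b r) \<omega>))" for \<omega>
    unfolding step_noise_def n_def a_def b_def C_def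
    by (simp add: sum_list_sum_nth case_prod_unfold atLeast0LessThan)
  define m where "m r q = measure lborel ({a r<..b r} \<inter> {a q<..b q})" for r q
  \<comment> \<open>The noise cut off after K modes, a finite sum of scalar increments with fixed
    vectors.\<close>
  define S where "S K \<omega> = (\<Sum>(k, r)\<in>{..<K} \<times> {..<n}. inc k (a r) (b r) \<omega> *\<^sub>R C r (noise_vec k))" for K \<omega>
  have Sval: "integrable lborel (\<lambda>s. (norm (step_value xs s v))\<^sup>2)"
    "(\<integral>s. (norm (step_value xs s v))\<^sup>2 \<partial>lborel) = (\<Sum>r<n. \<Sum>q<n. m r q * inner (C r v) (C q v))" for v
  proof -
    have int: "integrable lborel (\<lambda>s. indicator {a r<..b r} s * indicator {a q<..b q} s :: real)"
      and eq: "(\<integral>s. indicator {a r<..b r} s * indicator {a q<..b q} s \<partial>lborel) = m r q" for r q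
    proof -
      have "emeasure lborel ({a r<..b r} \<inter> {a q<..b q}) \<le> emeasure lborel {a r..b r}"
        by (intro emeasure_mono) auto
      also have "\<dots> < \<infinity>" by (simp add: emeasure_lborel_Icc_eq)
      finally have fin: "emeasure lborel ({a r<..b r} \<inter> {a q<..b q}) < \<infinity>" .
      show "integrable lborel (\<lambda>s. indicator {a r<..b r} s * indicator {a q<..b q} s :: real)"
        unfolding indicator_inter_arith[symmetric] using fin by (intro integrable_real_indicator) auto
      show "(\<integral>s. indicator {a r<..b r} s * indicator {a q<..b q} s \<partial>lborel) = m r q"
        unfolding indicator_inter_arith[symmetric] m_def by simp
    qed
    show "integrable lborel (\<lambda>s. (norm (step_value xs s v))\<^sup>2)"
      unfolding val by (rule integral_norm_square_sum(1)) (rule int)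
    show "(\<integral>s. (norm (step_value xs s v))\<^sup>2 \<partial>lborel) = (\<Sum>r<n. \<Sum>q<n. m r q * inner (C r v) (C q v))"
      unfolding val by (subst integral_norm_square_sum(2)) (simp_all add: int eq)
  qed
  have SK: "integrable M (\<lambda>\<omega>. (norm (S K \<omega>))\<^sup>2)"
    "(\<integral>\<omega>. (norm (S K \<omega>))\<^sup>2 \<partial>M) = (\<Sum>k<K. \<integral>s. (norm (step_value xs s (noise_vec k)))\<^sup>2 \<partial>lborel)" for K
  proof -
    have Seq: "S K \<omega> = (\<Sum>p\<in>{..<K} \<times> {..<n}. inc (fst p) (a (snd p)) (b (snd p)) \<omega> *\<^sub>R C (snd p) (noise_vec (fst p)))" for \<omega>
      by (simp add: S_def case_prod_unfold)
    have int: "integrable M (\<lambda>\<omega>. inc (fst p) (a (snd p)) (b (snd p)) \<omega> * inc (fst q) (a (snd q)) (b (snd q)) \<omega>)"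
      if "p \<in> {..<K} \<times> {..<n}" "q \<in> {..<K} \<times> {..<n}" for p q
      using that by (intro inc_covariance ab) auto
    show "integrable M (\<lambda>\<omega>. (norm (S K \<omega>))\<^sup>2)"
      unfolding Seq by (rule integral_norm_square_sum(1)) (rule int)
    have "(\<integral>\<omega>. (norm (S K \<omega>))\<^sup>2 \<partial>M) = (\<Sum>p\<in>{..<K} \<times> {..<n}. \<Sum>q\<in>{..<K} \<times> {..<n}.
        (\<integral>\<omega>. inc (fst p) (a (snd p)) (b (snd p)) \<omega> * inc (fst q) (a (snd q)) (b (snd q)) \<omega> \<partial>M)
          * inner (C (snd p) (noise_vec (fst p))) (C (snd q) (noise_vec (fst q))))"
      unfolding Seq by (rule integral_norm_square_sum(2)) (rule int)
    also have "\<dots> = (\<Sum>p\<in>{..<K} \<times> {..<n}. \<Sum>q\<in>{..<K} \<times> {..<n}.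
        (if fst p = fst q then m (snd p) (snd q) * inner (C (snd p) (noise_vec (fst p))) (C (snd q) (noise_vec (fst q))) else 0))"
      by (intro sum.cong refl) (auto simp: inc_covariance ab m_def)
    also have "\<dots> = (\<Sum>k<K. \<Sum>r<n. \<Sum>l<K. \<Sum>q<n. (if k = l then m r q * inner (C r (noise_vec k)) (C q (noise_vec l)) else 0))"
      by (simp only: sum.cartesian_product' fst_conv snd_conv)
    also have "\<dots> = (\<Sum>k<K. \<Sum>r<n. \<Sum>q<n. m r q * inner (C r (noise_vec k)) (C q (noise_vec k)))"
    proof (rule sum.cong[OF refl], rule sum.cong[OF refl])
      fix k r assume k: "k \<in> {..<K}"
      have "(\<Sum>l<K. \<Sum>q<n. (if k = l then m r q * inner (C r (noise_vec k)) (C q (noise_vec l)) else 0))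
          = (\<Sum>l<K. if k = l then \<Sum>q<n. m r q * inner (C r (noise_vec k)) (C q (noise_vec l)) else 0)"
        by (intro sum.cong) auto
      then show "(\<Sum>l<K. \<Sum>q<n. (if k = l then m r q * inner (C r (noise_vec k)) (C q (noise_vec l)) else 0))
          = (\<Sum>q<n. m r q * inner (C r (noise_vec k)) (C q (noise_vec k)))"
        using k by simp
    qed
    finally show "(\<integral>\<omega>. (norm (S K \<omega>))\<^sup>2 \<partial>M) = (\<Sum>k<K. \<integral>s. (norm (step_value xs s (noise_vec k)))\<^sup>2 \<partial>lborel)"
      by (simp add: Sval)
  qed
  let ?R = "\<integral>\<^sup>+s. (\<Sum>k. ennreal ((norm (step_value xs s (noise_vec k)))\<^sup>2)) \<partial>lborel"
  have bound: "(\<integral>\<^sup>+\<omega>. ennreal ((norm (S K \<omega>))\<^sup>2) \<partial>M) \<le> ?R" for K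
  proof -
    have "(\<integral>\<^sup>+\<omega>. ennreal ((norm (S K \<omega>))\<^sup>2) \<partial>M) = ennreal (\<Sum>k<K. \<integral>s. (norm (step_value xs s (noise_vec k)))\<^sup>2 \<partial>lborel)"
      using nn_integral_eq_integral[OF SK(1)] SK(2) by simp
    also have "\<dots> = (\<Sum>k<K. ennreal (\<integral>s. (norm (step_value xs s (noise_vec k)))\<^sup>2 \<partial>lborel))"
      by (subst sum_ennreal) auto
    also have "\<dots> = (\<Sum>k<K. \<integral>\<^sup>+s. ennreal ((norm (step_value xs s (noise_vec k)))\<^sup>2) \<partial>lborel)"
      by (intro sum.cong refl nn_integral_eq_integral[symmetric] Sval) simp
    also have "\<dots> \<le> (\<Sum>k. \<integral>\<^sup>+s. ennreal ((norm (step_value xs s (noise_vec k)))\<^sup>2) \<partial>lborel)"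
      by (rule sum_le_suminf) auto
    also have "\<dots> = ?R"
      by (rule nn_integral_suminf[symmetric]) measurable
    finally show ?thesis .
  qed
  have incm: "inc k (a r) (b r) \<in> borel_measurable M" if "r < n" for k r
    using inc_measurable ab[OF that] by blast
  have SM: "S K \<in> borel_measurable M" for K
    unfolding S_def by (intro borel_measurable_sum) (auto intro!: borel_measurable_scaleR incm)
  have "AE \<omega> in M. \<forall>r\<in>{..<n}. (\<lambda>k. inc k (a r) (b r) \<omega> *\<^sub>R noise_vec k) sums dW (a r) (b r) \<omega>"
    by (rule AE_finite_allI) (auto intro: dW_sums ab)
  then have "AE \<omega> in M. ennreal ((norm (step_noise xs \<omega>))\<^sup>2) = liminf (\<lambda>K. ennreal ((norm (S K \<omega>))\<^sup>2))"
  proof eventually_elim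
    case (elim \<omega>)
    have SKeq: "S K \<omega> = (\<Sum>r<n. C r (\<Sum>k<K. inc k (a r) (b r) \<omega> *\<^sub>R noise_vec k))" for K
    proof -
      have "(\<Sum>r<n. C r (\<Sum>k<K. inc k (a r) (b r) \<omega> *\<^sub>R noise_vec k)) = (\<Sum>r<n. \<Sum>k<K. inc k (a r) (b r) \<omega> *\<^sub>R C r (noise_vec k))"
        using Cl by (intro sum.cong refl) (simp add: linear_sum linear_scale bounded_linear.linear)
      also have "\<dots> = (\<Sum>k<K. \<Sum>r<n. inc k (a r) (b r) \<omega> *\<^sub>R C r (noise_vec k))"
        by (rule sum.swap)
      finally show ?thesis by (simp add: S_def sum.cartesian_product)
    qed
    have "(\<lambda>K. S K \<omega>) \<longlonglongrightarrow> step_noise xs \<omega>"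
      unfolding noi SKeq
    proof (rule tendsto_sum)
      fix r assume r: "r \<in> {..<n}"
      have "(\<lambda>K. \<Sum>k<K. inc k (a r) (b r) \<omega> *\<^sub>R noise_vec k) \<longlonglongrightarrow> dW (a r) (b r) \<omega>"
        using elim r by (simp add: sums_def)
      then show "(\<lambda>K. C r (\<Sum>k<K. inc k (a r) (b r) \<omega> *\<^sub>R noise_vec k)) \<longlonglongrightarrow> C r (dW (a r) (b r) \<omega>)"
        by (rule bounded_linear.tendsto[OF Cl, rotated]) (use r in simp)
    qed
    then have "(\<lambda>K. ennreal ((norm (S K \<omega>))\<^sup>2)) \<longlonglongrightarrow> ennreal ((norm (step_noise xs \<omega>))\<^sup>2)"
      by (intro tendsto_intros)
    then show ?case by (intro lim_imp_Liminf[symmetric]) simp_all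
  qed
  then have "(\<integral>\<^sup>+\<omega>. ennreal ((norm (step_noise xs \<omega>))\<^sup>2) \<partial>M) = (\<integral>\<^sup>+\<omega>. liminf (\<lambda>K. ennreal ((norm (S K \<omega>))\<^sup>2)) \<partial>M)"
    by (rule nn_integral_cong_AE)
  also have "\<dots> \<le> liminf (\<lambda>K. \<integral>\<^sup>+\<omega>. ennreal ((norm (S K \<omega>))\<^sup>2) \<partial>M)"
    using SM by (intro nn_integral_liminf) measurable
  also have "\<dots> \<le> liminf (\<lambda>K :: nat. ?R)"
    by (intro Liminf_mono always_eventually allI bound)
  also have "\<dots> = ?R" by (simp add: Liminf_const)
  finally show ?thesis .
qed

end

section \<open>Partitions, uniform grids and differences of step functions\<close>

lemma partition_mono:
  assumes "partition N p t" "i \<le> j" "j \<le> N"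
  shows "p i \<le> p j"
  using assms(2,3)
proof (induction rule: dec_induct)
  case (step n)
  then show ?case using assms(1) by (auto simp: partition_def intro: order_trans)
qed simp

lemma partition_bounds:
  assumes "partition N p t" "j \<le> N"
  shows "0 \<le> p j" "p j \<le> t"
  using partition_mono[OF assms(1), of 0 j] partition_mono[OF assms(1), of j N] assms by (auto simp: partition_def)

lemma sum_indicator_partition:
  fixes p :: "nat \<Rightarrow> real"
  assumes "\<And>j. j < n \<Longrightarrow> p j \<le> p (Suc j)"
  shows "(\<Sum>j<n. indicator {p j<..p (Suc j)} s :: real) = indicator {p 0<..p n} s" and "p 0 \<le> p n"
proof -
  have "(\<Sum>j<n. indicator {p j<..p (Suc j)} s :: real) = indicator {p 0<..p n} s \<and> p 0 \<le> p n"
    using assms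
  proof (induction n)
    case (Suc n)
    then have p: "p n \<le> p (Suc n)" "p 0 \<le> p n" by auto
    then have "indicator {p 0<..p n} s + indicator {p n<..p (Suc n)} s = (indicator {p 0<..p (Suc n)} s :: real)"
      by (auto simp: indicator_def)
    moreover have "p 0 \<le> p (Suc n)" using p by linarith
    ultimately show ?case using Suc by simp
  qed simp
  then show "(\<Sum>j<n. indicator {p j<..p (Suc j)} s :: real) = indicator {p 0<..p n} s" "p 0 \<le> p n"
    by auto
qed

text \<open>The index m stands for m + 1 cells, so there is never a division by zero.\<close>

definition grid :: "real \<Rightarrow> real \<Rightarrow> nat \<Rightarrow> nat \<Rightarrow> real"
  where "grid a b m j = a + real j * ((b - a) / real (Suc m))"

lemma grid_simps:
  assumes "a \<le> b"
  shows "grid a b m 0 = a" "grid a b m (Suc m) = b" "grid a b m j \<le> grid a b m (Suc j)" "a \<le> grid a b m j"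
    "grid a b m (Suc j) - grid a b m j = (b - a) / real (Suc m)"
proof -
  have h: "0 \<le> (b - a) / real (Suc m)" using assms by simp
  show "grid a b m 0 = a" by (simp add: grid_def)
  show "grid a b m (Suc m) = b" by (simp add: grid_def)
  show d: "grid a b m (Suc j) - grid a b m j = (b - a) / real (Suc m)"
    by (simp add: grid_def distrib_right del: times_divide_eq_right)
  show "grid a b m j \<le> grid a b m (Suc j)" using d h by linarith
  show "a \<le> grid a b m j" using mult_nonneg_nonneg[OF of_nat_0_le_iff h, of j] unfolding grid_def by linarith
qed

definition neg_steps :: "'n::finite step list \<Rightarrow> 'n step list"
  where "neg_steps xs = map (\<lambda>(a, b, C). (a, b, \<lambda>v. - C v)) xs"

lemma step_value_neg: "step_value (neg_steps xs) s v = - step_value xs s v"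
  by (induction xs) (auto simp: step_value_def neg_steps_def)

lemma admissible_neg: "admissible xs \<Longrightarrow> admissible (neg_steps xs)"
  by (auto simp: admissible_def neg_steps_def intro: bounded_linear_minus)

definition steps_of :: "('n::finite l2_torus \<Rightarrow> 'n l2_torus) \<Rightarrow> nat \<Rightarrow> (nat \<Rightarrow> real) \<Rightarrow> (nat \<Rightarrow> 'n l2_torus \<Rightarrow>\<^sub>L 'n l2_torus) \<Rightarrow> 'n step list"
  where "steps_of C N p A = map (\<lambda>j. (p j, p (Suc j), \<lambda>v. C (blinfun_apply (A j) v))) [0..<N]"

lemma sum_list_upt: "(\<Sum>j\<leftarrow>[0..<n]. f j) = (\<Sum>j<n. f j)"
  by (simp add: sum_list_sum_nth atLeast0LessThan)

lemma step_value_steps_of: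
  assumes "bounded_linear C"
  shows "step_value (steps_of C N p A) s v = C (step_function N p A s v)"
proof -
  have "step_value (steps_of C N p A) s v = (\<Sum>j<N. indicator {p j<..p (Suc j)} s *\<^sub>R C (blinfun_apply (A j) v))"
    by (simp add: step_value_def steps_of_def comp_def sum_list_upt)
  then show ?thesis
    using bounded_linear.linear[OF assms] by (simp add: step_function_def linear_sum linear_scale)
qed

lemma admissible_steps_of:
  assumes "bounded_linear C" "partition N p t"
  shows "admissible (steps_of C N p A)"
proof -
  have "0 \<le> p j" "p j \<le> p (Suc j)" if "j < N" for j
    using partition_bounds(1)[OF assms(2), of j] assms(2) that by (auto simp: partition_def)
  moreover have "bounded_linear (\<lambda>v. C (blinfun_apply (A j) v))" for j
    by (rule bounded_linear_compose[OF assms(1) blinfun.bounded_linear_right])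
  ultimately show ?thesis
    by (auto simp: admissible_def steps_of_def)
qed

lemma step_function_outside:
  assumes "partition N p t" "s \<notin> {0<..t}"
  shows "step_function N p A s v = 0"
  unfolding step_function_def
proof (rule sum.neutral, rule ballI)
  fix j assume "j \<in> {..<N}"
  then have "s \<notin> {p j<..p (Suc j)}"
    using partition_bounds(1)[OF assms(1), of j] partition_bounds(2)[OF assms(1), of "Suc j"] assms(2) by auto
  then show "indicator {p j<..p (Suc j)} s *\<^sub>R blinfun_apply (A j) v = 0" by simp
qed

context noise
begin

lemma step_noise_neg: "step_noise (neg_steps xs) \<omega> = - step_noise xs \<omega>"
  by (induction xs) (auto simp: step_noise_def neg_steps_def)

lemma step_noise_steps_of:
  assumes "bounded_linear C"
  shows "step_noise (steps_of C N p A) \<omega> = C (step_integral W N p A \<omega>)"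
proof -
  have "step_noise (steps_of C N p A) \<omega> = (\<Sum>j<N. C (blinfun_apply (A j) (dW (p j) (p (Suc j)) \<omega>)))"
    by (simp add: step_noise_def steps_of_def comp_def sum_list_upt)
  then show ?thesis
    using bounded_linear.linear[OF assms] by (simp add: step_integral_def dW_def linear_sum)
qed

lemma step_integral_measurable:
  assumes "partition N p t"
  shows "step_integral W N p A \<in> borel_measurable M"
  unfolding step_integral_def[abs_def]
proof (intro borel_measurable_sum)
  fix j assume "j \<in> {..<N}"
  then have "0 \<le> p j" "0 \<le> p (Suc j)"
    using partition_bounds(1)[OF assms] by auto
  then have "(\<lambda>\<omega>. W (p (Suc j)) \<omega> - W (p j) \<omega>) \<in> borel_measurable M"
    by (intro borel_measurable_diff W_measurable)
  then show "(\<lambda>\<omega>. blinfun_apply (A j) (W (p (Suc j)) \<omega> - W (p j) \<omega>)) \<in> borel_measurable M"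
    by (rule measurable_compose) (intro borel_measurable_continuous_onI linear_continuous_on blinfun.bounded_linear_right)
qed

section \<open>The integrand of the interaction picture and its left-point sums\<close>

definition rot :: "'n l2_torus \<Rightarrow> 'n l2_torus" where "rot v = (- (\<i> * complex_of_real \<alpha>)) *\<^sub>C v"

text \<open>The integrand -i alpha S(-s) of Y; it scales norms by |alpha| for every s.\<close>

definition U :: "real \<Rightarrow> 'n l2_torus \<Rightarrow> 'n l2_torus" where "U s v = rot (schroedinger_group (- s) v)"

lemma bounded_linear_rot: "bounded_linear rot"
  unfolding rot_def[abs_def] by (rule bounded_linear_scaleC)

lemma norm_rot: "norm (rot v) = \<bar>\<alpha>\<bar> * norm v"
  by (simp add: rot_def norm_scaleC norm_mult)

lemma bounded_linear_U: "bounded_linear (U s)"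
  unfolding U_def[abs_def] by (rule bounded_linear_compose[OF bounded_linear_rot bounded_linear_schroedinger])

lemma norm_U: "norm (U s v) = \<bar>\<alpha>\<bar> * norm v"
  by (simp add: U_def norm_rot)

lemma continuous_on_U: "continuous_on UNIV (\<lambda>s. U s v)"
proof -
  have "continuous_on UNIV (\<lambda>s. schroedinger_group (- s) v)"
    by (rule continuous_on_compose2[OF continuous_on_schroedinger_time]) (auto intro: continuous_intros)
  then show ?thesis
    unfolding U_def by (rule bounded_linear.continuous_on[OF bounded_linear_rot])
qed

lemma borel_measurable_U [measurable]: "(\<lambda>s. U s v) \<in> borel_measurable borel"
  by (rule borel_measurable_continuous_onI[OF continuous_on_U])

text \<open>Turns the kernel S(t - s) of the convolution up to time t into an integrand that does
  not see t; convolutions up to different times thereby become comparable.\<close>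

lemma U_schroedinger: "U t (schroedinger_group (t - s) v) = U s v"
  by (simp add: U_def schroedinger_group_add)

text \<open>The integrand is frozen at the left end of each cell. Every coefficient then scales
  norms by |alpha|, so \<open>increment_base\<close> applies cell by cell; the operators in
  \<open>has_stochastic_integral\<close> are arbitrary bounded ones and have no such
  property.\<close>

definition grid_steps :: "real \<Rightarrow> real \<Rightarrow> nat \<Rightarrow> 'n step list"
  where "grid_steps a b m = map (\<lambda>j. (grid a b m j, grid a b m (Suc j), U (grid a b m j))) [0..<Suc m]"

lemma admissible_grid_steps: "0 \<le> a \<Longrightarrow> a \<le> b \<Longrightarrow> admissible (grid_steps a b m)"
  using grid_simps(3,4)[of a b m] bounded_linear_U
  by (auto simp: admissible_def grid_steps_def intro: order_trans simp del: upt_Suc)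

lemma increment_grid_steps:
  assumes "0 \<le> a" "a \<le> b"
  shows "increment 9 a b (step_noise (grid_steps a b m))"
proof -
  have eq: "step_noise (grid_steps a b m) = (\<lambda>\<omega>. \<Sum>j<Suc m. U (grid a b m j) (dW (grid a b m j) (grid a b m (Suc j)) \<omega>))"
    by (simp add: step_noise_def grid_steps_def comp_def sum_list_upt fun_eq_iff del: upt_Suc sum.lessThan_Suc)
  have "increment 9 (grid a b m 0) (grid a b m (Suc m)) (\<lambda>\<omega>. \<Sum>j<Suc m. U (grid a b m j) (dW (grid a b m j) (grid a b m (Suc j)) \<omega>))"
    using assms grid_simps[OF assms(2), of m]
    by (intro increment_sum increment_base bounded_linear_U norm_U) (auto intro: order_trans)
  then show ?thesis
    unfolding eq grid_simps[OF assms(2)] .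
qed

definition grid_error :: "real \<Rightarrow> real \<Rightarrow> nat \<Rightarrow> real \<Rightarrow> 'n l2_torus \<Rightarrow> 'n l2_torus"
  where "grid_error a b m s v = (\<Sum>j<Suc m. indicator {grid a b m j<..grid a b m (Suc j)} s *\<^sub>R (U (grid a b m j) v - U s v))"

lemma step_value_grid_steps:
  assumes "a \<le> b"
  shows "step_value (grid_steps a b m) s v = indicator {a<..b} s *\<^sub>R U s v + grid_error a b m s v"
proof -
  have "step_value (grid_steps a b m) s v = (\<Sum>j<Suc m. indicator {grid a b m j<..grid a b m (Suc j)} s *\<^sub>R U (grid a b m j) v)"
    by (simp add: step_value_def grid_steps_def comp_def sum_list_upt del: upt_Suc sum.lessThan_Suc)
  moreover have "(\<Sum>j<Suc m. indicator {grid a b m j<..grid a b m (Suc j)} s *\<^sub>R U s v) = indicator {a<..b} s *\<^sub>R U s v"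
    using sum_indicator_partition(1)[of "Suc m" "grid a b m" s] grid_simps[OF assms, of m]
    by (simp add: scaleR_sum_left[symmetric] del: sum.lessThan_Suc)
  ultimately show ?thesis
    by (simp add: grid_error_def scaleR_diff_right sum_subtractf del: sum.lessThan_Suc)
qed

lemma grid_error_bound:
  assumes "a \<le> b"
    and "\<And>j. s \<in> {grid a b m j<..grid a b m (Suc j)} \<Longrightarrow> norm (U (grid a b m j) v - U s v) \<le> \<epsilon>"
  shows "norm (grid_error a b m s v) \<le> indicator {a<..b} s * \<epsilon>"
proof -
  have "norm (grid_error a b m s v) \<le> (\<Sum>j<Suc m. indicator {grid a b m j<..grid a b m (Suc j)} s * \<epsilon>)"
    unfolding grid_error_def by (rule sum_norm_le) (use assms(2) in \<open>auto simp: indicator_def\<close>)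
  also have "\<dots> = indicator {a<..b} s * \<epsilon>"
    using sum_indicator_partition(1)[of "Suc m" "grid a b m" s] grid_simps[OF assms(1), of m]
    by (simp add: sum_distrib_right[symmetric] del: sum.lessThan_Suc)
  finally show ?thesis .
qed

lemma grid_error_measurable [measurable]: "(\<lambda>s. grid_error a b m s v) \<in> borel_measurable borel"
  unfolding grid_error_def by measurable

lemma grid_error_square_bound:
  assumes "a \<le> b"
  shows "ennreal ((norm (grid_error a b m s v))\<^sup>2) \<le> indicator {a<..b} s * ennreal ((2 * \<bar>\<alpha>\<bar> * norm v)\<^sup>2)"
proof -
  have "norm (grid_error a b m s v) \<le> indicator {a<..b} s * (2 * \<bar>\<alpha>\<bar> * norm v)"
  proof (rule grid_error_bound[OF assms])
    fix j
    show "norm (U (grid a b m j) v - U s v) \<le> 2 * \<bar>\<alpha>\<bar> * norm v"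
      using norm_triangle_ineq4[of "U (grid a b m j) v" "U s v"] by (simp add: norm_U)
  qed
  then have "(norm (grid_error a b m s v))\<^sup>2 \<le> (indicator {a<..b} s * (2 * \<bar>\<alpha>\<bar> * norm v))\<^sup>2"
    by (intro power_mono) auto
  then have "ennreal ((norm (grid_error a b m s v))\<^sup>2) \<le> ennreal ((indicator {a<..b} s * (2 * \<bar>\<alpha>\<bar> * norm v))\<^sup>2)"
    by (rule ennreal_leI)
  then show ?thesis by (auto simp: indicator_def split: if_splits)
qed

lemma grid_error_tendsto:
  assumes ab: "a \<le> b"
  shows "(\<lambda>m. grid_error a b m s v) \<longlonglongrightarrow> 0"
proof (rule LIMSEQ_I)
  fix r :: real assume "0 < r"
  have "isCont (\<lambda>s. U s v) s"
    using continuous_on_U by (simp add: continuous_on_eq_continuous_at)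
  then obtain d where d: "0 < d" "\<And>x. dist x s < d \<Longrightarrow> dist (U x v) (U s v) < r / 2"
    using \<open>0 < r\<close> unfolding continuous_at_eps_delta by (meson half_gt_zero)
  have "(\<lambda>m. (b - a) / real (Suc m)) \<longlonglongrightarrow> 0"
    using LIMSEQ_Suc[OF lim_const_over_n[of "b - a"]] by simp
  then obtain M where M: "\<And>m. M \<le> m \<Longrightarrow> (b - a) / real (Suc m) < d"
    using order_tendstoD(2)[of _ 0 sequentially d] d(1) by (auto simp: eventually_sequentially)
  have "norm (grid_error a b m s v) < r" if "M \<le> m" for m
  proof -
    have "norm (grid_error a b m s v) \<le> indicator {a<..b} s * (r / 2)"
    proof (rule grid_error_bound[OF ab])
      fix j assume "s \<in> {grid a b m j<..grid a b m (Suc j)}"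
      then have "dist (grid a b m j) s \<le> (b - a) / real (Suc m)"
        using grid_simps(5)[OF ab, of m j] by (simp add: dist_real_def)
      then have "dist (grid a b m j) s < d" using M[OF that] by simp
      then show "norm (U (grid a b m j) v - U s v) \<le> r / 2"
        using d(2) by (simp add: dist_norm less_imp_le)
    qed
    also have "\<dots> < r" using \<open>0 < r\<close> by (auto simp: indicator_def)
    finally show ?thesis .
  qed
  then show "\<exists>no. \<forall>m\<ge>no. norm (grid_error a b m s v - 0) < r" by auto
qed

text \<open>The group is strongly but not norm continuous, so no rate uniform in the vector is
  available. Dominated convergence is used twice, over the modes with the summable majorant 4
  alpha^2 |gamma_k|^2 and over (a, b] with its sum.\<close>

lemma grid_error_integral_tendsto:
  assumes ab: "a \<le> b"
  shows "(\<lambda>m. \<integral>\<^sup>+s. (\<Sum>k. ennreal ((norm (grid_error a b m s (noise_vec k)))\<^sup>2)) \<partial>lborel) \<longlonglongrightarrow> 0"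
proof -
  define w where "w k = ennreal (4 * \<alpha>\<^sup>2) * ennreal ((cmod (\<gamma> k))\<^sup>2)" for k
  have sw: "(\<Sum>k. w k) = ennreal (4 * \<alpha>\<^sup>2) * ennreal (trace_Q \<gamma>)"
    unfolding w_def by (simp add: suminf_ennreal_trace)
  have bd: "ennreal ((norm (grid_error a b m s (noise_vec k)))\<^sup>2) \<le> indicator {a<..b} s * w k" for m s k
    using grid_error_square_bound[OF ab, of m s "noise_vec k"]
    by (simp add: norm_vec w_def power_mult_distrib ennreal_mult[symmetric])
  have pt: "(\<lambda>m. ennreal ((norm (grid_error a b m s v))\<^sup>2)) \<longlonglongrightarrow> 0" for s v
  proof -
    have "(\<lambda>m. ennreal ((norm (grid_error a b m s v))\<^sup>2)) \<longlonglongrightarrow> ennreal ((norm (0 :: 'n l2_torus))\<^sup>2)"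
      by (intro tendsto_intros grid_error_tendsto ab)
    then show ?thesis by simp
  qed
  have series: "(\<lambda>m. \<Sum>k. ennreal ((norm (grid_error a b m s (noise_vec k)))\<^sup>2)) \<longlonglongrightarrow> 0" for s
  proof -
    have "(\<lambda>m. \<integral>\<^sup>+k. ennreal ((norm (grid_error a b m s (noise_vec k)))\<^sup>2) \<partial>count_space UNIV) \<longlonglongrightarrow> (\<integral>\<^sup>+k. 0 \<partial>count_space (UNIV :: nat set))"
    proof (rule nn_integral_dominated_convergence)
      show "AE k in count_space UNIV. ennreal ((norm (grid_error a b m s (noise_vec k)))\<^sup>2) \<le> w k" for m
      proof (rule AE_I2)
        fix k
        have "indicator {a<..b} s * w k \<le> w k" by (auto simp: indicator_def)
        then show "ennreal ((norm (grid_error a b m s (noise_vec k)))\<^sup>2) \<le> w k"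
          using bd order_trans by blast
      qed
      show "(\<integral>\<^sup>+k. w k \<partial>count_space UNIV) < \<infinity>"
        by (simp add: nn_integral_count_space_nat sw ennreal_mult[symmetric] trace_nonneg)
      show "AE k in count_space UNIV. (\<lambda>m. ennreal ((norm (grid_error a b m s (noise_vec k)))\<^sup>2)) \<longlonglongrightarrow> 0"
        by (intro AE_I2 pt)
    qed auto
    then show ?thesis by (simp add: nn_integral_count_space_nat)
  qed
  have "(\<lambda>m. \<integral>\<^sup>+s. (\<Sum>k. ennreal ((norm (grid_error a b m s (noise_vec k)))\<^sup>2)) \<partial>lborel) \<longlonglongrightarrow> (\<integral>\<^sup>+s. 0 \<partial>(lborel :: real measure))"
  proof (rule nn_integral_dominated_convergence)
    show "AE s in lborel. (\<Sum>k. ennreal ((norm (grid_error a b m s (noise_vec k)))\<^sup>2)) \<le> (\<Sum>k. w k) * indicator {a<..b} s" for m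
    proof (rule AE_I2)
      fix s
      have "(\<Sum>k. ennreal ((norm (grid_error a b m s (noise_vec k)))\<^sup>2)) \<le> (\<Sum>k. indicator {a<..b} s * w k)"
        by (intro suminf_le bd) auto
      then show "(\<Sum>k. ennreal ((norm (grid_error a b m s (noise_vec k)))\<^sup>2)) \<le> (\<Sum>k. w k) * indicator {a<..b} s"
        by (simp add: mult.commute)
    qed
    show "(\<integral>\<^sup>+s. (\<Sum>k. w k) * indicator {a<..b} s \<partial>lborel) < \<infinity>"
      using ab by (simp add: nn_integral_cmult_indicator sw ennreal_mult[symmetric] trace_nonneg)
    show "AE s in lborel. (\<lambda>m. \<Sum>k. ennreal ((norm (grid_error a b m s (noise_vec k)))\<^sup>2)) \<longlonglongrightarrow> 0"
      by (intro AE_I2 series)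
  qed measurable
  then show ?thesis by simp
qed


section \<open>Increments of the stochastic convolution\<close>

lemma U_diff: "U t (x - y) = U t x - U t y"
  by (rule linear_diff[OF bounded_linear.linear[OF bounded_linear_U]])

lemma U_add: "U t (x + y) = U t x + U t y"
  by (rule linear_add[OF bounded_linear.linear[OF bounded_linear_U]])

lemma U_zero [simp]: "U t 0 = 0"
  by (rule linear_0[OF bounded_linear.linear[OF bounded_linear_U]])

lemma U_scaleR: "U t (c *\<^sub>R x) = c *\<^sub>R U t x"
  by (rule linear_scale[OF bounded_linear.linear[OF bounded_linear_U]])

lemma step_function_measurable [measurable]: "(\<lambda>s. step_function N p A s v) \<in> borel_measurable borel"
  unfolding step_function_def by measurable

lemma schroedinger_time_measurable [measurable]: "(\<lambda>s. schroedinger_group (t - s) v) \<in> borel_measurable borel"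
  by (rule borel_measurable_continuous_onI, rule continuous_on_compose2[OF continuous_on_schroedinger_time])
    (auto intro: continuous_intros)

text \<open>Off (0, t] both functions on the left vanish, so the point 0, which belongs to the
  interval of integration but to no cell, causes no trouble.\<close>

lemma norm_square_U_step_le:
  assumes "partition N p t"
  shows "(norm (U t (step_function N p A s v - indicator {0<..t} s *\<^sub>R schroedinger_group (t - s) v)))\<^sup>2
    \<le> \<alpha>\<^sup>2 * ((norm (step_function N p A s v - schroedinger_group (t - s) v))\<^sup>2 * indicator {0..t} s)"
proof (cases "s \<in> {0<..t}")
  case True
  then show ?thesis by (simp add: norm_U power_mult_distrib)
next
  case False
  then show ?thesis by (simp add: step_function_outside[OF assms])
qed

text \<open>Za and Zb come with approximations on unrelated partitions of [0, a] and [0, b]. Under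
  \<open>U a\<close> and \<open>U b\<close> both become approximations of the one integrand
  \<open>U s\<close>, so their difference, minus the left-point sum over [a, b], is a step function
  that tends to zero in the Ito norm. By \<open>ito_isometry_le\<close> the left-point sums converge
  to the increment in question, and \<open>increment_limit\<close> transfers their moments.\<close>

lemma stochastic_convolution_increment:
  assumes a: "0 \<le> a" and ab: "a \<le> b"
    and Za: "has_stochastic_integral M \<gamma> e \<beta> a (\<lambda>s. schroedinger_group (a - s)) Za"
    and Zb: "has_stochastic_integral M \<gamma> e \<beta> b (\<lambda>s. schroedinger_group (b - s)) Zb"
  shows "\<exists>D. increment 9 a b D \<and> (AE \<omega> in M. U b (Zb \<omega>) - U a (Za \<omega>) = D \<omega>)"
proof -
  define err where "err T N p A = (\<integral>\<^sup>+s\<in>{0..T}. (\<Sum>k. ennreal ((norm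
        (step_function N p A s (noise_vec k) - schroedinger_group (T - s) (noise_vec k)))\<^sup>2)) \<partial>lborel)"
    for T N p and A :: "nat \<Rightarrow> 'n l2_torus \<Rightarrow>\<^sub>L 'n l2_torus"
  define sto where "sto Z N p A = (\<integral>\<^sup>+\<omega>. ennreal ((norm (step_integral W N p A \<omega> - Z \<omega>))\<^sup>2) \<partial>M)"
    for Z N p and A :: "nat \<Rightarrow> 'n l2_torus \<Rightarrow>\<^sub>L 'n l2_torus"
  from Za obtain N p A where Zam [measurable]: "Za \<in> borel_measurable M"
    and pa: "\<And>m. partition (N m) (p m) a"
    and erra: "(\<lambda>m. err a (N m) (p m) (A m)) \<longlonglongrightarrow> 0"
    and stoa: "(\<lambda>m. sto Za (N m) (p m) (A m)) \<longlonglongrightarrow> 0"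
    unfolding has_stochastic_integral_def err_def sto_def noise_vec_def by blast
  from Zb obtain N' p' A' where Zbm [measurable]: "Zb \<in> borel_measurable M"
    and pb: "\<And>m. partition (N' m) (p' m) b"
    and errb: "(\<lambda>m. err b (N' m) (p' m) (A' m)) \<longlonglongrightarrow> 0"
    and stob: "(\<lambda>m. sto Zb (N' m) (p' m) (A' m)) \<longlonglongrightarrow> 0"
    unfolding has_stochastic_integral_def err_def sto_def noise_vec_def by blast
  have Ia [measurable]: "step_integral W (N m) (p m) (A m) \<in> borel_measurable M" for m
    by (rule step_integral_measurable[OF pa])
  have Ib [measurable]: "step_integral W (N' m) (p' m) (A' m) \<in> borel_measurable M" for m
    by (rule step_integral_measurable[OF pb])
  have Um [measurable]: "U t \<in> borel_measurable borel" for t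
    by (intro borel_measurable_continuous_onI linear_continuous_on bounded_linear_U)
  define Y where "Y \<omega> = U b (Zb \<omega>) - U a (Za \<omega>)" for \<omega>
  have [measurable]: "Y \<in> borel_measurable M" unfolding Y_def by measurable
  define L where "L m = step_noise (grid_steps a b m)" for m
  have L: "increment 9 a b (L m)" for m unfolding L_def by (rule increment_grid_steps[OF a ab])
  have [measurable]: "L m \<in> borel_measurable M" for m by (rule increment_measurable[OF L])
  \<comment> \<open>One step function comparing all three: the approximation for b, minus that for
    a, minus the left-point sum.\<close>
  define xs where "xs m = steps_of (U b) (N' m) (p' m) (A' m) @
      neg_steps (steps_of (U a) (N m) (p m) (A m)) @ neg_steps (grid_steps a b m)" for m
  have adm: "admissible (xs m)" for m
    unfolding xs_def admissible_append
    using admissible_steps_of[OF bounded_linear_U pb] admissible_steps_of[OF bounded_linear_U pa] admissible_grid_steps[OF a ab]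
    by (auto intro!: admissible_neg)
  have noise_xs: "step_noise (xs m) \<omega> = U b (step_integral W (N' m) (p' m) (A' m) \<omega>) - U a (step_integral W (N m) (p m) (A m) \<omega>) - L m \<omega>" for m \<omega>
    by (simp add: xs_def step_noise_append step_noise_neg step_noise_steps_of[OF bounded_linear_U] L_def)
  have noise_m: "step_noise (xs m) \<in> borel_measurable M" for m
    unfolding noise_xs[abs_def] by measurable
  have split: "L m \<omega> - Y \<omega> = U b (step_integral W (N' m) (p' m) (A' m) \<omega> - Zb \<omega>)
      + - U a (step_integral W (N m) (p m) (A m) \<omega> - Za \<omega>) + - step_noise (xs m) \<omega>" for m \<omega>
    by (simp add: noise_xs Y_def U_diff)
  have pw: "ennreal ((norm (L m \<omega> - Y \<omega>))\<^sup>2) \<le> ennreal (3 * \<alpha>\<^sup>2) * ennreal ((norm (step_integral W (N' m) (p' m) (A' m) \<omega> - Zb \<omega>))\<^sup>2)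
      + ennreal (3 * \<alpha>\<^sup>2) * ennreal ((norm (step_integral W (N m) (p m) (A m) \<omega> - Za \<omega>))\<^sup>2)
      + ennreal 3 * ennreal ((norm (step_noise (xs m) \<omega>))\<^sup>2)" for m \<omega>
  proof -
    have "(norm (L m \<omega> - Y \<omega>))\<^sup>2 \<le> (3 * \<alpha>\<^sup>2) * (norm (step_integral W (N' m) (p' m) (A' m) \<omega> - Zb \<omega>))\<^sup>2
        + (3 * \<alpha>\<^sup>2) * (norm (step_integral W (N m) (p m) (A m) \<omega> - Za \<omega>))\<^sup>2 + 3 * (norm (step_noise (xs m) \<omega>))\<^sup>2"
      unfolding split
      by (rule order_trans[OF norm_add3_square_le]) (simp add: norm_U power_mult_distrib)
    from ennreal_leI[OF this] show ?thesis
      by (simp add: ennreal_plus ennreal_mult)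
  qed
  have value_xs: "step_value (xs m) s v
      = U b (step_function (N' m) (p' m) (A' m) s v - indicator {0<..b} s *\<^sub>R schroedinger_group (b - s) v)
      + - U a (step_function (N m) (p m) (A m) s v - indicator {0<..a} s *\<^sub>R schroedinger_group (a - s) v)
      + - grid_error a b m s v" for m s v
  proof -
    \<comment> \<open>This splitting of (0, b] makes the common integrand \<open>U s v\<close>
      cancel, so that only three errors remain.\<close>
    have "indicator {0<..b} s = indicator {0<..a} s + (indicator {a<..b} s :: real)"
      using a ab by (auto simp: indicator_def)
    then show ?thesis
      by (simp add: xs_def step_value_append step_value_neg step_value_steps_of[OF bounded_linear_U]
          step_value_grid_steps[OF ab] U_diff U_add U_scaleR U_schroedinger scaleR_add_left)
  qed
  have value_bound: "ennreal ((norm (step_value (xs m) s v))\<^sup>2)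
      \<le> ennreal (3 * \<alpha>\<^sup>2) * (ennreal ((norm (step_function (N' m) (p' m) (A' m) s v - schroedinger_group (b - s) v))\<^sup>2) * indicator {0..b} s)
      + ennreal (3 * \<alpha>\<^sup>2) * (ennreal ((norm (step_function (N m) (p m) (A m) s v - schroedinger_group (a - s) v))\<^sup>2) * indicator {0..a} s)
      + ennreal 3 * ennreal ((norm (grid_error a b m s v))\<^sup>2)" for m s v
  proof -
    have "(norm (step_value (xs m) s v))\<^sup>2
      \<le> 3 * \<alpha>\<^sup>2 * ((norm (step_function (N' m) (p' m) (A' m) s v - schroedinger_group (b - s) v))\<^sup>2 * indicator {0..b} s)
      + 3 * \<alpha>\<^sup>2 * ((norm (step_function (N m) (p m) (A m) s v - schroedinger_group (a - s) v))\<^sup>2 * indicator {0..a} s)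
      + 3 * (norm (grid_error a b m s v))\<^sup>2"
      unfolding value_xs
      by (rule order_trans[OF norm_add3_square_le])
        (use norm_square_U_step_le[OF pb[of m], where s = s and v = v and A = "A' m"] norm_square_U_step_le[OF pa[of m], where s = s and v = v and A = "A m"] in \<open>simp add: mult.assoc\<close>)
    from ennreal_leI[OF this] show ?thesis
      by (simp add: ennreal_plus ennreal_mult ennreal_indicator)
  qed
  have isom: "(\<integral>\<^sup>+\<omega>. ennreal ((norm (step_noise (xs m) \<omega>))\<^sup>2) \<partial>M)
      \<le> ennreal (3 * \<alpha>\<^sup>2) * err b (N' m) (p' m) (A' m) + ennreal (3 * \<alpha>\<^sup>2) * err a (N m) (p m) (A m)
        + ennreal 3 * (\<integral>\<^sup>+s. (\<Sum>k. ennreal ((norm (grid_error a b m s (noise_vec k)))\<^sup>2)) \<partial>lborel)" for m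
  proof -
    have "(\<integral>\<^sup>+\<omega>. ennreal ((norm (step_noise (xs m) \<omega>))\<^sup>2) \<partial>M) \<le> (\<integral>\<^sup>+s. (\<Sum>k. ennreal ((norm (step_value (xs m) s (noise_vec k)))\<^sup>2)) \<partial>lborel)"
      by (rule ito_isometry_le[OF adm])
    also have "\<dots> \<le> (\<integral>\<^sup>+s. (\<Sum>k. ennreal (3 * \<alpha>\<^sup>2) * (ennreal ((norm (step_function (N' m) (p' m) (A' m) s (noise_vec k) - schroedinger_group (b - s) (noise_vec k)))\<^sup>2) * indicator {0..b} s)
      + ennreal (3 * \<alpha>\<^sup>2) * (ennreal ((norm (step_function (N m) (p m) (A m) s (noise_vec k) - schroedinger_group (a - s) (noise_vec k)))\<^sup>2) * indicator {0..a} s)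
      + ennreal 3 * ennreal ((norm (grid_error a b m s (noise_vec k)))\<^sup>2)) \<partial>lborel)"
      by (intro nn_integral_mono suminf_le value_bound) auto
    also have "\<dots> = (\<integral>\<^sup>+s. ennreal (3 * \<alpha>\<^sup>2) * ((\<Sum>k. ennreal ((norm (step_function (N' m) (p' m) (A' m) s (noise_vec k) - schroedinger_group (b - s) (noise_vec k)))\<^sup>2)) * indicator {0..b} s)
      + ennreal (3 * \<alpha>\<^sup>2) * ((\<Sum>k. ennreal ((norm (step_function (N m) (p m) (A m) s (noise_vec k) - schroedinger_group (a - s) (noise_vec k)))\<^sup>2)) * indicator {0..a} s)
      + ennreal 3 * (\<Sum>k. ennreal ((norm (grid_error a b m s (noise_vec k)))\<^sup>2)) \<partial>lborel)"
      by (simp only: suminf_add[symmetric, OF summableI summableI] ennreal_suminf_cmult ennreal_suminf_multc)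
    also have "\<dots> = ennreal (3 * \<alpha>\<^sup>2) * err b (N' m) (p' m) (A' m) + ennreal (3 * \<alpha>\<^sup>2) * err a (N m) (p m) (A m)
        + ennreal 3 * (\<integral>\<^sup>+s. (\<Sum>k. ennreal ((norm (grid_error a b m s (noise_vec k)))\<^sup>2)) \<partial>lborel)"
      unfolding err_def by (simp add: nn_integral_add nn_integral_cmult)
    finally show ?thesis .
  qed
  have main: "(\<integral>\<^sup>+\<omega>. ennreal ((norm (L m \<omega> - Y \<omega>))\<^sup>2) \<partial>M)
      \<le> ennreal (3 * \<alpha>\<^sup>2) * sto Zb (N' m) (p' m) (A' m) + ennreal (3 * \<alpha>\<^sup>2) * sto Za (N m) (p m) (A m)
        + ennreal 3 * (ennreal (3 * \<alpha>\<^sup>2) * err b (N' m) (p' m) (A' m) + ennreal (3 * \<alpha>\<^sup>2) * err a (N m) (p m) (A m)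
        + ennreal 3 * (\<integral>\<^sup>+s. (\<Sum>k. ennreal ((norm (grid_error a b m s (noise_vec k)))\<^sup>2)) \<partial>lborel))" for m
  proof -
    note noise_m[measurable]
    have "(\<integral>\<^sup>+\<omega>. ennreal ((norm (L m \<omega> - Y \<omega>))\<^sup>2) \<partial>M) \<le> (\<integral>\<^sup>+\<omega>. ennreal (3 * \<alpha>\<^sup>2) * ennreal ((norm (step_integral W (N' m) (p' m) (A' m) \<omega> - Zb \<omega>))\<^sup>2)
      + ennreal (3 * \<alpha>\<^sup>2) * ennreal ((norm (step_integral W (N m) (p m) (A m) \<omega> - Za \<omega>))\<^sup>2)
      + ennreal 3 * ennreal ((norm (step_noise (xs m) \<omega>))\<^sup>2) \<partial>M)"
      by (intro nn_integral_mono pw)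
    also have "\<dots> = ennreal (3 * \<alpha>\<^sup>2) * sto Zb (N' m) (p' m) (A' m) + ennreal (3 * \<alpha>\<^sup>2) * sto Za (N m) (p m) (A m)
        + ennreal 3 * (\<integral>\<^sup>+\<omega>. ennreal ((norm (step_noise (xs m) \<omega>))\<^sup>2) \<partial>M)"
      unfolding sto_def by (simp add: nn_integral_add nn_integral_cmult)
    finally show ?thesis
      by (rule order_trans) (intro add_left_mono mult_left_mono isom, simp)
  qed
  define G where "G m = ennreal (3 * \<alpha>\<^sup>2) * sto Zb (N' m) (p' m) (A' m) + ennreal (3 * \<alpha>\<^sup>2) * sto Za (N m) (p m) (A m)
        + ennreal 3 * (ennreal (3 * \<alpha>\<^sup>2) * err b (N' m) (p' m) (A' m) + ennreal (3 * \<alpha>\<^sup>2) * err a (N m) (p m) (A m)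
        + ennreal 3 * (\<integral>\<^sup>+s. (\<Sum>k. ennreal ((norm (grid_error a b m s (noise_vec k)))\<^sup>2)) \<partial>lborel))" for m
  have "G \<longlonglongrightarrow> ennreal (3 * \<alpha>\<^sup>2) * 0 + ennreal (3 * \<alpha>\<^sup>2) * 0 + ennreal 3 * (ennreal (3 * \<alpha>\<^sup>2) * 0 + ennreal (3 * \<alpha>\<^sup>2) * 0 + ennreal 3 * 0)"
    unfolding G_def
    by (intro tendsto_add ennreal_tendsto_cmult stoa stob erra errb grid_error_integral_tendsto ab) simp_all
  then have G: "G \<longlonglongrightarrow> 0" by simp
  have "(\<lambda>m. \<integral>\<^sup>+\<omega>. ennreal ((norm (L m \<omega> - Y \<omega>))\<^sup>2) \<partial>M) \<longlonglongrightarrow> 0"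
    by (rule tendsto_sandwich[OF _ _ tendsto_const G]; rule always_eventually; rule allI)
      (simp, unfold G_def, rule main)
  then have "\<exists>D. increment 9 a b D \<and> (AE \<omega> in M. Y \<omega> = D \<omega>)"
    by (rule increment_limit[OF L, rotated]) measurable
  then show ?thesis by (simp add: Y_def)
qed

end

section \<open>Balance of the mass\<close>

lemma set_integrable_norm_interval:
  fixes g :: "real \<Rightarrow> 'h::{banach, second_countable_topology}"
  assumes g: "set_integrable lebesgue {0..t} g" and ab: "0 \<le> a" "b \<le> t"
  shows "(\<lambda>s. norm (g s)) integrable_on {a..b}"
    and "A \<in> sets lebesgue \<Longrightarrow> A \<subseteq> {a..b} \<Longrightarrow> set_integrable lebesgue A g"
    and "A \<in> sets lebesgue \<Longrightarrow> A \<subseteq> {a..b} \<Longrightarrow> (LINT s:A|lebesgue. norm (g s)) \<le> integral {a..b} (\<lambda>s. norm (g s))"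
proof -
  have sub: "set_integrable lebesgue A g" if "A \<in> sets lebesgue" "A \<subseteq> {a..b}" for A
  proof (rule set_integrable_subset[OF g that(1)])
    show "A \<subseteq> {0..t}" using that(2) ab by fastforce
  qed
  then show "A \<in> sets lebesgue \<Longrightarrow> A \<subseteq> {a..b} \<Longrightarrow> set_integrable lebesgue A g" .
  have gn: "set_integrable lebesgue {a..b} (\<lambda>s. norm (g s))"
    by (rule set_integrable_norm[OF sub]) auto
  show "(\<lambda>s. norm (g s)) integrable_on {a..b}"
    by (rule set_lebesgue_integral_eq_integral(1)[OF gn])
  assume A: "A \<in> sets lebesgue" "A \<subseteq> {a..b}"
  have "(LINT s:A|lebesgue. norm (g s)) \<le> (LINT s:{a..b}|lebesgue. norm (g s))"
    unfolding set_lebesgue_integral_def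
    by (rule integral_mono) (use set_integrable_norm[OF sub[OF A]] gn A in \<open>auto simp: set_integrable_def indicator_def\<close>)
  then show "(LINT s:A|lebesgue. norm (g s)) \<le> integral {a..b} (\<lambda>s. norm (g s))"
    using set_lebesgue_integral_eq_integral(2)[OF gn] by simp
qed

lemma norm_set_lebesgue_integral_le:
  fixes g :: "'b \<Rightarrow> 'h::{banach, second_countable_topology}"
  shows "norm (LINT s:A|N. g s) \<le> (LINT s:A|N. norm (g s))"
  unfolding set_lebesgue_integral_def
  using integral_norm_bound[of N "\<lambda>s. indicator A s *\<^sub>R g s"] by simp

text \<open>
  The second-order remainder only sees the drift \<open>g\<close>; as \<open>g\<close> is orthogonal to \<open>v\<close>, it vanishes in the limit.
\<close>

lemma drift_remainder_tendsto:
  fixes v g :: "real \<Rightarrow> 'h::{real_inner, banach, second_countable_topology}"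
  assumes t: "0 \<le> t" and v: "continuous_on {0..t} v" and g: "set_integrable lebesgue {0..t} g"
    and orth: "\<And>s. s \<in> {0..t} \<Longrightarrow> inner (v s) (g s) = 0"
    and B: "\<And>n j. j < Suc n \<Longrightarrow> B n j = v (grid 0 t n (Suc j)) - v (grid 0 t n j) - (LINT s:{grid 0 t n j<..grid 0 t n (Suc j)}|lebesgue. g s)"
  shows "(\<lambda>n. \<Sum>j<Suc n. \<bar>(norm (v (grid 0 t n (Suc j))))\<^sup>2 - (norm (v (grid 0 t n j)))\<^sup>2
    - 2 * inner (v (grid 0 t n j)) (B n j) - (norm (B n j))\<^sup>2\<bar>) \<longlonglongrightarrow> 0"
proof -
  note G = grid_simps[OF t]
  \<comment> \<open>Total size of the drift up to x. The drift over a cell is bounded by an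
    increment of H, and these telescope.\<close>
  define H where "H x = integral {0..x} (\<lambda>s. norm (g s))" for x
  have int: "(\<lambda>s. norm (g s)) integrable_on {a..b}" if "0 \<le> a" "b \<le> t" for a b
    using set_integrable_norm_interval(1)[OF g that] .
  have Hdiff: "integral {a..b} (\<lambda>s. norm (g s)) = H b - H a" if "0 \<le> a" "a \<le> b" "b \<le> t" for a b
    unfolding H_def using Henstock_Kurzweil_Integration.integral_combine[OF that(1,2) int] that by simp
  have Ht: "0 \<le> H t" unfolding H_def by (rule integral_nonneg[OF int]) auto
  have Gt: "grid 0 t n j \<le> t" if "j \<le> Suc n" for n j
  proof -
    have "real j / real (Suc n) * t \<le> 1 * t"
      using that t by (intro mult_right_mono) auto
    then show ?thesis by (simp add: grid_def)
  qed
  have ucv: "uniformly_continuous_on {0..t} v"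
    by (rule compact_uniformly_continuous[OF v]) simp
  have "continuous_on {0..t} H"
    unfolding H_def by (rule indefinite_integral_continuous_1[OF int]) auto
  then have ucH: "uniformly_continuous_on {0..t} H"
    by (rule compact_uniformly_continuous) simp
  let ?e = "\<lambda>n j. \<bar>(norm (v (grid 0 t n (Suc j))))\<^sup>2 - (norm (v (grid 0 t n j)))\<^sup>2
    - 2 * inner (v (grid 0 t n j)) (B n j) - (norm (B n j))\<^sup>2\<bar>"
  show ?thesis
  proof (rule LIMSEQ_I)
    fix r :: real assume "0 < r"
    \<comment> \<open>The cells contribute at most 3 \<eta> (H t - H 0) in total, so this choice
      leaves at most 3 r / 4; the summand 1 covers H t = 0.\<close>
    define \<eta> where "\<eta> = r / (4 * (H t + 1))"
    have \<eta>: "0 < \<eta>" using \<open>0 < r\<close> Ht by (simp add: \<eta>_def)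
    obtain d1 where d1: "0 < d1" "\<And>x y. x \<in> {0..t} \<Longrightarrow> y \<in> {0..t} \<Longrightarrow> dist y x < d1 \<Longrightarrow> dist (v y) (v x) < \<eta>"
      using ucv \<eta> unfolding uniformly_continuous_on_def by metis
    obtain d2 where d2: "0 < d2" "\<And>x y. x \<in> {0..t} \<Longrightarrow> y \<in> {0..t} \<Longrightarrow> dist y x < d2 \<Longrightarrow> dist (H y) (H x) < \<eta>"
      using ucH \<eta> unfolding uniformly_continuous_on_def by metis
    have "(\<lambda>m. t / real (Suc m)) \<longlonglongrightarrow> 0"
      using LIMSEQ_Suc[OF lim_const_over_n[of t]] by simp
    then obtain N where N: "\<And>n. N \<le> n \<Longrightarrow> t / real (Suc n) < min d1 d2"
      using order_tendstoD(2)[of _ 0 sequentially "min d1 d2"] d1(1) d2(1) by (auto simp: eventually_sequentially)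
    have "(\<Sum>j<Suc n. ?e n j) < r" if n: "N \<le> n" for n
    proof -
      have ej: "?e n j \<le> 3 * \<eta> * (H (grid 0 t n (Suc j)) - H (grid 0 t n j))" if j: "j < Suc n" for j
      proof -
        let ?a = "grid 0 t n j" and ?b = "grid 0 t n (Suc j)"
        define I where "I = {?a<..?b}"
        define A where "A = (LINT s:I|lebesgue. g s)"
        have a: "0 \<le> ?a" "?a \<le> ?b" "?b \<le> t" "?a \<le> t" using G Gt j by auto
        have h: "?b - ?a < min d1 d2" using G(5)[of n j] N[OF n] by simp
        have I: "I \<in> sets lebesgue" "I \<subseteq> {?a..?b}" unfolding I_def by auto
        have gI: "set_integrable lebesgue I g"
          by (rule set_integrable_norm_interval(2)[OF g a(1,3) I])
        have GI: "(LINT s:I|lebesgue. norm (g s)) \<le> H ?b - H ?a"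
          using set_integrable_norm_interval(3)[OF g a(1,3) I] Hdiff[OF a(1,2,3)] by simp
        then have nA: "norm A \<le> H ?b - H ?a"
          unfolding A_def using norm_set_lebesgue_integral_le[where A = I and N = lebesgue and g = g] by linarith
        have "dist (H ?b) (H ?a) < \<eta>"
          using a h by (intro d2(2)) (auto simp: dist_real_def)
        then have nA2: "norm A \<le> \<eta>" using nA by (simp add: dist_real_def)
        have inA: "\<bar>inner (v ?b) A\<bar> \<le> \<eta> * (H ?b - H ?a)"
        proof -
          have "inner (v ?b) A = (\<integral>s. inner (v ?b) (indicator I s *\<^sub>R g s) \<partial>lebesgue)"
            unfolding A_def set_lebesgue_integral_def
            by (rule integral_inner_right[symmetric]) (use gI in \<open>simp add: set_integrable_def\<close>)
          also have "\<bar>\<dots>\<bar> \<le> (\<integral>s. \<eta> * (indicator I s * norm (g s)) \<partial>lebesgue)"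
          proof (rule abs_integral_le)
            show "integrable lebesgue (\<lambda>s. inner (v ?b) (indicator I s *\<^sub>R g s))"
              using gI by (intro integrable_inner_right) (simp add: set_integrable_def)
            show "integrable lebesgue (\<lambda>s. \<eta> * (indicator I s * norm (g s)))"
              using set_integrable_norm[OF gI] by (simp add: set_integrable_def)
            show "\<bar>inner (v ?b) (indicator I s *\<^sub>R g s)\<bar> \<le> \<eta> * (indicator I s * norm (g s))" for s
            proof (cases "s \<in> I")
              case True
              then have s: "s \<in> {0..t}" "dist ?b s < d1" using a h by (auto simp: I_def dist_real_def)
              \<comment> \<open>Orthogonality at time s replaces v at the end of the cell by an
                increment of v, which is small by uniform continuity, while the drift itself is only
                integrable.\<close>
              have "inner (v ?b) (g s) = inner (v ?b - v s) (g s)"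
                using orth[OF s(1)] by (simp add: inner_diff_left)
              also have "\<bar>\<dots>\<bar> \<le> norm (v ?b - v s) * norm (g s)" by (rule Cauchy_Schwarz_ineq2)
              also have "\<dots> \<le> \<eta> * norm (g s)"
                using d1(2)[OF s(1) _ s(2)] a by (intro mult_right_mono) (auto simp: dist_norm)
              finally show ?thesis using True by simp
            qed simp
          qed
          also have "\<dots> = \<eta> * (LINT s:I|lebesgue. norm (g s))"
            by (simp add: set_lebesgue_integral_def)
          also have "\<dots> \<le> \<eta> * (H ?b - H ?a)"
            using GI \<eta> by (intro mult_left_mono) auto
          finally show ?thesis .
        qed
        have Bj: "B n j = v ?b - v ?a - A" using B[OF j] by (simp add: A_def I_def)
        \<comment> \<open>An exact identity: the noise cancels and only the drift A of the cell
          remains, paired with v at the right end.\<close>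
        have "(norm (v ?b))\<^sup>2 - (norm (v ?a))\<^sup>2 - 2 * inner (v ?a) (B n j) - (norm (B n j))\<^sup>2 = 2 * inner (v ?b) A - (norm A)\<^sup>2"
          unfolding Bj by (simp add: power2_norm_eq_inner inner_diff_left inner_diff_right inner_commute)
        then have "?e n j \<le> 2 * \<bar>inner (v ?b) A\<bar> + (norm A)\<^sup>2"
          by (smt (verit) zero_le_power2)
        also have "(norm A)\<^sup>2 \<le> \<eta> * (H ?b - H ?a)"
          unfolding power2_eq_square using nA nA2 \<eta> by (intro mult_mono) auto
        finally show ?thesis using inA by linarith
      qed
      have "(\<Sum>j<Suc n. ?e n j) \<le> (\<Sum>j<Suc n. 3 * \<eta> * (H (grid 0 t n (Suc j)) - H (grid 0 t n j)))"
        by (rule sum_mono) (use ej in blast)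
      also have "\<dots> = 3 * \<eta> * (H t - H 0)"
        using sum_lessThan_telescope[of "\<lambda>j. H (grid 0 t n j)" "Suc n"] by (simp only: sum_distrib_left[symmetric] G)
      also have "\<dots> = 3 * \<eta> * H t" by (simp add: H_def)
      also have "\<dots> < r"
      proof -
        have "3 * \<eta> * H t \<le> 3 * \<eta> * (H t + 1)" using \<eta> by simp
        also have "\<dots> = 3 * r / 4" using Ht by (simp add: \<eta>_def field_simps)
        finally show ?thesis using \<open>0 < r\<close> by simp
      qed
      finally show ?thesis .
    qed
    moreover have "0 \<le> (\<Sum>j<Suc n. ?e n j)" for n by (rule sum_nonneg) simp
    ultimately show "\<exists>no. \<forall>n\<ge>no. norm ((\<Sum>j<Suc n. ?e n j) - 0) < r"
      by (intro exI[of _ N]) (simp del: sum.lessThan_Suc)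
  qed
qed

text \<open>Where E n is at most \<epsilon>, so is f - T n; elsewhere |T n| is at most 1/\<eta> +
  \<eta> (T n)^2. The bad part |f| + 1/\<eta> is integrable and vanishes in the mean by dominated
  convergence, the rest costs \<eta> C. This is uniform integrability of the T n, and it is what
  replaces integrability of the remainder E n.\<close>

lemma (in prob_space) expectation_nonpos_of_limit:
  fixes f :: "'a \<Rightarrow> real" and T E :: "nat \<Rightarrow> 'a \<Rightarrow> real"
  assumes f: "integrable M f"
    and T [measurable]: "\<And>n. T n \<in> borel_measurable M" and T2: "\<And>n. integrable M (\<lambda>\<omega>. (T n \<omega>)\<^sup>2)"
    and C: "\<And>n. (\<integral>\<omega>. (T n \<omega>)\<^sup>2 \<partial>M) \<le> C"
    and E [measurable]: "\<And>n. E n \<in> borel_measurable M"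
    and le: "\<And>n. AE \<omega> in M. f \<omega> - T n \<omega> \<le> E n \<omega>"
    and lim: "AE \<omega> in M. (\<lambda>n. E n \<omega>) \<longlonglongrightarrow> 0"
    and c: "\<And>n. (\<integral>\<omega>. f \<omega> - T n \<omega> \<partial>M) = c"
  shows "c \<le> 0"
proof -
  have [measurable]: "f \<in> borel_measurable M" using f by auto
  have T1: "integrable M (T n)" for n
    by (rule square_integrable_imp_integrable[OF T T2])
  have C0: "0 \<le> C" using C[of 0] by (rule order_trans[rotated]) simp
  have bound: "c \<le> \<epsilon> + \<eta> * C" if "0 < \<epsilon>" "0 < \<eta>" for \<epsilon> \<eta>
  proof -
    define K where "K \<omega> = \<bar>f \<omega>\<bar> + 1 / \<eta>" for \<omega>
    have K: "integrable M K" unfolding K_def using f by simp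
    then have [measurable]: "K \<in> borel_measurable M" by auto
    define A where "A n \<omega> = indicator {\<epsilon><..} (E n \<omega>) * K \<omega>" for n \<omega>
    have [measurable]: "A n \<in> borel_measurable M" for n unfolding A_def by measurable
    have K0: "0 \<le> K \<omega>" for \<omega> using that by (simp add: K_def)
    have AK: "\<bar>A n \<omega>\<bar> \<le> K \<omega>" for n \<omega> using K0 by (auto simp: A_def indicator_def)
    have Ai: "integrable M (A n)" for n
      by (rule Bochner_Integration.integrable_bound[OF K]) (use AK K0 in \<open>auto\<close>)
    have lA: "(\<lambda>n. \<integral>\<omega>. A n \<omega> \<partial>M) \<longlonglongrightarrow> (\<integral>\<omega>. 0 \<partial>M)"
    proof (rule Bochner_Integration.integral_dominated_convergence[OF _ _ K])
      show "AE \<omega> in M. (\<lambda>n. A n \<omega>) \<longlonglongrightarrow> 0"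
        using lim
      proof eventually_elim
        case (elim \<omega>)
        then have "eventually (\<lambda>n. E n \<omega> < \<epsilon>) sequentially" using that by (intro order_tendstoD) auto
        then have "eventually (\<lambda>n. A n \<omega> = 0) sequentially"
          by eventually_elim (simp add: A_def)
        then show ?case by (rule tendsto_eventually)
      qed
    qed (use AK in auto)
    have "c \<le> \<epsilon> + ((\<integral>\<omega>. A n \<omega> \<partial>M) + \<eta> * C)" for n
    proof -
      have "c \<le> (\<integral>\<omega>. \<epsilon> + (A n \<omega> + \<eta> * (T n \<omega>)\<^sup>2) \<partial>M)"
        unfolding c[of n, symmetric]
      proof (rule integral_mono_AE)
        show "integrable M (\<lambda>\<omega>. f \<omega> - T n \<omega>)" using f T1 by simp
        show "integrable M (\<lambda>\<omega>. \<epsilon> + (A n \<omega> + \<eta> * (T n \<omega>)\<^sup>2))" using Ai T2 by simp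
        show "AE \<omega> in M. f \<omega> - T n \<omega> \<le> \<epsilon> + (A n \<omega> + \<eta> * (T n \<omega>)\<^sup>2)"
          using le[of n]
        proof eventually_elim
          case (elim \<omega>)
          have t0: "0 \<le> \<eta> * (T n \<omega>)\<^sup>2" using that by simp
          show ?case
          proof (cases "E n \<omega> \<le> \<epsilon>")
            case True
            then have "A n \<omega> = 0" by (simp add: A_def)
            then show ?thesis using elim True t0 by linarith
          next
            case False
            then have "A n \<omega> = \<bar>f \<omega>\<bar> + 1 / \<eta>" by (simp add: A_def K_def)
            moreover have "\<bar>T n \<omega>\<bar> \<le> 1 / \<eta> + \<eta> * (T n \<omega>)\<^sup>2"
            proof -
              have "2 * (\<eta> * \<bar>T n \<omega>\<bar>) \<le> 1 + (\<eta> * \<bar>T n \<omega>\<bar>)\<^sup>2"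
                using sum_squares_bound[of 1 "\<eta> * \<bar>T n \<omega>\<bar>"] by simp
              moreover have "0 \<le> \<eta> * \<bar>T n \<omega>\<bar>" using that by simp
              ultimately have "\<eta> * \<bar>T n \<omega>\<bar> \<le> 1 + (\<eta> * \<bar>T n \<omega>\<bar>)\<^sup>2" by linarith
              then have "\<eta> * \<bar>T n \<omega>\<bar> \<le> \<eta> * (1 / \<eta> + \<eta> * (T n \<omega>)\<^sup>2)"
                using that by (simp add: distrib_left power_mult_distrib power2_eq_square[of \<eta>])
              then show ?thesis using that by (simp only: mult_le_cancel_left_pos)
            qed
            ultimately show ?thesis using that by linarith
          qed
        qed
      qed
      also have "\<dots> = \<epsilon> + ((\<integral>\<omega>. A n \<omega> \<partial>M) + \<eta> * (\<integral>\<omega>. (T n \<omega>)\<^sup>2 \<partial>M))"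
        using Ai T2 by (simp add: prob_space)
      also have "\<dots> \<le> \<epsilon> + ((\<integral>\<omega>. A n \<omega> \<partial>M) + \<eta> * C)"
        using C[of n] that by simp
      finally show ?thesis .
    qed
    moreover have "(\<lambda>n. \<epsilon> + ((\<integral>\<omega>. A n \<omega> \<partial>M) + \<eta> * C)) \<longlonglongrightarrow> \<epsilon> + (0 + \<eta> * C)"
      using lA by (intro tendsto_intros) simp
    ultimately have "c \<le> \<epsilon> + (0 + \<eta> * C)"
      by (intro LIMSEQ_le_const) auto
    then show ?thesis by simp
  qed
  have "c \<le> 0 + \<epsilon>" if "0 < \<epsilon>" for \<epsilon>
  proof -
    \<comment> \<open>Here \<eta> is \<epsilon> / 2 / (C + 1), so that \<eta> C stays below
      \<epsilon> / 2 even if C = 0.\<close>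
    have "c \<le> \<epsilon> / 2 + \<epsilon> / 2 / (C + 1) * C" using that C0 by (intro bound) auto
    also have "\<dots> \<le> \<epsilon> / 2 + \<epsilon> / 2" using that by (intro add_left_mono divide_Suc_mult_le C0) simp
    finally show ?thesis by simp
  qed
  then show ?thesis by (rule field_le_epsilon)
qed

context noise
begin

text \<open>The sum so far times the next weight is known at the start of the next cell, so the
  cross term in the square vanishes by \<open>increment_cross\<close>. Measurability at the last
  node is carried along for this reason.\<close>

lemma martingale_transform:
  fixes p :: "nat \<Rightarrow> real"
  assumes p0: "0 \<le> p 0"
    and D: "\<And>j. j < n \<Longrightarrow> increment 9 (p j) (p (Suc j)) (D j)"
    and X: "\<And>j. j < n \<Longrightarrow> X j \<in> borel_measurable (F (p j))"
    and X2: "\<And>j. j < n \<Longrightarrow> integrable M (\<lambda>\<omega>. (norm (X j \<omega>))\<^sup>2)"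
  shows "(\<lambda>\<omega>. \<Sum>j<n. inner (X j \<omega>) (D j \<omega>)) \<in> borel_measurable (F (p n))"
    and "integrable M (\<lambda>\<omega>. (\<Sum>j<n. inner (X j \<omega>) (D j \<omega>))\<^sup>2)"
    and "(\<integral>\<omega>. (\<Sum>j<n. inner (X j \<omega>) (D j \<omega>)) \<partial>M) = 0"
    and "(\<integral>\<omega>. (\<Sum>j<n. inner (X j \<omega>) (D j \<omega>))\<^sup>2 \<partial>M) \<le> (\<Sum>j<n. (p (Suc j) - p j) * \<kappa> * (\<integral>\<omega>. (norm (X j \<omega>))\<^sup>2 \<partial>M))"
proof -
  have "0 \<le> p n \<and> (\<lambda>\<omega>. \<Sum>j<n. inner (X j \<omega>) (D j \<omega>)) \<in> borel_measurable (F (p n))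
    \<and> integrable M (\<lambda>\<omega>. (\<Sum>j<n. inner (X j \<omega>) (D j \<omega>))\<^sup>2)
    \<and> (\<integral>\<omega>. (\<Sum>j<n. inner (X j \<omega>) (D j \<omega>)) \<partial>M) = 0
    \<and> (\<integral>\<omega>. (\<Sum>j<n. inner (X j \<omega>) (D j \<omega>))\<^sup>2 \<partial>M) \<le> (\<Sum>j<n. (p (Suc j) - p j) * \<kappa> * (\<integral>\<omega>. (norm (X j \<omega>))\<^sup>2 \<partial>M))"
    using D X X2
  proof (induction n)
    case 0
    then show ?case using p0 by simp
  next
    case (Suc n)
    define N where "N \<omega> = (\<Sum>j<n. inner (X j \<omega>) (D j \<omega>))" for \<omega>
    define d where "d \<omega> = inner (X n \<omega>) (D n \<omega>)" for \<omega>
    have Nd: "(\<Sum>j<Suc n. inner (X j \<omega>) (D j \<omega>)) = N \<omega> + d \<omega>" for \<omega> by (simp add: N_def d_def)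
    have IH: "0 \<le> p n" "N \<in> borel_measurable (F (p n))" "integrable M (\<lambda>\<omega>. (N \<omega>)\<^sup>2)" "(\<integral>\<omega>. N \<omega> \<partial>M) = 0"
      "(\<integral>\<omega>. (N \<omega>)\<^sup>2 \<partial>M) \<le> (\<Sum>j<n. (p (Suc j) - p j) * \<kappa> * (\<integral>\<omega>. (norm (X j \<omega>))\<^sup>2 \<partial>M))"
      using Suc unfolding N_def by auto
    have Dn: "increment 9 (p n) (p (Suc n)) (D n)" and Xn: "X n \<in> borel_measurable (F (p n))"
      and Xn2: "integrable M (\<lambda>\<omega>. (norm (X n \<omega>))\<^sup>2)" using Suc.prems by auto
    note T = increment_times[OF Dn]
    note NF [measurable] = IH(2) and XF [measurable] = Xn and DF [measurable] = increment_measurable_F[OF Dn]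
    have NM [measurable]: "N \<in> borel_measurable M" "X n \<in> borel_measurable M" "D n \<in> borel_measurable M"
      using measurable_F_M[OF IH(1) NF] measurable_F_M[OF IH(1) XF] increment_measurable[OF Dn] by auto
    have dM [measurable]: "d \<in> borel_measurable M" unfolding d_def by measurable
    have N'F: "N \<in> borel_measurable (F (p (Suc n)))" "X n \<in> borel_measurable (F (p (Suc n)))"
      using measurable_F_mono[OF IH(1) T(2) NF] measurable_F_mono[OF IH(1) T(2) XF] by auto
    have m: "(\<lambda>\<omega>. N \<omega> + d \<omega>) \<in> borel_measurable (F (p (Suc n)))"
      unfolding d_def using N'F by measurable
    note d2 = increment_cross_square[OF Dn XF Xn2, folded d_def]
    note d1 = increment_cross_L2[OF Dn XF Xn2, folded d_def]
    have iNd: "integrable M (\<lambda>\<omega>. N \<omega> * d \<omega>)"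
      using integrable_inner[OF NM(1) dM] IH(3) d2(1) by simp
    have "(\<lambda>\<omega>. N \<omega> *\<^sub>R X n \<omega>) \<in> borel_measurable (F (p n))" by measurable
    then have Nd0: "(\<integral>\<omega>. N \<omega> * d \<omega> \<partial>M) = 0"
      using increment_cross[OF Dn, of "\<lambda>\<omega>. N \<omega> *\<^sub>R X n \<omega>"] iNd by (simp add: d_def)
    have sq: "(N \<omega> + d \<omega>)\<^sup>2 = (N \<omega>)\<^sup>2 + (d \<omega>)\<^sup>2 + 2 * (N \<omega> * d \<omega>)" for \<omega>
      by (simp add: power2_sum)
    have iN: "integrable M N" by (rule square_integrable_imp_integrable[OF NM(1) IH(3)])
    have "(\<integral>\<omega>. (N \<omega> + d \<omega>)\<^sup>2 \<partial>M) = (\<integral>\<omega>. (N \<omega>)\<^sup>2 \<partial>M) + (\<integral>\<omega>. (d \<omega>)\<^sup>2 \<partial>M)"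
      unfolding sq using IH(3) d2(1) iNd Nd0 by simp
    moreover have "integrable M (\<lambda>\<omega>. (N \<omega> + d \<omega>)\<^sup>2)"
      unfolding sq using IH(3) d2(1) iNd by simp
    moreover have "(\<integral>\<omega>. N \<omega> + d \<omega> \<partial>M) = 0"
      using iN IH(4) d1 by simp
    ultimately show ?case
      unfolding Nd using T IH(5) d2(2) m by simp
  qed
  then show "(\<lambda>\<omega>. \<Sum>j<n. inner (X j \<omega>) (D j \<omega>)) \<in> borel_measurable (F (p n))"
    "integrable M (\<lambda>\<omega>. (\<Sum>j<n. inner (X j \<omega>) (D j \<omega>))\<^sup>2)"
    "(\<integral>\<omega>. (\<Sum>j<n. inner (X j \<omega>) (D j \<omega>)) \<partial>M) = 0"
    "(\<integral>\<omega>. (\<Sum>j<n. inner (X j \<omega>) (D j \<omega>))\<^sup>2 \<partial>M) \<le> (\<Sum>j<n. (p (Suc j) - p j) * \<kappa> * (\<integral>\<omega>. (norm (X j \<omega>))\<^sup>2 \<partial>M))"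
    by auto
qed

text \<open>Cauchy-Schwarz over the n + 1 cells, against fourth moments of order (t / (n + 1))^2,
  gives a bound free of n; this uniformity is what the kurtosis constant is for.\<close>

lemma quadratic_variation:
  assumes t: "0 \<le> t" and D: "\<And>j. j < Suc n \<Longrightarrow> increment 9 (grid 0 t n j) (grid 0 t n (Suc j)) (D j)"
  shows "integrable M (\<lambda>\<omega>. \<Sum>j<Suc n. (norm (D j \<omega>))\<^sup>2)"
    and "(\<integral>\<omega>. (\<Sum>j<Suc n. (norm (D j \<omega>))\<^sup>2) \<partial>M) = t * \<kappa>"
    and "integrable M (\<lambda>\<omega>. (\<Sum>j<Suc n. (norm (D j \<omega>))\<^sup>2)\<^sup>2)"
    and "(\<integral>\<omega>. (\<Sum>j<Suc n. (norm (D j \<omega>))\<^sup>2)\<^sup>2 \<partial>M) \<le> 9 * (t * \<kappa>)\<^sup>2"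
proof -
  have h: "grid 0 t n (Suc j) - grid 0 t n j = t / real (Suc n)" for j
    using grid_simps(5)[OF t] by simp
  have DM [measurable]: "D j \<in> borel_measurable M" if "j < Suc n" for j
    by (rule increment_measurable[OF D[OF that]])
  note sq = increment_square[OF D] and fo = increment_fourth[OF D]
  show "integrable M (\<lambda>\<omega>. \<Sum>j<Suc n. (norm (D j \<omega>))\<^sup>2)"
    by (intro Bochner_Integration.integrable_sum sq) simp
  have "(\<integral>\<omega>. (\<Sum>j<Suc n. (norm (D j \<omega>))\<^sup>2) \<partial>M) = (\<Sum>j<Suc n. \<integral>\<omega>. (norm (D j \<omega>))\<^sup>2 \<partial>M)"
    by (intro Bochner_Integration.integral_sum sq) simp
  also have "\<dots> = (\<Sum>j<Suc n. t / real (Suc n) * \<kappa>)"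
    using sq(2) by (intro sum.cong refl) (simp add: h)
  also have "\<dots> = t * \<kappa>" by (simp del: sum.lessThan_Suc)
  finally show "(\<integral>\<omega>. (\<Sum>j<Suc n. (norm (D j \<omega>))\<^sup>2) \<partial>M) = t * \<kappa>" .
  have le: "(\<Sum>j<Suc n. (norm (D j \<omega>))\<^sup>2)\<^sup>2 \<le> real (Suc n) * (\<Sum>j<Suc n. (norm (D j \<omega>)) ^ 4)" for \<omega>
    using sum_squared_le_sum_of_squares[of "\<lambda>j. (norm (D j \<omega>))\<^sup>2" "{..<Suc n}"]
    by (simp add: power_mult[symmetric] mult.commute del: sum.lessThan_Suc)
  have i4: "integrable M (\<lambda>\<omega>. real (Suc n) * (\<Sum>j<Suc n. (norm (D j \<omega>)) ^ 4))"
    by (intro integrable_mult_right Bochner_Integration.integrable_sum fo) simp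
  show iQ: "integrable M (\<lambda>\<omega>. (\<Sum>j<Suc n. (norm (D j \<omega>))\<^sup>2)\<^sup>2)"
  proof (rule Bochner_Integration.integrable_bound[OF i4])
    show "(\<lambda>\<omega>. (\<Sum>j<Suc n. (norm (D j \<omega>))\<^sup>2)\<^sup>2) \<in> borel_measurable M"
      by (intro borel_measurable_power borel_measurable_sum borel_measurable_norm DM borel_measurable_const) (auto intro: DM)
    show "AE \<omega> in M. norm ((\<Sum>j<Suc n. (norm (D j \<omega>))\<^sup>2)\<^sup>2) \<le> norm (real (Suc n) * (\<Sum>j<Suc n. (norm (D j \<omega>)) ^ 4))"
      using le by (auto intro!: AE_I2 order_trans[OF _ abs_ge_self] simp del: sum.lessThan_Suc)
  qed
  have "(\<integral>\<omega>. (\<Sum>j<Suc n. (norm (D j \<omega>))\<^sup>2)\<^sup>2 \<partial>M) \<le> (\<integral>\<omega>. real (Suc n) * (\<Sum>j<Suc n. (norm (D j \<omega>)) ^ 4) \<partial>M)"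
    by (rule integral_mono[OF iQ i4 le])
  also have "\<dots> = real (Suc n) * (\<integral>\<omega>. (\<Sum>j<Suc n. (norm (D j \<omega>)) ^ 4) \<partial>M)"
    by (rule integral_mult_right_zero)
  also have "(\<integral>\<omega>. (\<Sum>j<Suc n. (norm (D j \<omega>)) ^ 4) \<partial>M) = (\<Sum>j<Suc n. \<integral>\<omega>. (norm (D j \<omega>)) ^ 4 \<partial>M)"
    by (intro Bochner_Integration.integral_sum fo) simp
  also have "real (Suc n) * \<dots> \<le> real (Suc n) * (\<Sum>j<Suc n. 9 * (t / real (Suc n) * \<kappa>)\<^sup>2)"
    using fo(2) by (intro mult_left_mono sum_mono) (auto simp: h)
  also have "\<dots> = 9 * (t * \<kappa>)\<^sup>2"
  proof -
    have "N * (N * (9 * (t / N * \<kappa>)\<^sup>2)) = 9 * (t * \<kappa>)\<^sup>2" if "N \<noteq> 0" for N :: real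
      using that by (simp add: power2_eq_square)
    from this[of "real (Suc n)"] show ?thesis by (simp del: of_nat_Suc sum.lessThan_Suc)
  qed
  finally show "(\<integral>\<omega>. (\<Sum>j<Suc n. (norm (D j \<omega>))\<^sup>2)\<^sup>2 \<partial>M) \<le> 9 * (t * \<kappa>)\<^sup>2" .
qed

end

text \<open>A concave function lies below its tangents; 1 / (1 + \<delta> x)^2 is the derivative at
  x.\<close>

lemma damped_concave:
  fixes x y \<delta> :: real
  assumes "0 \<le> x" "0 \<le> y" "0 < \<delta>"
  shows "y / (1 + \<delta> * y) - x / (1 + \<delta> * x) \<le> (y - x) / (1 + \<delta> * x)\<^sup>2"
proof -
  have p: "0 < 1 + \<delta> * x" "0 < 1 + \<delta> * y" using assms by (simp_all add: add_pos_nonneg)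
  have "y / (1 + \<delta> * y) - x / (1 + \<delta> * x) = (y - x) / ((1 + \<delta> * x) * (1 + \<delta> * y))"
    using p by (subst diff_frac_eq) (auto simp: algebra_simps)
  also have "\<dots> \<le> (y - x) / (1 + \<delta> * x)\<^sup>2"
  proof (cases "x \<le> y")
    case True
    then have "(1 + \<delta> * x)\<^sup>2 \<le> (1 + \<delta> * x) * (1 + \<delta> * y)"
      unfolding power2_eq_square using p assms by (intro mult_left_mono) auto
    then show ?thesis using True p by (intro divide_left_mono) auto
  next
    case False
    then have "(1 + \<delta> * x) * (1 + \<delta> * y) \<le> (1 + \<delta> * x)\<^sup>2"
      unfolding power2_eq_square using p assms by (intro mult_left_mono) auto
    then show ?thesis using False p by (intro divide_left_mono_neg) auto
  qed
  finally show ?thesis .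
qed

text \<open>The last bound concerns the squared norm of v weighted by the derivative: such weights
  are bounded whatever the moments of v.\<close>

lemma damped_bounds:
  fixes x \<delta> :: real
  assumes "0 \<le> x" "0 < \<delta>"
  shows "0 \<le> x / (1 + \<delta> * x)" "x / (1 + \<delta> * x) \<le> 1 / \<delta>" "x / (1 + \<delta> * x) \<le> x"
    and "0 \<le> 1 / (1 + \<delta> * x)\<^sup>2" "1 / (1 + \<delta> * x)\<^sup>2 \<le> 1" "(1 / (1 + \<delta> * x)\<^sup>2)\<^sup>2 * x \<le> 1 / \<delta>"
proof -
  have p: "1 \<le> 1 + \<delta> * x" using assms by simp
  then have p0: "0 < 1 + \<delta> * x" by linarith
  show a: "0 \<le> x / (1 + \<delta> * x)" using assms p0 by simp
  show b: "x / (1 + \<delta> * x) \<le> 1 / \<delta>" using assms p0 by (simp add: field_simps)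
  show "x / (1 + \<delta> * x) \<le> x" using mult_left_mono[OF p assms(1)] by (intro mult_imp_div_pos_le[OF p0]) simp
  show "0 \<le> 1 / (1 + \<delta> * x)\<^sup>2" by simp
  show c: "1 / (1 + \<delta> * x)\<^sup>2 \<le> 1" using p by (simp add: divide_le_eq one_le_power)
  have c3: "1 / (1 + \<delta> * x) ^ 3 \<le> 1" using p by (simp add: divide_le_eq one_le_power)
  have "(1 / (1 + \<delta> * x)\<^sup>2)\<^sup>2 * x = 1 / (1 + \<delta> * x) ^ 3 * (x / (1 + \<delta> * x))"
    by (simp add: power2_eq_square power3_eq_cube)
  also have "\<dots> \<le> 1 * (1 / \<delta>)" using a b c3 p0 by (intro mult_mono) auto
  finally show "(1 / (1 + \<delta> * x)\<^sup>2)\<^sup>2 * x \<le> 1 / \<delta>" by simp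
qed

section \<open>Mass balance of an adapted process with vanishing second-order remainder\<close>

context noise
begin

context
  fixes v :: "real \<Rightarrow> 'a \<Rightarrow> 'n l2_torus" and D :: "real \<Rightarrow> nat \<Rightarrow> nat \<Rightarrow> 'a \<Rightarrow> 'n l2_torus"
  assumes vF: "\<And>t. 0 \<le> t \<Longrightarrow> v t \<in> borel_measurable (F t)"
    and v0: "integrable M (\<lambda>\<omega>. (norm (v 0 \<omega>))\<^sup>2)"
    and D: "\<And>t n j. 0 \<le> t \<Longrightarrow> j < Suc n \<Longrightarrow> increment 9 (grid 0 t n j) (grid 0 t n (Suc j)) (D t n j)"
    and remainder: "\<And>t. 0 \<le> t \<Longrightarrow> AE \<omega> in M. (\<lambda>n. \<Sum>j<Suc n.
      \<bar>(norm (v (grid 0 t n (Suc j)) \<omega>))\<^sup>2 - (norm (v (grid 0 t n j) \<omega>))\<^sup>2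
        - 2 * inner (v (grid 0 t n j) \<omega>) (D t n j \<omega>) - (norm (D t n j \<omega>))\<^sup>2\<bar>) \<longlonglongrightarrow> 0"
begin

lemma v_measurable: "0 \<le> t \<Longrightarrow> v t \<in> borel_measurable M"
  using vF measurable_F_M by blast

lemma remainder_measurable:
  assumes t: "0 \<le> t"
  shows "(\<lambda>\<omega>. \<Sum>j<Suc n. \<bar>(norm (v (grid 0 t n (Suc j)) \<omega>))\<^sup>2 - (norm (v (grid 0 t n j) \<omega>))\<^sup>2
        - 2 * inner (v (grid 0 t n j) \<omega>) (D t n j \<omega>) - (norm (D t n j \<omega>))\<^sup>2\<bar>) \<in> borel_measurable M"
proof (intro borel_measurable_sum)
  fix j assume "j \<in> {..<Suc n}"
  then have [measurable]: "D t n j \<in> borel_measurable M" using increment_measurable[OF D[OF t]] by blast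
  have [measurable]: "v (grid 0 t n j) \<in> borel_measurable M" "v (grid 0 t n (Suc j)) \<in> borel_measurable M"
    using v_measurable[OF grid_simps(4)[OF t]] by auto
  show "(\<lambda>\<omega>. \<bar>(norm (v (grid 0 t n (Suc j)) \<omega>))\<^sup>2 - (norm (v (grid 0 t n j) \<omega>))\<^sup>2
        - 2 * inner (v (grid 0 t n j) \<omega>) (D t n j \<omega>) - (norm (D t n j \<omega>))\<^sup>2\<bar>) \<in> borel_measurable M"
    by measurable
qed

text \<open>Martingale part and quadratic variation together have a known mean and a second moment
  bounded uniformly over the grids. It is applied with damped weights first, and with v itself once
  its mass is known to be integrable.\<close>

lemma grid_noise_terms:
  fixes X :: "nat \<Rightarrow> 'a \<Rightarrow> 'n l2_torus"
  assumes t: "0 \<le> t" and XF: "\<And>j. X j \<in> borel_measurable (F (grid 0 t n j))"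
    and X2: "\<And>j. integrable M (\<lambda>\<omega>. (norm (X j \<omega>))\<^sup>2)"
    and EX2: "\<And>j. j < Suc n \<Longrightarrow> (\<integral>\<omega>. (norm (X j \<omega>))\<^sup>2 \<partial>M) \<le> R"
  defines "T \<equiv> \<lambda>\<omega>. 2 * (\<Sum>j<Suc n. inner (X j \<omega>) (D t n j \<omega>)) + (\<Sum>j<Suc n. (norm (D t n j \<omega>))\<^sup>2)"
  shows "T \<in> borel_measurable M" and "integrable M T" and "(\<integral>\<omega>. T \<omega> \<partial>M) = t * \<kappa>"
    and "integrable M (\<lambda>\<omega>. (T \<omega>)\<^sup>2)" and "(\<integral>\<omega>. (T \<omega>)\<^sup>2 \<partial>M) \<le> 8 * (t * \<kappa> * R) + 2 * (9 * (t * \<kappa>)\<^sup>2)"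
proof -
  note G = grid_simps[OF t]
  define N where "N \<omega> = (\<Sum>j<Suc n. inner (X j \<omega>) (D t n j \<omega>))" for \<omega>
  define Q where "Q \<omega> = (\<Sum>j<Suc n. (norm (D t n j \<omega>))\<^sup>2)" for \<omega>
  have T: "T = (\<lambda>\<omega>. 2 * N \<omega> + Q \<omega>)" by (simp only: T_def N_def Q_def)
  have pos: "0 \<le> grid 0 t n 0" using G by simp
  note mt = martingale_transform[where p = "grid 0 t n" and n = "Suc n", OF pos D[OF t] XF X2, folded N_def]
  note qv = quadratic_variation[OF t D[OF t], of n, folded Q_def]
  have NM [measurable]: "N \<in> borel_measurable M"
    using measurable_F_M[OF _ mt(1)] t G(2) by simp
  have QM [measurable]: "Q \<in> borel_measurable M" using qv(1) by auto
  have iN: "integrable M N" by (rule square_integrable_imp_integrable[OF NM mt(2)])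
  show TM: "T \<in> borel_measurable M" unfolding T by measurable
  show "integrable M T" "(\<integral>\<omega>. T \<omega> \<partial>M) = t * \<kappa>"
    unfolding T using iN qv(1,2) mt(3) by simp_all
  have "(\<integral>\<omega>. (N \<omega>)\<^sup>2 \<partial>M) \<le> (\<Sum>j<Suc n. (grid 0 t n (Suc j) - grid 0 t n j) * \<kappa> * (\<integral>\<omega>. (norm (X j \<omega>))\<^sup>2 \<partial>M))"
    by (rule mt(4))
  also have "\<dots> \<le> (\<Sum>j<Suc n. t / real (Suc n) * \<kappa> * R)"
    unfolding G(5) using t \<kappa>_nonneg by (intro sum_mono mult_mono EX2) auto
  also have "\<dots> = t * \<kappa> * R" by (simp del: sum.lessThan_Suc)
  finally have EN2: "(\<integral>\<omega>. (N \<omega>)\<^sup>2 \<partial>M) \<le> t * \<kappa> * R" .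
  have le: "(T \<omega>)\<^sup>2 \<le> 8 * (N \<omega>)\<^sup>2 + 2 * (Q \<omega>)\<^sup>2" for \<omega>
    using norm_add_square_le[of "2 * N \<omega>" "Q \<omega>"] by (simp add: T power_mult_distrib)
  have i: "integrable M (\<lambda>\<omega>. 8 * (N \<omega>)\<^sup>2 + 2 * (Q \<omega>)\<^sup>2)"
    using mt(2) qv(3) by simp
  show iT: "integrable M (\<lambda>\<omega>. (T \<omega>)\<^sup>2)"
    by (rule Bochner_Integration.integrable_bound[OF i]) (use le TM in auto)
  have "(\<integral>\<omega>. (T \<omega>)\<^sup>2 \<partial>M) \<le> (\<integral>\<omega>. 8 * (N \<omega>)\<^sup>2 + 2 * (Q \<omega>)\<^sup>2 \<partial>M)"
    by (rule integral_mono[OF iT i le])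
  also have "\<dots> = 8 * (\<integral>\<omega>. (N \<omega>)\<^sup>2 \<partial>M) + 2 * (\<integral>\<omega>. (Q \<omega>)\<^sup>2 \<partial>M)"
    using mt(2) qv(3) by simp
  also have "\<dots> \<le> 8 * (t * \<kappa> * R) + 2 * (9 * (t * \<kappa>)\<^sup>2)"
    by (intro add_mono mult_left_mono EN2 qv(4)) auto
  finally show "(\<integral>\<omega>. (T \<omega>)\<^sup>2 \<partial>M) \<le> 8 * (t * \<kappa> * R) + 2 * (9 * (t * \<kappa>)\<^sup>2)" .
qed

text \<open>
  The concave function $x \mapsto x / (1 + \delta x)$ of the mass has bounded martingale part, which replaces
  localisation by stopping times.
\<close>

lemma damped_mass_le:
  assumes t: "0 \<le> t" and \<delta>: "0 < \<delta>"
  shows "(\<integral>\<omega>. (norm (v t \<omega>))\<^sup>2 / (1 + \<delta> * (norm (v t \<omega>))\<^sup>2) \<partial>M) \<le> (\<integral>\<omega>. (norm (v 0 \<omega>))\<^sup>2 \<partial>M) + t * \<kappa>"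
proof -
  define m where "m s \<omega> = (norm (v s \<omega>))\<^sup>2" for s \<omega>
  define \<phi> where "\<phi> x = x / (1 + \<delta> * x)" for x
  define w where "w x = 1 / (1 + \<delta> * x)\<^sup>2" for x
  have m0: "0 \<le> m s \<omega>" for s \<omega> by (simp add: m_def)
  have mM [measurable]: "m s \<in> borel_measurable M" if "0 \<le> s" for s
    unfolding m_def using v_measurable[OF that] by measurable
  have \<phi>m [measurable]: "\<phi> \<in> borel_measurable borel" and wm [measurable]: "w \<in> borel_measurable borel"
    unfolding \<phi>_def w_def by measurable
  have b\<phi>: "0 \<le> \<phi> (m s \<omega>)" "\<phi> (m s \<omega>) \<le> 1 / \<delta>" "\<phi> (m s \<omega>) \<le> m s \<omega>" for s \<omega>
    unfolding \<phi>_def using damped_bounds(1-3)[OF m0 \<delta>] by auto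
  have bw: "0 \<le> w (m s \<omega>)" "w (m s \<omega>) \<le> 1" "(w (m s \<omega>))\<^sup>2 * m s \<omega> \<le> 1 / \<delta>" for s \<omega>
    unfolding w_def using damped_bounds(4-6)[OF m0 \<delta>] by auto
  have i\<phi>: "integrable M (\<lambda>\<omega>. \<phi> (m s \<omega>))" if "0 \<le> s" for s
  proof (rule integrable_const_bound[where B = "1 / \<delta>"])
    show "(\<lambda>\<omega>. \<phi> (m s \<omega>)) \<in> borel_measurable M" using mM[OF that] by measurable
  qed (use b\<phi> in auto)
  note G = grid_simps[OF t]
  \<comment> \<open>Derivative of the damped function times v, the weight that the tangent
    inequality puts on the noise.\<close>
  define X where "X n j \<omega> = w (m (grid 0 t n j) \<omega>) *\<^sub>R v (grid 0 t n j) \<omega>" for n j \<omega>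
  have XF: "X n j \<in> borel_measurable (F (grid 0 t n j))" for n j
  proof -
    have [measurable]: "v (grid 0 t n j) \<in> borel_measurable (F (grid 0 t n j))" by (rule vF[OF G(4)])
    show ?thesis unfolding X_def m_def by measurable
  qed
  have XM: "X n j \<in> borel_measurable M" for n j using measurable_F_M[OF G(4) XF] .
  have nX: "(norm (X n j \<omega>))\<^sup>2 \<le> 1 / \<delta>" for n j \<omega>
    using bw(3)[of "grid 0 t n j" \<omega>] by (simp add: X_def power_mult_distrib m_def)
  have X2: "integrable M (\<lambda>\<omega>. (norm (X n j \<omega>))\<^sup>2)" for n j
  proof (rule integrable_const_bound[where B = "1 / \<delta>"])
    show "(\<lambda>\<omega>. (norm (X n j \<omega>))\<^sup>2) \<in> borel_measurable M" using XM by measurable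
  qed (use nX in auto)
  have EX2: "(\<integral>\<omega>. (norm (X n j \<omega>))\<^sup>2 \<partial>M) \<le> 1 / \<delta>" for n j
    by (rule integral_le_const[OF X2]) (use nX in auto)
  define T where "T n \<omega> = 2 * (\<Sum>j<Suc n. inner (X n j \<omega>) (D t n j \<omega>)) + (\<Sum>j<Suc n. (norm (D t n j \<omega>))\<^sup>2)" for n \<omega>
  note T = grid_noise_terms[where X = "\<lambda>j. X n j" and n = n for n, OF t XF X2 EX2, folded T_def]
  define E where "E n \<omega> = (\<Sum>j<Suc n. \<bar>m (grid 0 t n (Suc j)) \<omega> - m (grid 0 t n j) \<omega>
        - 2 * inner (v (grid 0 t n j) \<omega>) (D t n j \<omega>) - (norm (D t n j \<omega>))\<^sup>2\<bar>)" for n \<omega>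
  have EM: "E n \<in> borel_measurable M" for n
    unfolding E_def m_def by (rule remainder_measurable[OF t])
  have lim: "AE \<omega> in M. (\<lambda>n. E n \<omega>) \<longlonglongrightarrow> 0"
    unfolding E_def m_def by (rule remainder[OF t])
  define f where "f \<omega> = \<phi> (m t \<omega>) - \<phi> (m 0 \<omega>)" for \<omega>
  have if_: "integrable M f" unfolding f_def using i\<phi> t by simp
  have le: "f \<omega> - T n \<omega> \<le> E n \<omega>" for n \<omega>
  proof -
    have "f \<omega> = (\<Sum>j<Suc n. \<phi> (m (grid 0 t n (Suc j)) \<omega>) - \<phi> (m (grid 0 t n j) \<omega>))"
      using sum_lessThan_telescope[of "\<lambda>j. \<phi> (m (grid 0 t n j) \<omega>)" "Suc n"] by (simp only: f_def G)
    also have "\<dots> \<le> (\<Sum>j<Suc n. 2 * inner (X n j \<omega>) (D t n j \<omega>) + (norm (D t n j \<omega>))\<^sup>2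
        + \<bar>m (grid 0 t n (Suc j)) \<omega> - m (grid 0 t n j) \<omega>
        - 2 * inner (v (grid 0 t n j) \<omega>) (D t n j \<omega>) - (norm (D t n j \<omega>))\<^sup>2\<bar>)"
    proof (rule sum_mono)
      fix j
      let ?x = "m (grid 0 t n j) \<omega>" and ?y = "m (grid 0 t n (Suc j)) \<omega>"
      let ?i = "2 * inner (v (grid 0 t n j) \<omega>) (D t n j \<omega>)" and ?q = "(norm (D t n j \<omega>))\<^sup>2"
      have "\<phi> ?y - \<phi> ?x \<le> (?y - ?x) * w ?x"
        using damped_concave[OF m0 m0 \<delta>] by (simp add: \<phi>_def w_def)
      also have "\<dots> = w ?x * ?i + w ?x * ?q + w ?x * (?y - ?x - ?i - ?q)"
        by (simp add: algebra_simps)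
      also have "\<dots> \<le> w ?x * ?i + ?q + \<bar>?y - ?x - ?i - ?q\<bar>"
      proof (intro add_mono order_refl)
        \<comment> \<open>A weight of at most 1 lets the quadratic variation be taken undamped, at
          the price of an inequality; the mean of the undamped term is known exactly.\<close>
        show "w ?x * ?q \<le> ?q" using bw by (intro mult_left_le_one_le) auto
        have "w ?x * (?y - ?x - ?i - ?q) \<le> w ?x * \<bar>?y - ?x - ?i - ?q\<bar>"
          using bw by (intro mult_left_mono) auto
        also have "\<dots> \<le> \<bar>?y - ?x - ?i - ?q\<bar>" using bw by (intro mult_left_le_one_le) auto
        finally show "w ?x * (?y - ?x - ?i - ?q) \<le> \<bar>?y - ?x - ?i - ?q\<bar>" .
      qed
      finally show "\<phi> ?y - \<phi> ?x \<le> 2 * inner (X n j \<omega>) (D t n j \<omega>) + ?q + \<bar>?y - ?x - ?i - ?q\<bar>"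
        by (simp add: X_def)
    qed
    also have "\<dots> = T n \<omega> + E n \<omega>"
      by (simp only: T_def E_def sum.distrib sum_distrib_left)
    finally show ?thesis by simp
  qed
  have c: "(\<integral>\<omega>. f \<omega> - T n \<omega> \<partial>M) = (\<integral>\<omega>. \<phi> (m t \<omega>) \<partial>M) - (\<integral>\<omega>. \<phi> (m 0 \<omega>) \<partial>M) - t * \<kappa>" for n
    using i\<phi>[OF t] i\<phi>[OF order_refl] T(2,3)[of n] by (simp add: f_def)
  have "(\<integral>\<omega>. \<phi> (m t \<omega>) \<partial>M) - (\<integral>\<omega>. \<phi> (m 0 \<omega>) \<partial>M) - t * \<kappa> \<le> 0"
    by (rule expectation_nonpos_of_limit[OF if_ T(1,4,5) EM _ lim c]) (use le in auto)
  moreover have "(\<integral>\<omega>. \<phi> (m 0 \<omega>) \<partial>M) \<le> (\<integral>\<omega>. m 0 \<omega> \<partial>M)"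
    using v0 b\<phi>(3) by (intro integral_mono i\<phi>) (auto simp: m_def)
  ultimately show ?thesis by (simp add: \<phi>_def m_def)
qed

text \<open>As \<delta> = 1 / (k + 1) tends to 0, the damped masses converge pointwise to the mass,
  and Fatou carries the bound over.\<close>

lemma mass_le:
  assumes t: "0 \<le> t"
  shows "integrable M (\<lambda>\<omega>. (norm (v t \<omega>))\<^sup>2)"
    and "(\<integral>\<omega>. (norm (v t \<omega>))\<^sup>2 \<partial>M) \<le> (\<integral>\<omega>. (norm (v 0 \<omega>))\<^sup>2 \<partial>M) + t * \<kappa>"
proof -
  let ?c = "(\<integral>\<omega>. (norm (v 0 \<omega>))\<^sup>2 \<partial>M) + t * \<kappa>"
  have c0: "0 \<le> ?c" using t \<kappa>_nonneg by simp
  have [measurable]: "v t \<in> borel_measurable M" by (rule v_measurable[OF t])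
  define \<phi> where "\<phi> k x = x / (1 + inverse (real (Suc k)) * x)" for k x
  have bd: "0 \<le> \<phi> k ((norm (v t \<omega>))\<^sup>2)" "\<phi> k ((norm (v t \<omega>))\<^sup>2) \<le> real (Suc k)" for k \<omega>
    unfolding \<phi>_def using damped_bounds(1,2)[of "(norm (v t \<omega>))\<^sup>2" "inverse (real (Suc k))"]
    by (auto simp: divide_inverse simp del: of_nat_Suc)
  have [measurable]: "\<phi> k \<in> borel_measurable borel" for k unfolding \<phi>_def by measurable
  have int: "integrable M (\<lambda>\<omega>. \<phi> k ((norm (v t \<omega>))\<^sup>2))" for k
    by (rule integrable_const_bound[where B = "real (Suc k)"]) (use bd in auto)
  have "(\<integral>\<^sup>+\<omega>. ennreal ((norm (v t \<omega>))\<^sup>2) \<partial>M) = (\<integral>\<^sup>+\<omega>. liminf (\<lambda>k. ennreal (\<phi> k ((norm (v t \<omega>))\<^sup>2))) \<partial>M)"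
  proof (rule nn_integral_cong)
    fix \<omega>
    let ?x = "(norm (v t \<omega>))\<^sup>2"
    have "(\<lambda>k. ennreal (\<phi> k ?x)) \<longlonglongrightarrow> ennreal (?x / (1 + 0 * ?x))"
      unfolding \<phi>_def by (intro tendsto_intros LIMSEQ_inverse_real_of_nat) simp
    then show "ennreal ?x = liminf (\<lambda>k. ennreal (\<phi> k ?x))"
      by (intro lim_imp_Liminf[symmetric]) simp_all
  qed
  also have "\<dots> \<le> liminf (\<lambda>k. \<integral>\<^sup>+\<omega>. ennreal (\<phi> k ((norm (v t \<omega>))\<^sup>2)) \<partial>M)"
    by (intro nn_integral_liminf) measurable
  also have "\<dots> \<le> liminf (\<lambda>k :: nat. ennreal ?c)"
  proof (intro Liminf_mono always_eventually allI)
    fix k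
    have "(\<integral>\<omega>. \<phi> k ((norm (v t \<omega>))\<^sup>2) \<partial>M) \<le> ?c"
      unfolding \<phi>_def by (rule damped_mass_le[OF t]) simp
    then show "(\<integral>\<^sup>+\<omega>. ennreal (\<phi> k ((norm (v t \<omega>))\<^sup>2)) \<partial>M) \<le> ennreal ?c"
      using nn_integral_eq_integral[OF int[of k]] bd(1) by (simp add: ennreal_leI)
  qed
  also have "\<dots> = ennreal ?c" by (simp add: Liminf_const)
  finally have *: "(\<integral>\<^sup>+\<omega>. ennreal ((norm (v t \<omega>))\<^sup>2) \<partial>M) \<le> ennreal ?c" .
  show "integrable M (\<lambda>\<omega>. (norm (v t \<omega>))\<^sup>2)" "(\<integral>\<omega>. (norm (v t \<omega>))\<^sup>2 \<partial>M) \<le> ?c"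
    using integrable_of_nn_integral_le[OF _ _ *] c0 by auto
qed

text \<open>For the missing inequality the limit argument is run with reversed signs. The noise
  terms now carry the undamped weight v; they are bounded in L^2(Omega) because
  \<open>mass_le\<close> bounds its second moment by the same R at all grid times up to t.\<close>

lemma mass_balance:
  assumes t: "0 \<le> t"
  shows "(\<integral>\<omega>. (norm (v t \<omega>))\<^sup>2 \<partial>M) = (\<integral>\<omega>. (norm (v 0 \<omega>))\<^sup>2 \<partial>M) + t * \<kappa>"
proof (rule antisym[OF mass_le(2)[OF t]])
  define m where "m s \<omega> = (norm (v s \<omega>))\<^sup>2" for s \<omega>
  note G = grid_simps[OF t]
  define R where "R = (\<integral>\<omega>. (norm (v 0 \<omega>))\<^sup>2 \<partial>M) + t * \<kappa>"
  have XF: "v (grid 0 t n j) \<in> borel_measurable (F (grid 0 t n j))" for n j by (rule vF[OF G(4)])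
  have X2: "integrable M (\<lambda>\<omega>. (norm (v (grid 0 t n j) \<omega>))\<^sup>2)" for n j by (rule mass_le(1)[OF G(4)])
  have EX2: "(\<integral>\<omega>. (norm (v (grid 0 t n j) \<omega>))\<^sup>2 \<partial>M) \<le> R" if "j < Suc n" for n j
  proof -
    have "real j / real (Suc n) * t \<le> 1 * t" using that t by (intro mult_right_mono) auto
    then have "grid 0 t n j * \<kappa> \<le> t * \<kappa>" using \<kappa>_nonneg by (intro mult_right_mono) (auto simp: grid_def)
    then show ?thesis using mass_le(2)[OF G(4), of n j] by (simp add: R_def)
  qed
  define T where "T n \<omega> = 2 * (\<Sum>j<Suc n. inner (v (grid 0 t n j) \<omega>) (D t n j \<omega>)) + (\<Sum>j<Suc n. (norm (D t n j \<omega>))\<^sup>2)" for n \<omega>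
  note T = grid_noise_terms[where X = "\<lambda>j. v (grid 0 t n j)" and n = n for n, OF t XF X2 EX2, folded T_def]
  define E where "E n \<omega> = (\<Sum>j<Suc n. \<bar>m (grid 0 t n (Suc j)) \<omega> - m (grid 0 t n j) \<omega>
        - 2 * inner (v (grid 0 t n j) \<omega>) (D t n j \<omega>) - (norm (D t n j \<omega>))\<^sup>2\<bar>)" for n \<omega>
  have EM: "E n \<in> borel_measurable M" for n
    unfolding E_def m_def by (rule remainder_measurable[OF t])
  have lim: "AE \<omega> in M. (\<lambda>n. E n \<omega>) \<longlonglongrightarrow> 0"
    unfolding E_def m_def by (rule remainder[OF t])
  define f where "f \<omega> = - (m t \<omega> - m 0 \<omega>)" for \<omega>
  have im: "integrable M (m t)" "integrable M (m 0)"
    unfolding m_def using mass_le(1)[OF t] v0 by auto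
  have if_: "integrable M f" unfolding f_def using im by simp
  have le: "f \<omega> - - T n \<omega> \<le> E n \<omega>" for n \<omega>
  proof -
    have "f \<omega> = - (\<Sum>j<Suc n. m (grid 0 t n (Suc j)) \<omega> - m (grid 0 t n j) \<omega>)"
      using sum_lessThan_telescope[of "\<lambda>j. m (grid 0 t n j) \<omega>" "Suc n"] by (simp only: f_def G)
    also have "\<dots> = - T n \<omega> + (\<Sum>j<Suc n. - (m (grid 0 t n (Suc j)) \<omega> - m (grid 0 t n j) \<omega>
        - 2 * inner (v (grid 0 t n j) \<omega>) (D t n j \<omega>) - (norm (D t n j \<omega>))\<^sup>2))"
      unfolding T_def sum_distrib_left sum.distrib[symmetric] sum_negf[symmetric]
      by (rule sum.cong[OF refl]) simp
    also have "\<dots> \<le> - T n \<omega> + E n \<omega>"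
      unfolding E_def by (intro add_left_mono sum_mono) (rule abs_ge_minus_self)
    finally show ?thesis by simp
  qed
  have c: "(\<integral>\<omega>. f \<omega> - - T n \<omega> \<partial>M) = - ((\<integral>\<omega>. m t \<omega> \<partial>M) - (\<integral>\<omega>. m 0 \<omega> \<partial>M)) + t * \<kappa>" for n
    using im T(2,3)[of n] by (simp add: f_def)
  have T': "(\<lambda>\<omega>. - T n \<omega>) \<in> borel_measurable M" "integrable M (\<lambda>\<omega>. (- T n \<omega>)\<^sup>2)"
    "(\<integral>\<omega>. (- T n \<omega>)\<^sup>2 \<partial>M) \<le> 8 * (t * \<kappa> * R) + 2 * (9 * (t * \<kappa>)\<^sup>2)" for n
    using T(1,4,5)[of n] by simp_all
  have "- ((\<integral>\<omega>. m t \<omega> \<partial>M) - (\<integral>\<omega>. m 0 \<omega> \<partial>M)) + t * \<kappa> \<le> 0"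
    by (rule expectation_nonpos_of_limit[OF if_ T' EM _ lim c]) (use le in auto)
  then show "(\<integral>\<omega>. (norm (v 0 \<omega>))\<^sup>2 \<partial>M) + t * \<kappa> \<le> (\<integral>\<omega>. (norm (v t \<omega>))\<^sup>2 \<partial>M)"
    by (simp add: m_def)
qed

end

end

section \<open>The trace formulas\<close>

lemma measurable_schroedinger_comp:
  assumes "f \<in> borel_measurable M" "\<theta> \<in> borel_measurable M"
  shows "(\<lambda>s. schroedinger_group (\<theta> s) (f s)) \<in> borel_measurable M"
  using borel_measurable_continuous_Pair[OF assms(2,1), of schroedinger_group] continuous_on_schroedinger
  by (simp add: case_prod_unfold)

lemma set_integrable_schroedinger:
  assumes f: "set_integrable lebesgue A f"
  shows "set_integrable lebesgue A (\<lambda>s. schroedinger_group (c - s) (f s))"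
proof -
  have eq: "indicator A s *\<^sub>R schroedinger_group (c - s) (f s) = schroedinger_group (c - s) (indicator A s *\<^sub>R f s)" for s
    by (simp add: linear_scale[OF linear_schroedinger])
  have m: "(\<lambda>s. indicator A s *\<^sub>R f s) \<in> borel_measurable lebesgue"
    using f by (simp add: set_integrable_def)
  have "(\<lambda>s. c - s) \<in> borel_measurable lebesgue"
    by (intro measurable_completion) measurable
  then show ?thesis
    unfolding set_integrable_def eq
    by (intro Bochner_Integration.integrable_bound[OF f[unfolded set_integrable_def]] measurable_schroedinger_comp m) auto
qed

lemma bounded_linear_set_integral:
  assumes "bounded_linear R" "set_integrable N A f"
  shows "R (LINT s:A|N. f s) = (LINT s:A|N. R (f s))"
  using integral_bounded_linear[OF assms(1) assms(2)[unfolded set_integrable_def]] assms(1)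
  by (simp add: set_lebesgue_integral_def linear_scale bounded_linear.linear)

context noise
begin

text \<open>All nodes of a partition of [0, 0] are 0, so every step integral vanishes. This
  identifies v at time 0 with the initial value, as Z 0 is given only as a version of the
  integral.\<close>

lemma stochastic_integral_at_0:
  assumes "has_stochastic_integral M \<gamma> e \<beta> 0 \<Phi> X"
  shows "AE \<omega> in M. X \<omega> = 0"
proof -
  from assms obtain N p A where X [measurable]: "X \<in> borel_measurable M"
    and part: "\<And>m. partition (N m) (p m) 0"
    and lim: "(\<lambda>m. \<integral>\<^sup>+\<omega>. ennreal ((norm (step_integral W (N m) (p m) (A m) \<omega> - X \<omega>))\<^sup>2) \<partial>M) \<longlonglongrightarrow> 0"
    unfolding has_stochastic_integral_def by blast
  have zero: "step_integral W (N m) (p m) (A m) \<omega> = 0" for m \<omega>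
    unfolding step_integral_def
  proof (rule sum.neutral, rule ballI)
    fix j assume "j \<in> {..<N m}"
    then have "p m j = 0" "p m (Suc j) = 0"
      using partition_bounds[OF part, of _ m] by (auto intro!: antisym)
    then show "blinfun_apply (A m j) (W (p m (Suc j)) \<omega> - W (p m j) \<omega>) = 0"
      by (simp add: blinfun.zero_right)
  qed
  have "(\<integral>\<^sup>+\<omega>. ennreal ((norm (X \<omega>))\<^sup>2) \<partial>M) = 0"
    using lim by (simp add: zero LIMSEQ_const_iff)
  then show ?thesis
    by (subst (asm) nn_integral_0_iff_AE) auto
qed

text \<open>
  In the interaction picture $v(t) = S(-t)u(t)$ the free evolution drops out and $v$ is the sum of an
  absolutely continuous drift, pointwise orthogonal to $v$, and a process with \<^const>\<open>increment\<close>s.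
\<close>

lemma exact_solution_mass:
  assumes u0: "integrable M (\<lambda>\<omega>. mass (u\<^sub>0 \<omega>))" "u\<^sub>0 \<in> borel_measurable (F 0)"
    and mild: "mild_solution M F \<gamma> e \<beta> \<alpha> V u\<^sub>0 u" and t: "0 \<le> t"
  shows "integrable M (\<lambda>\<omega>. mass (u t \<omega>))"
    and "(\<integral>\<omega>. mass (u t \<omega>) \<partial>M) = (\<integral>\<omega>. mass (u\<^sub>0 \<omega>) \<partial>M) + t * \<kappa>"
proof -
  define f where "f s \<omega> = nonlinearity V (u s \<omega>)" for s \<omega>
  from mild obtain Z where uF: "\<And>t. 0 \<le> t \<Longrightarrow> u t \<in> borel_measurable (F t)"
    and ucont: "\<And>\<omega>. \<omega> \<in> space M \<Longrightarrow> continuous_on {0..} (\<lambda>t. u t \<omega>)"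
    and Z: "\<And>t. 0 \<le> t \<Longrightarrow> has_stochastic_integral M \<gamma> e \<beta> t (\<lambda>s. schroedinger_group (t - s)) (Z t)"
    and eq: "AE \<omega> in M. (\<forall>T\<ge>0. set_integrable lebesgue {0..T} (\<lambda>s. f s \<omega>)) \<and>
        (\<forall>t\<ge>0. u t \<omega> = schroedinger_group t (u\<^sub>0 \<omega>)
          - \<i> *\<^sub>C (LINT s:{0..t}|lebesgue. schroedinger_group (t - s) (f s \<omega>))
          - (\<i> * complex_of_real \<alpha>) *\<^sub>C Z t \<omega>)"
    unfolding mild_solution_def f_def by auto
  define v where "v t \<omega> = schroedinger_group (- t) (u t \<omega>)" for t \<omega>
  define g where "g \<omega> s = - (\<i> *\<^sub>C schroedinger_group (- s) (f s \<omega>))" for \<omega> s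
  have nv: "(norm (v t \<omega>))\<^sup>2 = mass (u t \<omega>)" for t \<omega>
    by (simp add: v_def mass_def)
  have vF: "v t \<in> borel_measurable (F t)" if "0 \<le> t" for t
    unfolding v_def[abs_def] by (rule measurable_compose[OF uF[OF that] borel_measurable_schroedinger])
  have g_int: "set_integrable lebesgue A (g \<omega>)" if "set_integrable lebesgue A (\<lambda>s. f s \<omega>)" for A \<omega>
  proof -
    have "set_integrable lebesgue A (\<lambda>s. schroedinger_group (- s) (f s \<omega>))"
      using set_integrable_schroedinger[OF that, of 0] by simp
    then have "integrable lebesgue (\<lambda>s. - (\<i> *\<^sub>C (indicator A s *\<^sub>R schroedinger_group (- s) (f s \<omega>))))"
      unfolding set_integrable_def
      by (intro Bochner_Integration.integrable_minus integrable_bounded_linear[OF bounded_linear_scaleC])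
    then show ?thesis
      by (simp add: set_integrable_def g_def linear_scale[OF bounded_linear.linear[OF bounded_linear_scaleC]])
  qed
  \<comment> \<open>S(-t) cancels S(t) in front of the initial value and turns S(t - s) into S(-s)
    under the integral, which leaves an integrand independent of t.\<close>
  have v_eq: "v t \<omega> = u\<^sub>0 \<omega> + (LINT s:{0..t}|lebesgue. g \<omega> s) + U t (Z t \<omega>)"
    if int: "set_integrable lebesgue {0..t} (\<lambda>s. f s \<omega>)"
      and u: "u t \<omega> = schroedinger_group t (u\<^sub>0 \<omega>)
          - \<i> *\<^sub>C (LINT s:{0..t}|lebesgue. schroedinger_group (t - s) (f s \<omega>))
          - (\<i> * complex_of_real \<alpha>) *\<^sub>C Z t \<omega>" for t \<omega>
  proof -
    let ?R = "\<lambda>x. - (\<i> *\<^sub>C schroedinger_group (- t) x)"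
    have R: "bounded_linear ?R"
      by (intro bounded_linear_minus bounded_linear_compose[OF bounded_linear_scaleC bounded_linear_schroedinger])
    have "(LINT s:{0..t}|lebesgue. g \<omega> s) = ?R (LINT s:{0..t}|lebesgue. schroedinger_group (t - s) (f s \<omega>))"
      by (subst bounded_linear_set_integral[OF R set_integrable_schroedinger[OF int]])
        (simp add: g_def[abs_def] schroedinger_group_add)
    moreover have "v t \<omega> = u\<^sub>0 \<omega> - \<i> *\<^sub>C schroedinger_group (- t) (LINT s:{0..t}|lebesgue. schroedinger_group (t - s) (f s \<omega>))
        - (\<i> * complex_of_real \<alpha>) *\<^sub>C schroedinger_group (- t) (Z t \<omega>)"
      unfolding v_def u by (simp add: schroedinger_diff schroedinger_group_scaleC schroedinger_group_add)
    ultimately show ?thesis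
      by (simp add: U_def rot_def scaleC_minus_left)
  qed
  \<comment> \<open>S(-s) is unitary and commutes with multiplication by i, so up to sign this is
    the product of u with i F(u).\<close>
  have orth: "inner (v s \<omega>) (g \<omega> s) = 0" for s \<omega>
    by (simp add: v_def g_def f_def schroedinger_group_scaleC[symmetric] inner_nonlinearity)
  have "\<exists>D. increment 9 a b D \<and> (AE \<omega> in M. U b (Z b \<omega>) - U a (Z a \<omega>) = D \<omega>)" if "0 \<le> a" "a \<le> b" for a b
    using stochastic_convolution_increment[OF that Z Z] that by simp
  note ex = this
  \<comment> \<open>One increment is chosen for each pair of times, so that \<open>D\<close> is a
    fixed family before any null set is discarded.\<close>
  define DD where "DD a b = (SOME D. increment 9 a b D \<and> (AE \<omega> in M. U b (Z b \<omega>) - U a (Z a \<omega>) = D \<omega>))" for a b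
  have DD: "increment 9 a b (DD a b)" "AE \<omega> in M. U b (Z b \<omega>) - U a (Z a \<omega>) = DD a b \<omega>"
    if "0 \<le> a" "a \<le> b" for a b
    using someI_ex[OF ex[OF that]] unfolding DD_def by blast+
  define D where "D t n j = DD (grid 0 t n j) (grid 0 t n (Suc j))" for t n j
  have D: "increment 9 (grid 0 t n j) (grid 0 t n (Suc j)) (D t n j)" if "0 \<le> t" for t n j
    unfolding D_def using grid_simps(3,4)[OF that] by (intro DD)
  have rem: "AE \<omega> in M. (\<lambda>n. \<Sum>j<Suc n.
      \<bar>(norm (v (grid 0 t n (Suc j)) \<omega>))\<^sup>2 - (norm (v (grid 0 t n j) \<omega>))\<^sup>2
        - 2 * inner (v (grid 0 t n j) \<omega>) (D t n j \<omega>) - (norm (D t n j \<omega>))\<^sup>2\<bar>) \<longlonglongrightarrow> 0" if t: "0 \<le> t" for t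
  proof -
    note G = grid_simps[OF t]
    \<comment> \<open>Each identity holds off a null set that depends on the pair of times; only
      countably many grid pairs occur.\<close>
    have "AE \<omega> in M. \<forall>n j. U (grid 0 t n (Suc j)) (Z (grid 0 t n (Suc j)) \<omega>) - U (grid 0 t n j) (Z (grid 0 t n j) \<omega>) = D t n j \<omega>"
      unfolding AE_all_countable D_def
    proof (intro allI)
      fix n j
      show "AE \<omega> in M. U (grid 0 t n (Suc j)) (Z (grid 0 t n (Suc j)) \<omega>) - U (grid 0 t n j) (Z (grid 0 t n j) \<omega>)
          = DD (grid 0 t n j) (grid 0 t n (Suc j)) \<omega>"
        by (rule DD(2)[OF G(4,3)])
    qed
    with eq AE_space show ?thesis
    proof eventually_elim
      case (elim \<omega>)
      have fi: "set_integrable lebesgue {0..T} (\<lambda>s. f s \<omega>)" if "0 \<le> T" for T using elim that by blast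
      have ve: "v T \<omega> = u\<^sub>0 \<omega> + (LINT s:{0..T}|lebesgue. g \<omega> s) + U T (Z T \<omega>)" if "0 \<le> T" for T
        using elim that by (intro v_eq) auto
      have "continuous_on {0..t} (\<lambda>s. u s \<omega>)"
        by (rule continuous_on_subset[OF ucont]) (use elim in auto)
      then have "continuous_on {0..t} (\<lambda>s. (- s, u s \<omega>))"
        by (intro continuous_intros)
      then have vc: "continuous_on {0..t} (\<lambda>s. v s \<omega>)"
        using continuous_on_compose2[OF continuous_on_schroedinger] by (fastforce simp: v_def)
      show ?case
      proof (rule drift_remainder_tendsto[OF t vc g_int[OF fi[OF t]] orth])
        fix n j
        let ?a = "grid 0 t n j" and ?b = "grid 0 t n (Suc j)"
        have ab: "0 \<le> ?a" "?a \<le> ?b" using G by auto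
        then have un: "{0..?b} = {0..?a} \<union> {?a<..?b}" by auto
        have sub: "set_integrable lebesgue {?a<..?b} (g \<omega>)"
          by (rule set_integrable_subset[OF g_int[OF fi[of ?b]]]) (use ab in auto)
        have "(LINT s:{0..?b}|lebesgue. g \<omega> s) = (LINT s:{0..?a}|lebesgue. g \<omega> s) + (LINT s:{?a<..?b}|lebesgue. g \<omega> s)"
          unfolding un by (rule set_integral_Un[OF _ g_int[OF fi[OF ab(1)]] sub]) auto
        moreover have "U ?b (Z ?b \<omega>) - U ?a (Z ?a \<omega>) = D t n j \<omega>" using elim by blast
        ultimately show "D t n j \<omega> = v ?b \<omega> - v ?a \<omega> - (LINT s:{?a<..?b}|lebesgue. g \<omega> s)"
          using ve[of ?a] ve[of ?b] ab by simp
      qed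
    qed
  qed
  \<comment> \<open>At time 0 the drift integral runs over a null set and the stochastic integral
    vanishes almost surely, so v agrees with the initial value up to a null set.\<close>
  have v0: "AE \<omega> in M. (norm (v 0 \<omega>))\<^sup>2 = mass (u\<^sub>0 \<omega>)"
    using eq stochastic_integral_at_0[OF Z[OF order_refl]]
  proof eventually_elim
    case (elim \<omega>)
    have "(LINT s:{0..0}|lebesgue. g \<omega> s) = 0"
      unfolding set_lebesgue_integral_def
    proof (rule integral_eq_zero_AE)
      have "AE s in lebesgue. s \<noteq> (0 :: real)"
        using AE_lborel_singleton by (rule AE_completion)
      then show "AE s in lebesgue. indicator {0..0} s *\<^sub>R g \<omega> s = 0"
        by eventually_elim (simp add: indicator_def)
    qed
    moreover have "v 0 \<omega> = u\<^sub>0 \<omega> + (LINT s:{0..0}|lebesgue. g \<omega> s) + U 0 (Z 0 \<omega>)"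
      using elim by (intro v_eq) blast+
    ultimately show ?case
      using elim by (simp add: mass_def)
  qed
  have [measurable]: "v 0 \<in> borel_measurable M" "u\<^sub>0 \<in> borel_measurable M"
    using measurable_F_M[OF order_refl vF] measurable_F_M[OF order_refl u0(2)] by auto
  have mm: "(\<lambda>\<omega>. mass (u\<^sub>0 \<omega>)) \<in> borel_measurable M" unfolding mass_def by measurable
  have v0i: "integrable M (\<lambda>\<omega>. (norm (v 0 \<omega>))\<^sup>2)"
    using u0(1) integrable_cong_AE[OF _ mm v0] by simp
  have v0e: "(\<integral>\<omega>. (norm (v 0 \<omega>))\<^sup>2 \<partial>M) = (\<integral>\<omega>. mass (u\<^sub>0 \<omega>) \<partial>M)"
    using integral_cong_AE[OF _ mm v0] by simp
  show "integrable M (\<lambda>\<omega>. mass (u t \<omega>))"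
    using mass_le(1)[OF vF v0i D rem t] by (simp add: nv)
  show "(\<integral>\<omega>. mass (u t \<omega>) \<partial>M) = (\<integral>\<omega>. mass (u\<^sub>0 \<omega>) \<partial>M) + t * \<kappa>"
    using mass_balance[OF vF v0i D rem t] v0e by (simp add: nv)
qed

text \<open>Measurability at t_n is part of the induction, since the noise of the next step is
  orthogonal only to variables of the past; measurability of the flow enters here.\<close>

lemma splitting_scheme_mass:
  assumes \<tau>: "0 < \<tau>" and u0: "integrable M (\<lambda>\<omega>. mass (u\<^sub>0 \<omega>))" "u\<^sub>0 \<in> borel_measurable (F 0)"
    and V: "\<And>v. V v \<in> borel_measurable torus" and flow: "\<And>t. phase_flow V t \<in> borel_measurable borel"
  shows "splitting_scheme \<gamma> e \<beta> \<alpha> V \<tau> u\<^sub>0 n \<in> borel_measurable (F (real n * \<tau>)) \<and>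
    integrable M (\<lambda>\<omega>. mass (splitting_scheme \<gamma> e \<beta> \<alpha> V \<tau> u\<^sub>0 n \<omega>)) \<and>
    (\<integral>\<omega>. mass (splitting_scheme \<gamma> e \<beta> \<alpha> V \<tau> u\<^sub>0 n \<omega>) \<partial>M) = (\<integral>\<omega>. mass (u\<^sub>0 \<omega>) \<partial>M) + real n * \<tau> * \<kappa>"
proof (induction n)
  case 0
  have "splitting_scheme \<gamma> e \<beta> \<alpha> V \<tau> u\<^sub>0 0 = u\<^sub>0" by (rule ext) simp
  then show ?case using u0 by simp
next
  case (Suc n)
  define s t where "s = real n * \<tau>" and "t = real (Suc n) * \<tau>"
  have st: "0 \<le> s" "s \<le> t" "t - s = \<tau>"
    using \<tau> by (auto simp: s_def t_def algebra_simps)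
  define w where "w = splitting_scheme \<gamma> e \<beta> \<alpha> V \<tau> u\<^sub>0 n"
  define X where "X \<omega> = phase_flow V \<tau> (w \<omega>)" for \<omega>
  define D where "D \<omega> = rot (dW s t \<omega>)" for \<omega>
  have D: "increment 3 s t D"
    unfolding D_def[abs_def] by (rule increment_base[OF st(1,2) bounded_linear_rot norm_rot])
  have w: "w \<in> borel_measurable (F s)" "integrable M (\<lambda>\<omega>. mass (w \<omega>))"
    "(\<integral>\<omega>. mass (w \<omega>) \<partial>M) = (\<integral>\<omega>. mass (u\<^sub>0 \<omega>) \<partial>M) + s * \<kappa>"
    using Suc unfolding w_def s_def by auto
  have X: "X \<in> borel_measurable (F s)"
    unfolding X_def[abs_def] by (rule measurable_compose[OF w(1) flow])
  have nX: "(norm (X \<omega>))\<^sup>2 = mass (w \<omega>)" for \<omega>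
    unfolding X_def norm_phase_flow[of V "w \<omega>", OF V] by (simp add: mass_def)
  have next_eq: "splitting_scheme \<gamma> e \<beta> \<alpha> V \<tau> u\<^sub>0 (Suc n) = (\<lambda>\<omega>. schroedinger_group \<tau> (X \<omega> + D \<omega>))"
    by (rule ext) (simp add: X_def D_def w_def rot_def dW_def scaleC_minus_left s_def t_def)
  have m: "(\<lambda>\<omega>. X \<omega> + D \<omega>) \<in> borel_measurable (F t)"
    by (intro borel_measurable_add measurable_F_mono[OF st(1,2) X] increment_measurable_F[OF D])
  have "splitting_scheme \<gamma> e \<beta> \<alpha> V \<tau> u\<^sub>0 (Suc n) \<in> borel_measurable (F t)"
    unfolding next_eq by (rule measurable_compose[OF m borel_measurable_schroedinger])
  moreover have mass_eq: "mass (splitting_scheme \<gamma> e \<beta> \<alpha> V \<tau> u\<^sub>0 (Suc n) \<omega>) = mass (w \<omega>) + (norm (D \<omega>))\<^sup>2 + 2 * inner (X \<omega>) (D \<omega>)" for \<omega>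
    unfolding next_eq mass_def[of "schroedinger_group \<tau> _"] norm_schroedinger_group nX[symmetric]
    by (simp add: power2_norm_eq_inner inner_add_left inner_add_right inner_commute)
  have iX: "integrable M (\<lambda>\<omega>. (norm (X \<omega>))\<^sup>2)" using w(2) by (simp add: nX)
  note cr = increment_cross_L2[OF D X iX]
  note sq = increment_square[OF D]
  have "integrable M (\<lambda>\<omega>. mass (splitting_scheme \<gamma> e \<beta> \<alpha> V \<tau> u\<^sub>0 (Suc n) \<omega>))"
    unfolding mass_eq using w(2) cr sq by simp
  moreover have "(\<integral>\<omega>. mass (splitting_scheme \<gamma> e \<beta> \<alpha> V \<tau> u\<^sub>0 (Suc n) \<omega>) \<partial>M) = (\<integral>\<omega>. mass (u\<^sub>0 \<omega>) \<partial>M) + t * \<kappa>"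
    unfolding mass_eq using w(2,3) cr sq by (simp add: left_diff_distrib)
  ultimately show ?case unfolding t_def by blast
qed

end

theorem proposition6:
  fixes M :: "'a measure" and F :: "real \<Rightarrow> 'a measure"
    and \<gamma> :: "nat \<Rightarrow> complex" and e :: "nat \<Rightarrow> 'n::finite l2_torus"
    and \<beta> :: "nat \<Rightarrow> real \<Rightarrow> 'a \<Rightarrow> real" and \<alpha> :: real
    and V :: "'n l2_torus \<Rightarrow> real ^ 'n \<Rightarrow> real"
    and u\<^sub>0 :: "'a \<Rightarrow> 'n l2_torus" and u :: "real \<Rightarrow> 'a \<Rightarrow> 'n l2_torus"
  assumes "stochastic_basis M F"
    and "complete_orthonormal_system e"
    and "\<And>k. wiener_process M F (\<beta> k)"
    and "prob_space.indep_vars M (\<lambda>_. \<Pi>\<^sub>M t\<in>{0..}. borel) (\<lambda>k \<omega>. \<lambda>t\<in>{0..}. \<beta> k t \<omega>) UNIV"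
    and "summable (\<lambda>k. (cmod (\<gamma> k))\<^sup>2)"
    and "0 < \<alpha>"
    and "u\<^sub>0 \<in> borel_measurable (F 0)"
    and "integrable M (\<lambda>\<omega>. mass (u\<^sub>0 \<omega>))"
    and "\<And>v. V v \<in> borel_measurable torus"
    and "\<And>v w. AE x in torus. cmod (rep_l2_torus v x) = cmod (rep_l2_torus w x)
      \<Longrightarrow> AE x in torus. V v x = V w x"
    and "\<And>t. phase_flow V t \<in> borel_measurable borel"
    and "mild_solution M F \<gamma> e \<beta> \<alpha> V u\<^sub>0 u"
  shows "(\<forall>t\<ge>0. integrable M (\<lambda>\<omega>. mass (u t \<omega>)) \<and>
        (\<integral>\<omega>. mass (u t \<omega>) \<partial>M) = (\<integral>\<omega>. mass (u\<^sub>0 \<omega>) \<partial>M) + t * \<alpha>\<^sup>2 * trace_Q \<gamma>) \<and>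
      (\<forall>\<tau>>0. \<forall>n. integrable M (\<lambda>\<omega>. mass (splitting_scheme \<gamma> e \<beta> \<alpha> V \<tau> u\<^sub>0 n \<omega>)) \<and>
        (\<integral>\<omega>. mass (splitting_scheme \<gamma> e \<beta> \<alpha> V \<tau> u\<^sub>0 n \<omega>) \<partial>M)
          = (\<integral>\<omega>. mass (u\<^sub>0 \<omega>) \<partial>M) + (real n * \<tau>) * \<alpha>\<^sup>2 * trace_Q \<gamma>)"
proof -
  interpret prob_space M
    using assms(1) by (simp add: stochastic_basis_def)
  interpret noise M F \<gamma> e \<beta> \<alpha>
    by unfold_locales (fact assms)+
  show ?thesis
    using exact_solution_mass[OF assms(8,7,12)] splitting_scheme_mass[OF _ assms(8,7,9,11)]
    by (simp add: \<kappa>_def mult.assoc)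
qed

end
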